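(* Let $X$ be a finite connected CW complex of dimension $d\ge 1$ and let $r\colon X_d\to\mathbb{R}_{+}$, $b\mapsto r_b$, be a positive function on the set of $d$-cells. Given a vector $\mathbf{V}\in C_d(X;\mathbb{R})$, there is exactly one vector $z\in Z_d(X;\mathbb{R})$ such that $\mathbf{V}-Rz\in B^d(X;\mathbb{R})$. Furthermore, for each $d$-cell $b$, we have $$\langle z,b\rangle=\frac{1}{\Delta}\sum_T\frac{w_T}{r_b}\,\langle \mathbf{V},\bar T(b)\rangle,$$ where the sum is over all spanning trees $T$ of $X$ and $\Delta=\sum_T w_T$.
   Context: Notation. $X_k$ is the set of $k$-cells of $X$, $X^{(k)}$ its $k$-skeleton, $C_k(X;A)$ the cellular chain group (free $A$-module on $X_k$), $\partial$ the cellular boundary, $Z_k(X;A)$ the $k$-cycles; all homology is cellular, and $\beta_k$ denotes the $k$-th Betti number. The standard inner product $\langle\ ,\ \rangle$ on $C_k(X;\mathbb{R})$ is the one for which $X_k$ is an orthonormal basis. $R\colon C_d(X;\mathbb{R})\to C_d(X;\mathbb{R})$ is the linear map with $R(b)=r_b b$ for $b\in X_d$. $\partial^*\colon C_{d-1}(X;\mathbb{R})\to C_d(X;\mathbb{R})$ is the adjoint of $\partial$ with respect to the standard inner products, and $B^d(X;\mathbb{R})$ is the image of $\partial^*$. Spanning tree. A spanning tree for $X$ is a subcomplex $T\subset X$ such that $H_d(T;\mathbb{Z})=0$, $\beta_{d-1}(T)=\beta_{d-1}(X)$, and $X^{(d-1)}\subset T$. $T_d$ denotes the set of $d$-cells of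 $T$. The map $\bar T$. For a spanning tree $T$, the linear map $\bar T\colon C_d(X;\mathbb{R})\to Z_d(X;\mathbb{R})$ is defined on $d$-cells by: $\bar T(b)=0$ if $b\in T_d$; if $b\notin T_d$, then $H_d(T\cup b;\mathbb{Z})=Z_d(T\cup b;\mathbb{Z})\subset C_d(X;\mathbb{R})$ is infinite cyclic, and with a generator $c$ and $t_b=\langle c,b\rangle\neq 0$ one sets $\bar T(b)=c/t_b$ (independent of the choice of $c$). Weights. $\theta_T$ is the order of the torsion subgroup of $H_{d-1}(T;\mathbb{Z})$, and $w_T=\theta_T^2\prod_{b\in T_d} r_b^{-1}$. *)

theory Defs
  imports "HOL-Homology.Homology" "HOL-Analysis.Analysis"
begin

section \<open>CW complexes\<close>

definition disk :: "nat \<Rightarrow> (nat \<Rightarrow> real) topology" where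
  "disk n = subtopology (Euclidean_space n) {x. (\<Sum>i<n. (x i)\<^sup>2) \<le> 1}"

definition open_disk :: "nat \<Rightarrow> (nat \<Rightarrow> real) set" where
  "open_disk n = {x \<in> topspace (disk n). (\<Sum>i<n. (x i)\<^sup>2) < 1}"

text \<open>For \<open>n = 0\<close> this set is empty.\<close>

definition disk_sphere :: "nat \<Rightarrow> (nat \<Rightarrow> real) set" where
  "disk_sphere n = {x \<in> topspace (disk n). (\<Sum>i<n. (x i)\<^sup>2) = 1}"

text \<open>Cells are indexed by the elements of \<open>cw_cells\<close>; the cell with index \<open>e\<close> has dimension
  \<open>cw_dim e\<close> and characteristic map \<open>cw_char e\<close>, defined on the closed disk.\<close>

record ('p, 'c) cw =
  cw_space :: "'p topology"
  cw_cells :: "'c set"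
  cw_dim :: "'c \<Rightarrow> nat"
  cw_char :: "'c \<Rightarrow> (nat \<Rightarrow> real) \<Rightarrow> 'p"

definition open_cell :: "('p, 'c) cw \<Rightarrow> 'c \<Rightarrow> 'p set" where
  "open_cell K e = cw_char K e ` open_disk (cw_dim K e)"

definition cw_complex :: "('p, 'c) cw \<Rightarrow> bool" where
  "cw_complex K \<longleftrightarrow>
     Hausdorff_space (cw_space K) \<and>
     topspace (cw_space K) = (\<Union>e\<in>cw_cells K. open_cell K e) \<and>
     (\<forall>e\<in>cw_cells K. \<forall>f\<in>cw_cells K. e \<noteq> f \<longrightarrow> open_cell K e \<inter> open_cell K f = {}) \<and>
     (\<forall>e\<in>cw_cells K.
        continuous_map (disk (cw_dim K e)) (cw_space K) (cw_char K e) \<and>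
        homeomorphic_map (subtopology (disk (cw_dim K e)) (open_disk (cw_dim K e)))
          (subtopology (cw_space K) (open_cell K e)) (cw_char K e) \<and>
        (\<exists>F. finite F \<and> F \<subseteq> {f \<in> cw_cells K. cw_dim K f < cw_dim K e} \<and>
             cw_char K e ` disk_sphere (cw_dim K e) \<subseteq> (\<Union>f\<in>F. open_cell K f))) \<and>
     (\<forall>A \<subseteq> topspace (cw_space K).
        closedin (cw_space K) A \<longleftrightarrow>
        (\<forall>e\<in>cw_cells K. closedin (disk (cw_dim K e))
           {x \<in> topspace (disk (cw_dim K e)). cw_char K e x \<in> A}))"

text \<open>Degrees are integers, so that \<open>k - 1\<close> makes sense for \<open>k = 0\<close>.\<close>

definition cells_of :: "('p, 'c) cw \<Rightarrow> int \<Rightarrow> 'c set" where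
  "cells_of K k = {e \<in> cw_cells K. int (cw_dim K e) = k}"

definition has_dimension :: "('p, 'c) cw \<Rightarrow> nat \<Rightarrow> bool" where
  "has_dimension K d \<longleftrightarrow>
     (\<forall>e\<in>cw_cells K. cw_dim K e \<le> d) \<and> (\<exists>e\<in>cw_cells K. cw_dim K e = d)"

definition skeleton_cells :: "('p, 'c) cw \<Rightarrow> int \<Rightarrow> 'c set" where
  "skeleton_cells K k = {e \<in> cw_cells K. int (cw_dim K e) \<le> k}"

definition skeleton :: "('p, 'c) cw \<Rightarrow> int \<Rightarrow> 'p set" where
  "skeleton K k = (\<Union>e\<in>skeleton_cells K k. open_cell K e)"

definition subcomplex :: "('p, 'c) cw \<Rightarrow> 'c set \<Rightarrow> bool" where
  "subcomplex K T \<longleftrightarrow>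
     T \<subseteq> cw_cells K \<and> closedin (cw_space K) (\<Union>e\<in>T. open_cell K e)"

text \<open>The union of the cells in \<open>T\<close>, as a CW complex in its own right.\<close>

definition restrict_cw :: "('p, 'c) cw \<Rightarrow> 'c set \<Rightarrow> ('p, 'c) cw" where
  "restrict_cw K T =
     K\<lparr>cw_space := subtopology (cw_space K) (\<Union>e\<in>T. open_cell K e), cw_cells := T\<rparr>"


section \<open>The cellular chain complex\<close>

text \<open>The cellular boundary is defined through singular homology: it is the map
  \<open>H\<^sub>k(X\<^sup>k, X\<^sup>k\<^sup>-\<^sup>1) \<rightarrow> H\<^sub>k\<^sub>-\<^sub>1(X\<^sup>k\<^sup>-\<^sup>1, X\<^sup>k\<^sup>-\<^sup>2)\<close> of the triple (\<open>hom_relboundary\<close>), written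
  in the bases given by the cells. The class of a cell is the image under its characteristic map
  of a generator of \<open>H\<^sub>k(D\<^sup>k, S\<^sup>k\<^sup>-\<^sup>1)\<close>, fixed once and for all for every \<open>k\<close>.\<close>

definition disk_class :: "nat \<Rightarrow> (nat \<Rightarrow> real) chain set" where
  "disk_class n =
     (SOME g. g \<in> carrier (relative_homology_group (int n) (disk n) (disk_sphere n)) \<and>
        generate (relative_homology_group (int n) (disk n) (disk_sphere n)) {g} =
        carrier (relative_homology_group (int n) (disk n) (disk_sphere n)))"

definition skeleton_homology :: "('p, 'c) cw \<Rightarrow> int \<Rightarrow> 'p chain set monoid" where
  "skeleton_homology K k =
     relative_homology_group k (subtopology (cw_space K) (skeleton K k)) (skeleton K (k - 1))"

definition skeleton_boundary :: "('p, 'c) cw \<Rightarrow> int \<Rightarrow> 'p chain set \<Rightarrow> 'p chain set" where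
  "skeleton_boundary K k =
     hom_relboundary k (subtopology (cw_space K) (skeleton K k))
       (skeleton K (k - 1)) (skeleton K (k - 2))"

definition cell_class :: "('p, 'c) cw \<Rightarrow> 'c \<Rightarrow> 'p chain set" where
  "cell_class K e =
     (let n = cw_dim K e in
      hom_induced (int n) (disk n) (disk_sphere n)
        (subtopology (cw_space K) (skeleton K (int n))) (skeleton K (int n - 1))
        (cw_char K e) (disk_class n))"

text \<open>The integer coefficients of \<open>\<partial>e\<close>. This definition and the following ones are meant for
  finite complexes, for which all sums over cells are finite and the free module on the
  \<open>k\<close>-cells consists of all functions supported on them.\<close>

definition incidence :: "('p, 'c) cw \<Rightarrow> 'c \<Rightarrow> 'c \<Rightarrow> int" where
  "incidence K e =
     (let k = int (cw_dim K e) in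
      THE n. (\<forall>f. f \<notin> cells_of K (k - 1) \<longrightarrow> n f = 0) \<and>
        skeleton_boundary K k (cell_class K e) =
          (\<Otimes>\<^bsub>skeleton_homology K (k - 1)\<^esub> f\<in>cells_of K (k - 1).
             cell_class K f [^]\<^bsub>skeleton_homology K (k - 1)\<^esub> n f))"

definition cell_chains :: "('p, 'c) cw \<Rightarrow> int \<Rightarrow> ('c \<Rightarrow> 'a::zero) set" where
  "cell_chains K k = {c. \<forall>e. e \<notin> cells_of K k \<longrightarrow> c e = 0}"

definition boundary :: "('p, 'c) cw \<Rightarrow> int \<Rightarrow> ('c \<Rightarrow> 'a::comm_ring_1) \<Rightarrow> 'c \<Rightarrow> 'a" where
  "boundary K k c =
     (\<lambda>f. if f \<in> cells_of K (k - 1)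
           then \<Sum>e\<in>cells_of K k. c e * of_int (incidence K e f) else 0)"

definition cycles :: "('p, 'c) cw \<Rightarrow> int \<Rightarrow> ('c \<Rightarrow> 'a::comm_ring_1) set" where
  "cycles K k = {c \<in> cell_chains K k. boundary K k c = (\<lambda>_. 0)}"

definition boundaries :: "('p, 'c) cw \<Rightarrow> int \<Rightarrow> ('c \<Rightarrow> 'a::comm_ring_1) set" where
  "boundaries K k = boundary K (k + 1) ` cell_chains K (k + 1)"

definition cycle_group :: "('p, 'c) cw \<Rightarrow> int \<Rightarrow> ('c \<Rightarrow> int) monoid" where
  "cycle_group K k =
     \<lparr>carrier = cycles K k, monoid.mult = (\<lambda>c c' e. c e + c' e), one = (\<lambda>_. 0)\<rparr>"

text \<open>\<open>H\<^sub>k(K; \<int>)\<close>, written multiplicatively.\<close>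

definition cellular_homology :: "('p, 'c) cw \<Rightarrow> int \<Rightarrow> ('c \<Rightarrow> int) set monoid" where
  "cellular_homology K k = cycle_group K k Mod boundaries K k"

definition int_independent :: "('g, 'm) monoid_scheme \<Rightarrow> 'g set \<Rightarrow> bool" where
  "int_independent G S \<longleftrightarrow>
     (\<forall>n::'g \<Rightarrow> int. (\<Otimes>\<^bsub>G\<^esub> x\<in>S. x [^]\<^bsub>G\<^esub> n x) = \<one>\<^bsub>G\<^esub> \<longrightarrow> (\<forall>x\<in>S. n x = 0))"

definition abelian_rank :: "('g, 'm) monoid_scheme \<Rightarrow> nat" where
  "abelian_rank G = Max {card S | S. finite S \<and> S \<subseteq> carrier G \<and> int_independent G S}"

definition betti :: "('p, 'c) cw \<Rightarrow> int \<Rightarrow> nat" where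
  "betti K k = abelian_rank (cellular_homology K k)"

definition torsion_subgroup :: "('g, 'm) monoid_scheme \<Rightarrow> 'g set" where
  "torsion_subgroup G = {x \<in> carrier G. \<exists>n::nat. n > 0 \<and> x [^]\<^bsub>G\<^esub> n = \<one>\<^bsub>G\<^esub>}"


section \<open>Real chains\<close>

definition cell_vector :: "'c \<Rightarrow> 'c \<Rightarrow> real" where
  "cell_vector b = (\<lambda>e. if e = b then 1 else 0)"

definition chain_inner :: "('p, 'c) cw \<Rightarrow> int \<Rightarrow> ('c \<Rightarrow> real) \<Rightarrow> ('c \<Rightarrow> real) \<Rightarrow> real" where
  "chain_inner K k x y = (\<Sum>e\<in>cells_of K k. x e * y e)"

text \<open>The adjoint \<open>\<partial>\<^sup>*: C\<^sub>k\<^sub>-\<^sub>1 \<rightarrow> C\<^sub>k\<close> of \<open>boundary K k\<close>, and its image.\<close>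

definition boundary_adjoint :: "('p, 'c) cw \<Rightarrow> int \<Rightarrow> ('c \<Rightarrow> real) \<Rightarrow> 'c \<Rightarrow> real" where
  "boundary_adjoint K k y =
     (THE x. x \<in> cell_chains K k \<and>
        (\<forall>c\<in>cell_chains K k. chain_inner K k c x = chain_inner K (k - 1) (boundary K k c) y))"

definition coboundaries :: "('p, 'c) cw \<Rightarrow> int \<Rightarrow> ('c \<Rightarrow> real) set" where
  "coboundaries K k = boundary_adjoint K k ` cell_chains K (k - 1)"

definition resistance_map ::
  "('p, 'c) cw \<Rightarrow> nat \<Rightarrow> ('c \<Rightarrow> real) \<Rightarrow> ('c \<Rightarrow> real) \<Rightarrow> 'c \<Rightarrow> real" where
  "resistance_map K d r x = (\<lambda>b. if b \<in> cells_of K d then r b * x b else 0)"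


section \<open>Spanning trees\<close>

definition spanning_tree :: "('p, 'c) cw \<Rightarrow> nat \<Rightarrow> 'c set \<Rightarrow> bool" where
  "spanning_tree K d T \<longleftrightarrow>
     subcomplex K T \<and>
     trivial_group (cellular_homology (restrict_cw K T) d) \<and>
     betti (restrict_cw K T) (int d - 1) = betti K (int d - 1) \<and>
     skeleton_cells K (int d - 1) \<subseteq> T"

text \<open>The value \<open>c / t\<^sub>b\<close> of the tree map on a \<open>d\<close>-cell \<open>b\<close> outside \<open>T\<close>, and 0 on the cells
  of \<open>T\<close>.\<close>

definition tree_cycle :: "('p, 'c) cw \<Rightarrow> nat \<Rightarrow> 'c set \<Rightarrow> 'c \<Rightarrow> 'c \<Rightarrow> real" where
  "tree_cycle K d T b =
     (if b \<in> T then (\<lambda>_. 0)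
      else let Z = cycle_group (restrict_cw K (insert b T)) d;
               c = (SOME c. c \<in> carrier Z \<and> generate Z {c} = carrier Z);
               t = chain_inner K d (\<lambda>e. real_of_int (c e)) (cell_vector b)
           in (\<lambda>e. real_of_int (c e) / t))"

definition tree_map ::
  "('p, 'c) cw \<Rightarrow> nat \<Rightarrow> 'c set \<Rightarrow> ('c \<Rightarrow> real) \<Rightarrow> 'c \<Rightarrow> real" where
  "tree_map K d T x = (\<lambda>e. \<Sum>b\<in>cells_of K d. x b * tree_cycle K d T b e)"

definition torsion_weight :: "('p, 'c) cw \<Rightarrow> nat \<Rightarrow> 'c set \<Rightarrow> nat" where
  "torsion_weight K d T =
     card (torsion_subgroup (cellular_homology (restrict_cw K T) (int d - 1)))"

definition tree_weight :: "('p, 'c) cw \<Rightarrow> nat \<Rightarrow> ('c \<Rightarrow> real) \<Rightarrow> 'c set \<Rightarrow> real" where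
  "tree_weight K d r T =
     (real (torsion_weight K d T))\<^sup>2 * (\<Prod>b\<in>cells_of (restrict_cw K T) d. inverse (r b))"

definition total_tree_weight :: "('p, 'c) cw \<Rightarrow> nat \<Rightarrow> ('c \<Rightarrow> real) \<Rightarrow> real" where
  "total_tree_weight K d r = (\<Sum>T | spanning_tree K d T. tree_weight K d r T)"

end

theory Submission
  imports Defs
begin

text \<open>
The equation asks for a cycle \<open>z\<close> such that \<open>V - R z\<close> is a coboundary, that is, orthogonal to all cycles. So \<open>z\<close>
is the orthogonal projection of \<open>R\<^sup>-\<^sup>1 V\<close> to the cycles with respect to the inner product with weights
\<open>r\<close>, and both assertions follow once this projection is known to be the average \<open>P\<close> of the tree maps
with weights \<open>w\<^sub>T / \<Delta>\<close>.

Each tree map sends chains to cycles and fixes all cycles, because a cycle on a tree is zero; hence so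
does \<open>P\<close> (\<open>fundamental_cycle_retraction\<close>). What remains is that \<open>P\<close> is self-adjoint, and this is proved by exchange
(\<open>weighted_fundamental_cycle_symmetric\<close>). If \<open>T\<close> contributes to the matrix entry at \<open>(b, b')\<close>, then \<open>T'\<close>, which is \<open>T\<close> with
\<open>b'\<close> replaced by \<open>b\<close>, contributes to the entry at \<open>(b', b)\<close>. Both trees have the same extension
\<open>U\<close> by one cell, with the same circuit \<open>c\<close>. Passing from \<open>T\<close> to \<open>U\<close> divides the order of the torsion group by the absolute
value of the coefficient \<open>c b\<close> (\<open>theta_insert\<close>), and in the same way for \<open>T'\<close> and \<open>c b'\<close>; so the squares of
the torsion numbers in the weights compensate exactly for the quotients \<open>c b' / c b\<close> and \<open>c b / c b'\<close> in
the tree maps (\<open>exchange_weight\<close>). That \<open>\<Delta>\<close> is positive needs the existence of a tree and finiteness of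
the torsion groups (\<open>max_forest_exists\<close>, \<open>theta_pos\<close>).

This argument is carried out for an integer matrix and a lattice of cycles containing all boundaries. Two
things link it to CW complexes. The algebraic one is that the equality of Betti numbers says
that the top cells of the tree form a maximal set without cycles (\<open>max_forest_iff_rank\<close>). The topological one is
that the incidence numbers, which are defined through singular homology, are well defined, satisfy that
the boundary of a boundary is zero (\<open>incidence_incidence\<close>), and do not change under restriction to a subcomplex
containing the codimension-one skeleton (\<open>incidence_restrict\<close>). For this one needs that the classes of the
\<open>k\<close>-cells are a basis of the homology of the \<open>k\<close>-skeleton relative to the skeleton below
(\<open>cell_classes_generate\<close>, \<open>cell_classes_independent\<close>), which reduces by long exact sequences to the attachment of a single cell
(\<open>cell_attachment.iso_char\<close>), a consequence of excision.
\<close>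

section \<open>Closed disks\<close>

definition disk_norm :: "nat \<Rightarrow> (nat \<Rightarrow> real) \<Rightarrow> real" where
  "disk_norm n x = sqrt (\<Sum>i<n. (x i)\<^sup>2)"

lemma disk_norm_nonneg [simp]: "0 \<le> disk_norm n x"
  by (simp add: disk_norm_def sum_nonneg)

lemma disk_eq_top_of_set:
  "disk n = top_of_set {x. (\<forall>i\<ge>n. x i = 0) \<and> disk_norm n x \<le> 1}"
  by (auto simp: disk_def Euclidean_space_def subtopology_subtopology disk_norm_def Collect_conj_eq
        simp flip: euclidean_product_topology)

lemma topspace_disk: "topspace (disk n) = {x. (\<forall>i\<ge>n. x i = 0) \<and> disk_norm n x \<le> 1}"
  by (simp add: disk_eq_top_of_set)

lemma disk_sphere_eq: "disk_sphere n = {x \<in> topspace (disk n). disk_norm n x = 1}"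
  by (simp add: disk_sphere_def disk_norm_def)

lemma open_disk_eq: "open_disk n = {x \<in> topspace (disk n). disk_norm n x < 1}"
  by (simp add: open_disk_def disk_norm_def)

lemma disk_Un: "topspace (disk n) = disk_sphere n \<union> open_disk n"
  by (auto simp: topspace_disk disk_sphere_eq open_disk_eq)

lemma disk_disjoint: "disk_sphere n \<inter> open_disk n = {}"
  by (auto simp: disk_sphere_eq open_disk_eq)

lemma continuous_on_disk_norm [continuous_intros]: "continuous_on S (disk_norm n)"
  unfolding disk_norm_def
  by (intro continuous_intros continuous_on_product_then_coordinatewise[OF continuous_on_id])

lemma continuous_on_snd_coordinate:
  "continuous_on S (\<lambda>z::real \<times> (nat \<Rightarrow> real). snd z i)"
  by (rule continuous_on_product_then_coordinatewise[OF continuous_on_snd[OF continuous_on_id]])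

lemma disk_norm_divide: "r > 0 \<Longrightarrow> disk_norm n (\<lambda>i. x i / r) = disk_norm n x / r"
  by (simp add: disk_norm_def power_divide real_sqrt_divide flip: sum_divide_distrib)

lemma disk_norm_mult: "r \<ge> 0 \<Longrightarrow> disk_norm n (\<lambda>i. r * x i) = r * disk_norm n x"
  by (simp add: disk_norm_def power_mult_distrib real_sqrt_mult flip: sum_distrib_left)

lemma abs_le_disk_norm: "i < n \<Longrightarrow> \<bar>x i\<bar> \<le> disk_norm n x"
  unfolding disk_norm_def
  by (rule real_le_rsqrt) (use member_le_sum[of i "{..<n}" "\<lambda>i. (x i)\<^sup>2"] in simp)

lemma Hausdorff_space_disk: "Hausdorff_space (disk n)"
  unfolding disk_eq_top_of_set by (simp add: Hausdorff_space_subtopology)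

lemma closed_disk: "closed (topspace (disk n))"
proof -
  have "closed {x::nat \<Rightarrow> real. x i = 0}" for i
    by (intro closed_Collect_eq continuous_on_const continuous_on_product_coordinates)
  then have "closed (\<Inter>i\<in>{n..}. {x::nat \<Rightarrow> real. x i = 0})"
    by auto
  moreover have "closed {x. disk_norm n x \<le> 1}"
    by (intro closed_Collect_le continuous_intros)
  moreover have "topspace (disk n) = (\<Inter>i\<in>{n..}. {x. x i = 0}) \<inter> {x. disk_norm n x \<le> 1}"
    by (auto simp: topspace_disk)
  ultimately show ?thesis
    by (metis closed_Int)
qed

lemma compact_space_disk: "compact_space (disk n)"
proof -
  have "compactin (powertop_real UNIV) (PiE UNIV (\<lambda>i. {-1..1::real}))"
    by (simp add: compactin_PiE)
  moreover have "topspace (disk n) \<subseteq> PiE UNIV (\<lambda>i. {-1..1::real})"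
  proof
    fix x assume "x \<in> topspace (disk n)"
    then have "\<bar>x i\<bar> \<le> 1" for i
      using abs_le_disk_norm[of i n x] by (cases "i < n") (auto simp: topspace_disk)
    then show "x \<in> PiE UNIV (\<lambda>i. {-1..1::real})"
      by (auto simp: abs_le_iff minus_le_iff)
  qed
  ultimately have "compactin euclidean (topspace (disk n))"
    by (metis closed_closedin closed_compactin closed_disk euclidean_product_topology)
  then show ?thesis
    unfolding disk_eq_top_of_set topspace_disk topspace_euclidean_subtopology
    by (rule compact_space_subtopology)
qed

lemma contractible_space_disk: "contractible_space (disk n)"
proof -
  have "continuous_on ({0..1} \<times> topspace (disk n)) (\<lambda>z::real \<times> (nat \<Rightarrow> real). (\<lambda>i. (1 - fst z) * snd z i))"
    by (intro continuous_intros continuous_on_snd_coordinate)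
  moreover have "disk_norm n (\<lambda>i. (1 - t) * x i) \<le> 1" if "0 \<le> t" "t \<le> 1" "disk_norm n x \<le> 1" for t x
    using that by (simp add: disk_norm_mult mult_le_one)
  ultimately have "homotopic_with (\<lambda>x. True) (disk n) (disk n) id (\<lambda>x. (\<lambda>i. 0))"
    unfolding homotopic_with_def
    by (intro exI[of _ "\<lambda>z. (\<lambda>i. (1 - fst z) * snd z i)"])
       (auto simp: disk_eq_top_of_set)
  then show ?thesis
    unfolding contractible_space_def by blast
qed

text \<open>A homotopy of the disk that fixes the boundary sphere and starts at the identity. At time 1 it
divides by the maximum of 1/2 and the norm, so the outer shell, where the norm is at least 1/2, has
been pushed onto the sphere. The shell stays in itself throughout, and the map is defined at the
centre too, so the homotopy extends over any space to which the disk is attached.\<close>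

definition disk_push :: "nat \<Rightarrow> real \<Rightarrow> (nat \<Rightarrow> real) \<Rightarrow> nat \<Rightarrow> real" where
  "disk_push n t y = (\<lambda>i. y i / max (1 - t / 2) (disk_norm n y))"

definition disk_collar :: "nat \<Rightarrow> (nat \<Rightarrow> real) set" where
  "disk_collar n = {x \<in> topspace (disk n). disk_norm n x \<ge> 1 / 2}"

lemma disk_norm_push:
  assumes "t \<le> 1"
  shows "disk_norm n (disk_push n t y) = disk_norm n y / max (1 - t / 2) (disk_norm n y)"
  unfolding disk_push_def using assms by (intro disk_norm_divide) auto

lemma disk_push_0: "y \<in> topspace (disk n) \<Longrightarrow> disk_push n 0 y = y"
  by (auto simp: disk_push_def topspace_disk max_def)

lemma disk_push_sphere: "y \<in> disk_sphere n \<Longrightarrow> 0 \<le> t \<Longrightarrow> disk_push n t y = y"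
  by (auto simp: disk_push_def disk_sphere_eq max_def)

lemma disk_push_in_disk:
  assumes "y \<in> topspace (disk n)" "0 \<le> t" "t \<le> 1"
  shows "disk_push n t y \<in> topspace (disk n)"
proof -
  have "disk_norm n (disk_push n t y) \<le> 1"
    unfolding disk_norm_push[OF assms(3)] using assms by (subst divide_le_eq_1_pos) auto
  with assms show ?thesis by (auto simp: topspace_disk disk_push_def)
qed

lemma disk_push_collar:
  assumes "y \<in> disk_collar n" "0 \<le> t" "t \<le> 1"
  shows "disk_push n t y \<in> disk_collar n"
proof -
  have y: "y \<in> topspace (disk n)" "disk_norm n y \<le> 1" "1/2 \<le> disk_norm n y"
    using assms by (auto simp: disk_collar_def topspace_disk)
  have "max (1 - t / 2) (disk_norm n y) \<le> 1" "max (1 - t / 2) (disk_norm n y) > 0"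
    using y assms by auto
  then have "disk_norm n y / max (1 - t / 2) (disk_norm n y) \<ge> disk_norm n y"
    by (simp add: le_divide_eq mult_left_le)
  then have "disk_norm n (disk_push n t y) \<ge> 1 / 2"
    using y(3) unfolding disk_norm_push[OF assms(3)] by linarith
  then show ?thesis
    using disk_push_in_disk[OF y(1) assms(2,3)] by (simp add: disk_collar_def)
qed

lemma disk_push_1_collar:
  assumes "y \<in> disk_collar n"
  shows "disk_push n 1 y \<in> disk_sphere n"
proof -
  have y: "y \<in> topspace (disk n)" "disk_norm n y \<le> 1" "1/2 \<le> disk_norm n y"
    using assms by (auto simp: disk_collar_def topspace_disk)
  then have "disk_norm n (disk_push n 1 y) = 1"
    by (simp add: disk_norm_push)
  then show ?thesis
    using disk_push_in_disk[OF y(1), of 1] by (simp add: disk_sphere_eq)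
qed

lemma continuous_map_disk_push:
  "continuous_map (prod_topology (top_of_set {0..1}) (disk n)) (disk n) (\<lambda>z. disk_push n (fst z) (snd z))"
proof -
  have "continuous_on ({0..1} \<times> topspace (disk n)) (\<lambda>z. disk_push n (fst z) (snd z))"
    unfolding disk_push_def
    by (intro continuous_intros continuous_on_snd_coordinate
        continuous_on_compose2[OF continuous_on_disk_norm[of UNIV], of _ snd]) auto
  moreover have "(\<lambda>z. disk_push n (fst z) (snd z)) \<in> {0..1} \<times> topspace (disk n) \<rightarrow> topspace (disk n)"
    using disk_push_in_disk by auto
  ultimately have "continuous_map (top_of_set ({0..1} \<times> topspace (disk n)))
      (top_of_set (topspace (disk n))) (\<lambda>z. disk_push n (fst z) (snd z))"
    by simp
  then show ?thesis
    unfolding disk_eq_top_of_set topspace_disk prod_topology_subtopology_eu topspace_euclidean_subtopology .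
qed

section \<open>Attaching one cell\<close>

lemma iso_cancel_left:
  assumes "f \<in> hom G H" "g \<in> iso H K" "h \<in> iso G K" "\<And>x. x \<in> carrier G \<Longrightarrow> g (f x) = h x"
  shows "f \<in> iso G H"
proof -
  have g: "bij_betw g (carrier H) (carrier K)" and h: "bij_betw h (carrier G) (carrier K)"
    using assms by (auto simp: iso_def)
  have f: "f ` carrier G \<subseteq> carrier H"
    using assms(1) by (auto simp: hom_def)
  have "bij_betw (g \<circ> f) (carrier G) (carrier K)"
    using h assms(4) by (simp cong: bij_betw_cong)
  then have "bij_betw f (carrier G) (carrier H)"
    using g f bij_betw_comp_iff2 by blast
  with assms(1) show ?thesis by (simp add: iso_def)
qed

lemma iso_cancel_right:
  assumes "g \<in> hom H K" "f \<in> iso G H" "h \<in> iso G K" "\<And>x. x \<in> carrier G \<Longrightarrow> g (f x) = h x"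
  shows "g \<in> iso H K"
proof -
  have f: "bij_betw f (carrier G) (carrier H)" and h: "bij_betw h (carrier G) (carrier K)"
    using assms by (auto simp: iso_def)
  have "bij_betw (g \<circ> f) (carrier G) (carrier K)"
    using h assms(4) by (simp cong: bij_betw_cong)
  then have "bij_betw g (carrier H) (carrier K)"
    using f bij_betw_comp_iff by blast
  with assms(1) show ?thesis by (simp add: iso_def)
qed

text \<open>\<open>X\<close> is obtained from the closed subspace \<open>B\<close> by attaching a single cell. The disk is
compact and \<open>X\<close> is Hausdorff, so the characteristic map is closed and \<open>X\<close> has the quotient topology.\<close>

locale cell_attachment =
  fixes X :: "'p topology" and B :: "'p set" and n :: nat and \<phi> :: "(nat \<Rightarrow> real) \<Rightarrow> 'p"
  assumes Hausdorff: "Hausdorff_space X"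
    and closedin_base: "closedin X B"
    and continuous_char: "continuous_map (disk n) X \<phi>"
    and char_sphere: "\<phi> ` disk_sphere n \<subseteq> B"
    and topspace_eq: "topspace X = B \<union> \<phi> ` open_disk n"
    and disjoint_base: "B \<inter> \<phi> ` open_disk n = {}"
    and inj_char: "inj_on \<phi> (open_disk n)"
begin

lemma closed_map_char: "closed_map (disk n) X \<phi>"
  using continuous_char compact_space_disk Hausdorff by (rule continuous_imp_closed_map)

definition collar :: "'p set" where
  "collar = B \<union> \<phi> ` disk_collar n"

definition push :: "real \<Rightarrow> 'p \<Rightarrow> 'p" where
  "push t x = (if x \<in> B then x else \<phi> (disk_push n t (inv_into (open_disk n) \<phi> x)))"

lemma push_char:
  assumes "y \<in> topspace (disk n)" "0 \<le> t"
  shows "push t (\<phi> y) = \<phi> (disk_push n t y)"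
proof (cases "y \<in> disk_sphere n")
  case True
  then show ?thesis using char_sphere assms by (auto simp: push_def disk_push_sphere)
next
  case False
  then have y: "y \<in> open_disk n" using assms disk_Un[of n] by blast
  then have "\<phi> y \<notin> B" using disjoint_base by blast
  then show ?thesis using y inj_char by (simp add: push_def)
qed

text \<open>\<open>X\<close> is the union of the closed sets \<open>B\<close> and the image of the disk. On the second one,
continuity descends from the disk because the product of \<open>[0,1]\<close> with the characteristic map
is a continuous surjection from a compact onto a Hausdorff space, hence a quotient map.\<close>

lemma continuous_map_push:
  "continuous_map (prod_topology (top_of_set {0..1}) X) X (\<lambda>z. push (fst z) (snd z))"
proof -
  let ?I = "top_of_set {0..1::real}"
  let ?P = "prod_topology ?I X"
  let ?G = "\<lambda>z. push (fst z) (snd z)"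
  let ?T = "\<lambda>i. if i then topspace ?I \<times> B else topspace ?I \<times> \<phi> ` topspace (disk n)"
  have closed: "closedin ?P (?T i)" for i
    using closedin_base closed_map_char closedin_prod_Times_iff
    by (auto simp: closedin_prod_Times_iff closed_map_def)
  have B: "continuous_map (subtopology ?P (topspace ?I \<times> B)) X ?G"
  proof (rule continuous_map_eq)
    show "continuous_map (subtopology ?P (topspace ?I \<times> B)) X snd"
      by (intro continuous_map_from_subtopology continuous_map_snd)
  qed (auto simp: push_def)
  have D: "continuous_map (subtopology ?P (topspace ?I \<times> \<phi> ` topspace (disk n))) X ?G"
  proof -
    let ?q = "\<lambda>z. (fst z, \<phi> (snd z))"
    let ?Q = "prod_topology ?I (disk n)"
    have cont: "continuous_map ?Q ?P ?q"
      by (intro continuous_map_pairedI continuous_map_fst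
          continuous_map_compose[OF continuous_map_snd continuous_char, unfolded comp_def])
    have im: "?q ` topspace ?Q = topspace ?I \<times> \<phi> ` topspace (disk n)"
      by force
    have sub: "\<phi> ` topspace (disk n) \<subseteq> topspace X"
      using continuous_char by (auto simp: continuous_map_def)
    have "quotient_map ?Q (subtopology ?P (topspace ?I \<times> \<phi> ` topspace (disk n))) ?q"
    proof (rule continuous_imp_quotient_map)
      show "continuous_map ?Q (subtopology ?P (topspace ?I \<times> \<phi> ` topspace (disk n))) ?q"
        using cont by (auto simp: continuous_map_in_subtopology)
      show "compact_space ?Q"
        using compact_space_disk by (simp add: compact_space_prod_topology compact_space_subtopology)
      show "Hausdorff_space (subtopology ?P (topspace ?I \<times> \<phi> ` topspace (disk n)))"
        using Hausdorff by (intro Hausdorff_space_subtopology) (simp add: Hausdorff_space_prod_topology Hausdorff_space_subtopology)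
      show "?q ` topspace ?Q = topspace (subtopology ?P (topspace ?I \<times> \<phi> ` topspace (disk n)))"
        unfolding im using sub by auto
    qed
    moreover have "continuous_map ?Q X (?G \<circ> ?q)"
    proof (rule continuous_map_eq)
      show "continuous_map ?Q X (\<phi> \<circ> (\<lambda>z. disk_push n (fst z) (snd z)))"
        by (rule continuous_map_compose[OF continuous_map_disk_push continuous_char])
    qed (auto simp: push_char)
    ultimately show ?thesis
      by (rule continuous_compose_quotient_map)
  qed
  show ?thesis
  proof (rule pasting_lemma_closed[where I=UNIV and T="?T" and f="\<lambda>_. ?G"])
    show "continuous_map (subtopology ?P (?T i)) X ?G" for i
      using B D by simp
    show "\<exists>j. j \<in> UNIV \<and> z \<in> ?T j \<and> ?G z = ?G z" if "z \<in> topspace ?P" for z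
    proof -
      have "snd z \<in> B \<or> snd z \<in> \<phi> ` topspace (disk n)"
        using that topspace_eq disk_Un[of n] by auto
      then show ?thesis using that by (auto simp: mem_Times_iff intro: exI[of _ True] exI[of _ False])
    qed
  qed (use closed in auto)
qed

lemma push_0: "x \<in> topspace X \<Longrightarrow> push 0 x = x"
  using disk_push_0 disk_Un[of n] topspace_eq inj_char by (auto simp: push_def)

lemma push_base: "x \<in> B \<Longrightarrow> push t x = x"
  by (simp add: push_def)

lemma disk_collar_subset: "disk_collar n \<subseteq> topspace (disk n)"
  by (auto simp: disk_collar_def)

lemma push_collar: "x \<in> collar \<Longrightarrow> 0 \<le> t \<Longrightarrow> t \<le> 1 \<Longrightarrow> push t x \<in> collar"
  using disk_push_collar disk_collar_subset by (auto simp: collar_def push_base push_char subset_iff)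

lemma push_1_collar: "x \<in> collar \<Longrightarrow> push 1 x \<in> B"
  using disk_push_1_collar disk_collar_subset char_sphere
  by (auto simp: collar_def push_base push_char subset_iff)

text \<open>Thickening \<open>B\<close> to the collar does not change relative homology: the time-1 push is a homotopy
inverse, as a map of pairs, of the identity. The collar is needed because excision requires the
excised closed set to lie in the interior of the subspace.\<close>

lemma iso_collar: "hom_induced p X B X collar id \<in> iso (relative_homology_group p X B) (relative_homology_group p X collar)"
proof (rule homotopy_equivalence_relative_homology_group_isomorphism)
  have h: "homotopic_with (\<lambda>h. h \<in> B \<rightarrow> B \<and> h \<in> collar \<rightarrow> collar) X X id (push 1)"
  proof (subst homotopic_with)
    have "B \<subseteq> topspace X" "collar \<subseteq> topspace X"
      using topspace_eq continuous_char disk_collar_subset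
      by (auto simp: collar_def continuous_map_def Pi_iff subset_iff)
    then show "(h \<in> B \<rightarrow> B \<and> h \<in> collar \<rightarrow> collar) = (k \<in> B \<rightarrow> B \<and> k \<in> collar \<rightarrow> collar)"
      if "\<And>x. x \<in> topspace X \<Longrightarrow> h x = k x" for h k
      using that by (auto simp: Pi_iff subset_iff)
  qed (use continuous_map_push push_0 push_collar in
      \<open>auto simp: push_base intro!: exI[of _ "\<lambda>z. push (fst z) (snd z)"]\<close>)
  then show "homotopic_with (\<lambda>h. h \<in> B \<rightarrow> B) X X (push 1 \<circ> id) id"
    "homotopic_with (\<lambda>h. h \<in> collar \<rightarrow> collar) X X (id \<circ> push 1) id"
    by (auto intro: homotopic_with_symD homotopic_with_mono)
  show "continuous_map X X (push 1)"
    using h homotopic_with_imp_continuous_maps by blast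
  show "id \<in> B \<rightarrow> collar" "push 1 \<in> collar \<rightarrow> B"
    using push_1_collar by (auto simp: collar_def)
qed auto

lemma openin_collar_interior: "openin X (topspace X - \<phi> ` {y \<in> topspace (disk n). disk_norm n y \<le> 1 / 2})"
proof -
  have "closed {x. disk_norm n x \<le> 1 / 2}"
    by (intro closed_Collect_le continuous_intros)
  then have "closedin (disk n) {y \<in> topspace (disk n). disk_norm n y \<le> 1 / 2}"
    unfolding topspace_disk disk_eq_top_of_set by (auto simp: closedin_closed)
  then show ?thesis
    using closed_map_char by (auto simp: closed_map_def)
qed

lemma iso_excision:
  "hom_induced p (subtopology X (\<phi> ` open_disk n)) (collar - B) X collar id
   \<in> iso (relative_homology_group p (subtopology X (\<phi> ` open_disk n)) (collar - B)) (relative_homology_group p X collar)"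
proof -
  have "B \<subseteq> topspace X - \<phi> ` {y \<in> topspace (disk n). disk_norm n y \<le> 1 / 2}"
    using disjoint_base topspace_eq by (auto simp: open_disk_eq)
  moreover have "topspace X - \<phi> ` {y \<in> topspace (disk n). disk_norm n y \<le> 1 / 2} \<subseteq> collar"
  proof
    fix x assume x: "x \<in> topspace X - \<phi> ` {y \<in> topspace (disk n). disk_norm n y \<le> 1 / 2}"
    show "x \<in> collar"
    proof (cases "x \<in> B")
      case False
      then obtain y where "y \<in> topspace (disk n)" "x = \<phi> y"
        using x topspace_eq disk_Un[of n] by auto
      with x have "y \<in> disk_collar n"
        by (force simp: disk_collar_def)
      with \<open>x = \<phi> y\<close> show ?thesis
        by (simp add: collar_def)
    qed (simp add: collar_def)
  qed
  ultimately have "B \<subseteq> X interior_of collar"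
    using openin_collar_interior by (meson interior_of_maximal subset_trans)
  moreover have "X closure_of B = B"
    using closedin_base by (simp add: closure_of_closedin)
  moreover have "collar \<subseteq> topspace X"
    using topspace_eq continuous_char disk_collar_subset
    by (auto simp: collar_def continuous_map_def Pi_iff subset_iff)
  moreover have "topspace X - B = \<phi> ` open_disk n"
    using topspace_eq disjoint_base by blast
  ultimately show ?thesis
    using homology_excision_axiom[of X B collar "topspace X" p] by simp
qed

lemma homeomorphic_map_char:
  "homeomorphic_map (subtopology (disk n) (open_disk n)) (subtopology X (\<phi> ` open_disk n)) \<phi>"
proof -
  have *: "{y \<in> topspace (disk n). \<phi> y \<in> \<phi> ` open_disk n} = open_disk n"
    using char_sphere disjoint_base disk_Un[of n] by auto
  have "closed_map (subtopology (disk n) (open_disk n)) (subtopology X (\<phi> ` open_disk n)) \<phi>"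
    using closed_map_restriction[OF closed_map_char, of "\<phi> ` open_disk n"] * by blast
  moreover have "continuous_map (subtopology (disk n) (open_disk n)) (subtopology X (\<phi> ` open_disk n)) \<phi>"
    using continuous_char by (auto simp: continuous_map_in_subtopology continuous_map_from_subtopology)
  moreover have "topspace (subtopology (disk n) (open_disk n)) = open_disk n"
    "topspace (subtopology X (\<phi> ` open_disk n)) = \<phi> ` open_disk n"
    using topspace_eq disk_Un[of n] by auto
  ultimately show ?thesis
    using inj_char by (intro bijective_closed_imp_homeomorphic_map) auto
qed

end

lemma cell_attachment_disk: "cell_attachment (disk n) (disk_sphere n) n id"
proof
  have "closed {x. disk_norm n x \<ge> 1}"
    by (intro closed_Collect_le continuous_intros)
  moreover have "disk_sphere n = topspace (disk n) \<inter> {x. disk_norm n x \<ge> 1}"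
    by (auto simp: disk_sphere_eq topspace_disk)
  ultimately show "closedin (disk n) (disk_sphere n)"
    unfolding topspace_disk disk_eq_top_of_set by (auto simp: closedin_closed)
qed (use disk_Un disk_disjoint Hausdorff_space_disk in auto)

text \<open>Thicken and excise \<open>B\<close>, and do the same with the boundary sphere in the disk, which is itself a
cell attached to its sphere. Both sides then become the homology of the open disk relative to its
outer shell, and the characteristic map is a homeomorphism there.\<close>

theorem (in cell_attachment) iso_char:
  "hom_induced p (disk n) (disk_sphere n) X B \<phi>
   \<in> iso (relative_homology_group p (disk n) (disk_sphere n)) (relative_homology_group p X B)"
proof -
  interpret D: cell_attachment "disk n" "disk_sphere n" n id
    by (rule cell_attachment_disk)
  have ND: "D.collar = disk_collar n"
    unfolding D.collar_def by (auto simp: disk_collar_def disk_sphere_eq)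
  have collar_minus: "\<phi> ` (disk_collar n - disk_sphere n) = collar - B"
  proof -
    have "disk_collar n - disk_sphere n = disk_collar n \<inter> open_disk n"
      using disk_Un[of n] disk_disjoint[of n] disk_collar_subset by blast
    moreover have "\<phi> ` (disk_collar n \<inter> open_disk n) = collar - B"
    proof -
      have "y \<in> open_disk n" if "y \<in> disk_collar n" "\<phi> y \<notin> B" for y
        using that char_sphere disk_Un[of n] disk_collar_subset by blast
      then show ?thesis
        using disjoint_base by (auto simp: collar_def)
    qed
    ultimately show ?thesis by simp
  qed
  let ?oD = "subtopology (disk n) (open_disk n)" and ?oX = "subtopology X (\<phi> ` open_disk n)"
  let ?c = "hom_induced p ?oD (disk_collar n - disk_sphere n) ?oX (collar - B) \<phi>"
  let ?b = "hom_induced p ?oD (disk_collar n - disk_sphere n) (disk n) (disk_collar n) id"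
  let ?d = "hom_induced p ?oX (collar - B) X collar id"
  let ?m = "hom_induced p (disk n) (disk_collar n) X collar \<phi>"
  have c: "?c \<in> iso (relative_homology_group p ?oD (disk_collar n - disk_sphere n)) (relative_homology_group p ?oX (collar - B))"
    using homeomorphic_map_char collar_minus disk_Un[of n] disk_collar_subset
    by (intro homeomorphic_map_relative_homology_iso) auto
  have [simp]: "\<phi> \<in> disk_collar n \<rightarrow> collar" "\<phi> \<in> disk_collar n - disk_sphere n \<rightarrow> collar - B"
    using collar_minus by (auto simp: collar_def)
  have cont: "continuous_map ?oD ?oX \<phi>"
    using homeomorphic_map_char homeomorphic_imp_continuous_map by blast
  have m: "?m \<in> iso (relative_homology_group p (disk n) (disk_collar n)) (relative_homology_group p X collar)"
  proof (rule iso_cancel_right)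
    show "?b \<in> iso (relative_homology_group p ?oD (disk_collar n - disk_sphere n)) (relative_homology_group p (disk n) (disk_collar n))"
      using D.iso_excision ND by simp
    show "?d \<circ> ?c \<in> iso (relative_homology_group p ?oD (disk_collar n - disk_sphere n)) (relative_homology_group p X collar)"
      using c iso_excision by (rule iso_set_trans)
    show "?m (?b x) = (?d \<circ> ?c) x" for x
    proof -
      have "?m (?b x) = hom_induced p ?oD (disk_collar n - disk_sphere n) X collar (\<phi> \<circ> id) x"
        using continuous_char by (intro hom_induced_compose') auto
      also have "\<dots> = hom_induced p ?oD (disk_collar n - disk_sphere n) X collar (id \<circ> \<phi>) x"
        by simp
      also have "\<dots> = ?d (?c x)"
        using cont by (intro hom_induced_compose'[symmetric]) auto
      finally show ?thesis by simp
    qed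
  qed (rule hom_induced_hom)
  let ?a = "hom_induced p (disk n) (disk_sphere n) (disk n) (disk_collar n) id"
  have a: "?a \<in> iso (relative_homology_group p (disk n) (disk_sphere n)) (relative_homology_group p (disk n) (disk_collar n))"
    using D.iso_collar ND by simp
  show ?thesis
  proof (rule iso_cancel_left)
    show "hom_induced p X B X collar id \<in> iso (relative_homology_group p X B) (relative_homology_group p X collar)"
      by (rule iso_collar)
    show "?m \<circ> ?a \<in> iso (relative_homology_group p (disk n) (disk_sphere n)) (relative_homology_group p X collar)"
      using a m by (rule iso_set_trans)
    show "hom_induced p X B X collar id (hom_induced p (disk n) (disk_sphere n) X B \<phi> x) = (?m \<circ> ?a) x" for x
    proof -
      have "hom_induced p X B X collar id (hom_induced p (disk n) (disk_sphere n) X B \<phi> x)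
        = hom_induced p (disk n) (disk_sphere n) X collar (id \<circ> \<phi>) x"
        using continuous_char char_sphere by (intro hom_induced_compose') (auto simp: collar_def)
      also have "\<dots> = hom_induced p (disk n) (disk_sphere n) X collar (\<phi> \<circ> id) x"
        by simp
      also have "\<dots> = ?m (?a x)"
        using continuous_char by (intro hom_induced_compose'[symmetric]) (simp_all, auto simp: disk_sphere_eq disk_collar_def)
      finally show ?thesis by simp
    qed
  qed (rule hom_induced_hom)
qed

section \<open>The cell classes form a basis\<close>

lemma subtopology_disk_sphere:
  assumes "n > 0"
  shows "subtopology (disk n) (disk_sphere n) = nsphere (n - 1)"
proof -
  obtain m where m: "n = Suc m" using assms gr0_implies_Suc by blast
  show ?thesis
    by (auto simp: m disk_def disk_sphere_def nsphere_def subtopology_subtopology Euclidean_space_def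
        lessThan_Suc_atMost intro: arg_cong[where f="subtopology _"])
qed

text \<open>In dimension 0 the sphere is empty and the disk is a point; otherwise the disk is contractible
and the boundary map leads to the reduced homology of a sphere.\<close>

lemma relative_homology_disk_iso: "relative_homology_group (int n) (disk n) (disk_sphere n) \<cong> integer_group"
proof (cases "n = 0")
  case True
  have "topspace (disk 0) = {\<lambda>i. 0}"
    by (auto simp: topspace_disk disk_norm_def)
  moreover have "disk_sphere 0 = {}"
    by (auto simp: disk_sphere_def)
  ultimately show ?thesis
    using homology_coefficients True by simp
next
  case False
  have "(\<lambda>i. if i = 0 then 1 else 0) \<in> topspace (disk n) \<inter> disk_sphere n"
    using False by (simp add: disk_sphere_def topspace_disk disk_norm_def if_distrib[of "\<lambda>x. x\<^sup>2"] cong: if_cong)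
  then have "relative_homology_group (int n) (disk n) (disk_sphere n)
    \<cong> reduced_homology_group (int n - 1) (subtopology (disk n) (disk_sphere n))"
    using contractible_space_disk by (intro isomorphic_group_relative_homology_of_contractible) auto
  also have "\<dots> \<cong> integer_group"
    using reduced_homology_group_nsphere(1)[of "n - 1"] False
    by (simp add: subtopology_disk_sphere of_nat_diff)
  finally show ?thesis .
qed

text \<open>The second part concerns an arbitrary generator, since the class of the disk is
chosen by a description operator.\<close>

lemma iso_integer_group_generator:
  assumes G: "group G" "G \<cong> integer_group"
  shows "\<exists>g\<in>carrier G. generate G {g} = carrier G"
    and "g \<in> carrier G \<Longrightarrow> generate G {g} = carrier G \<Longrightarrow> g [^]\<^bsub>G\<^esub> (k::int) = \<one>\<^bsub>G\<^esub> \<Longrightarrow> k = 0"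
proof -
  interpret G: group G by fact
  obtain h where h: "h \<in> iso G integer_group"
    using assms by (auto simp: is_iso_def)
  then interpret h: group_hom G integer_group h
    by (simp add: group_hom_def group_hom_axioms_def iso_def G)
  have pow: "h (g [^]\<^bsub>G\<^esub> (k::int)) = k * h g" if "g \<in> carrier G" for g k
    using that by (simp add: h.hom_int_pow)
  have inj: "inj_on h (carrier G)" and surj: "h ` carrier G = UNIV"
    using h by (auto simp: iso_def bij_betw_def)
  obtain g where g: "g \<in> carrier G" "h g = 1"
    using surj by (metis UNIV_I imageE)
  have "x \<in> generate G {g}" if "x \<in> carrier G" for x
  proof -
    have "h x = h (g [^]\<^bsub>G\<^esub> h x)" using g by (simp add: pow)
    then have "x = g [^]\<^bsub>G\<^esub> h x"
      using inj that g by (simp add: inj_on_eq_iff)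
    then show ?thesis
      using g G.generate_pow by blast
  qed
  then show "\<exists>g\<in>carrier G. generate G {g} = carrier G"
    using g G.generate_incl[of "{g}"] by blast
  show "k = 0" if g': "g' \<in> carrier G" "generate G {g'} = carrier G" "g' [^]\<^bsub>G\<^esub> k = \<one>\<^bsub>G\<^esub>" for g'
  proof -
    have "g \<in> generate G {g'}" using g that by simp
    then obtain j :: int where "g = g' [^]\<^bsub>G\<^esub> j"
      using g' by (auto simp: G.generate_pow)
    then have "j * h g' = 1" using g g' pow by metis
    moreover have "k * h g' = 0"
      using pow[OF g'(1), of k] g'(3) by simp
    ultimately show ?thesis by auto
  qed
qed

lemma disk_class:
  shows disk_class_carrier: "disk_class n \<in> carrier (relative_homology_group (int n) (disk n) (disk_sphere n))"
    and generate_disk_class: "generate (relative_homology_group (int n) (disk n) (disk_sphere n)) {disk_class n}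
      = carrier (relative_homology_group (int n) (disk n) (disk_sphere n))"
proof -
  have "\<exists>g. g \<in> carrier (relative_homology_group (int n) (disk n) (disk_sphere n)) \<and>
        generate (relative_homology_group (int n) (disk n) (disk_sphere n)) {g} =
        carrier (relative_homology_group (int n) (disk n) (disk_sphere n))"
    using iso_integer_group_generator(1)[OF group_relative_homology_group relative_homology_disk_iso[of n]] by blast
  from someI_ex[OF this] show "disk_class n \<in> carrier (relative_homology_group (int n) (disk n) (disk_sphere n))"
    "generate (relative_homology_group (int n) (disk n) (disk_sphere n)) {disk_class n}
      = carrier (relative_homology_group (int n) (disk n) (disk_sphere n))"
    unfolding disk_class_def by auto
qed

lemma (in cell_attachment) char_class:
  fixes k :: int
  defines "G \<equiv> relative_homology_group (int n) X B"
    and "g \<equiv> hom_induced (int n) (disk n) (disk_sphere n) X B \<phi> (disk_class n)"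
  shows char_class_generates: "x \<in> carrier G \<Longrightarrow> \<exists>m::int. x = g [^]\<^bsub>G\<^esub> m"
    and char_class_infinite_order: "g [^]\<^bsub>G\<^esub> k = \<one>\<^bsub>G\<^esub> \<Longrightarrow> k = 0"
proof -
  let ?D = "relative_homology_group (int n) (disk n) (disk_sphere n)"
  let ?h = "hom_induced (int n) (disk n) (disk_sphere n) X B \<phi>"
  interpret D: group ?D by simp
  interpret G: group G by (simp add: G_def)
  have h: "?h \<in> iso ?D G"
    unfolding G_def by (rule iso_char)
  interpret h: group_hom ?D G ?h
    using h by unfold_locales (auto simp: iso_def)
  have surj: "?h ` carrier ?D = carrier G" and inj: "inj_on ?h (carrier ?D)"
    using h by (auto simp: iso_def bij_betw_def)
  have pow: "?h (disk_class n [^]\<^bsub>?D\<^esub> m) = g [^]\<^bsub>G\<^esub> m" for m :: int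
    unfolding g_def using disk_class_carrier by (rule h.hom_int_pow)
  show "\<exists>m::int. x = g [^]\<^bsub>G\<^esub> m" if x: "x \<in> carrier G"
  proof -
    obtain y where y: "y \<in> carrier ?D" "x = ?h y"
      using x surj by blast
    then obtain m :: int where "y = disk_class n [^]\<^bsub>?D\<^esub> m"
      using generate_disk_class[of n] D.generate_pow[OF disk_class_carrier] by blast
    with y pow show ?thesis by metis
  qed
  show "k = 0" if k: "g [^]\<^bsub>G\<^esub> k = \<one>\<^bsub>G\<^esub>"
  proof -
    have "?h (disk_class n [^]\<^bsub>?D\<^esub> k) = ?h \<one>\<^bsub>?D\<^esub>"
      using k pow[of k] h.hom_one by metis
    then have "disk_class n [^]\<^bsub>?D\<^esub> k = \<one>\<^bsub>?D\<^esub>"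
      using inj disk_class_carrier by (meson D.int_pow_closed D.one_closed inj_on_eq_iff)
    then show ?thesis
      using iso_integer_group_generator(2)[OF group_relative_homology_group relative_homology_disk_iso
          disk_class_carrier generate_disk_class] by blast
  qed
qed

lemma hom_finprod:
  assumes "comm_group G" "comm_group H" "h \<in> hom G H" "f \<in> A \<rightarrow> carrier G"
  shows "h (finprod G f A) = finprod H (\<lambda>x. h (f x)) A"
proof -
  interpret G: comm_group G by fact
  interpret H: comm_group H by fact
  interpret h: group_hom G H h using assms by unfold_locales
  show ?thesis
    using assms(4)
  proof (induction A rule: infinite_finite_induct)
    case (insert x A)
    then show ?case
      by (subst G.finprod_insert, simp_all, subst H.finprod_insert) (auto simp: Pi_iff)
  qed auto
qed

locale finite_cw =
  fixes K :: "('p, 'c) cw"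
  assumes cw: "cw_complex K" and finite_cells: "finite (cw_cells K)"
begin

definition cell_union :: "'c set \<Rightarrow> 'p set" where
  "cell_union T = (\<Union>e\<in>T. open_cell K e)"

text \<open>For a finite complex this is the combinatorial form of being a subcomplex: the union of such
cells is a finite union of compact images of disks.\<close>

definition closed_cells :: "'c set \<Rightarrow> bool" where
  "closed_cells T \<longleftrightarrow> T \<subseteq> cw_cells K \<and> (\<forall>e\<in>T. cw_char K e ` disk_sphere (cw_dim K e) \<subseteq> cell_union T)"

lemma skeleton_eq: "skeleton K k = cell_union (skeleton_cells K k)"
  by (simp add: skeleton_def cell_union_def)

lemmas cw_conds = cw[unfolded cw_complex_def]

lemma Hausdorff_cw: "Hausdorff_space (cw_space K)"
  by (rule cw_conds[THEN conjunct1])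

lemma topspace_cw: "topspace (cw_space K) = cell_union (cw_cells K)"
  unfolding cell_union_def by (rule cw_conds[THEN conjunct2, THEN conjunct1])

lemma disjoint_cells: "\<lbrakk>e \<in> cw_cells K; f \<in> cw_cells K; e \<noteq> f\<rbrakk> \<Longrightarrow> open_cell K e \<inter> open_cell K f = {}"
  using cw_conds[THEN conjunct2, THEN conjunct2, THEN conjunct1] by (simp only: simp_thms)

lemmas char_conds = cw_conds[THEN conjunct2, THEN conjunct2, THEN conjunct2, THEN conjunct1, THEN bspec]

lemma continuous_char: "e \<in> cw_cells K \<Longrightarrow> continuous_map (disk (cw_dim K e)) (cw_space K) (cw_char K e)"
  by (rule char_conds[THEN conjunct1])

lemma inj_on_char:
  assumes "e \<in> cw_cells K"
  shows "inj_on (cw_char K e) (open_disk (cw_dim K e))"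
proof -
  have "inj_on (cw_char K e) (topspace (subtopology (disk (cw_dim K e)) (open_disk (cw_dim K e))))"
    using char_conds[OF assms, THEN conjunct2, THEN conjunct1] by (rule homeomorphic_imp_injective_map)
  moreover have "topspace (subtopology (disk (cw_dim K e)) (open_disk (cw_dim K e))) = open_disk (cw_dim K e)"
    using disk_Un[of "cw_dim K e"] by auto
  ultimately show ?thesis by simp
qed

lemma char_sphere_skeleton:
  assumes "e \<in> cw_cells K"
  shows "cw_char K e ` disk_sphere (cw_dim K e) \<subseteq> skeleton K (int (cw_dim K e) - 1)"
proof -
  obtain F where F: "F \<subseteq> {f \<in> cw_cells K. cw_dim K f < cw_dim K e}"
    "cw_char K e ` disk_sphere (cw_dim K e) \<subseteq> (\<Union>f\<in>F. open_cell K f)"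
    using char_conds[OF assms, THEN conjunct2, THEN conjunct2] by (elim exE conjE)
  have "F \<subseteq> skeleton_cells K (int (cw_dim K e) - 1)"
    using F(1) by (auto simp: skeleton_cells_def)
  then have "(\<Union>f\<in>F. open_cell K f) \<subseteq> skeleton K (int (cw_dim K e) - 1)"
    unfolding skeleton_def by (rule UN_mono) simp
  then show ?thesis using F(2) by (rule order_trans[rotated])
qed

lemma skeleton_mono: "k \<le> l \<Longrightarrow> skeleton K k \<subseteq> skeleton K l"
  unfolding skeleton_def skeleton_cells_def by (intro UN_mono) auto

lemma cell_union_mono: "S \<subseteq> T \<Longrightarrow> cell_union S \<subseteq> cell_union T"
  by (auto simp: cell_union_def)

lemma closed_cellsI:
  assumes "skeleton_cells K (k - 1) \<subseteq> T" "T \<subseteq> skeleton_cells K k"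
  shows "closed_cells T"
  unfolding closed_cells_def
proof (intro conjI ballI)
  show "T \<subseteq> cw_cells K" using assms by (auto simp: skeleton_cells_def)
  fix e assume e: "e \<in> T"
  then have "e \<in> cw_cells K" "int (cw_dim K e) \<le> k" using assms by (auto simp: skeleton_cells_def)
  then have "cw_char K e ` disk_sphere (cw_dim K e) \<subseteq> skeleton K (k - 1)"
    using char_sphere_skeleton skeleton_mono[of "int (cw_dim K e) - 1" "k - 1"] by fastforce
  also have "\<dots> \<subseteq> cell_union T"
    unfolding skeleton_eq using assms(1) by (rule cell_union_mono)
  finally show "cw_char K e ` disk_sphere (cw_dim K e) \<subseteq> cell_union T" .
qed

lemma char_disk_subset:
  assumes "closed_cells T" "e \<in> T"
  shows "cw_char K e ` topspace (disk (cw_dim K e)) \<subseteq> cell_union T"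
proof -
  have "cw_char K e ` disk_sphere (cw_dim K e) \<subseteq> cell_union T" "cw_char K e ` open_disk (cw_dim K e) \<subseteq> cell_union T"
    using assms unfolding closed_cells_def by (auto simp: cell_union_def open_cell_def)
  then show ?thesis by (simp add: disk_Un image_Un)
qed

lemma closedin_cell_union:
  assumes "closed_cells T"
  shows "closedin (cw_space K) (cell_union T)"
proof -
  have "cell_union T = (\<Union>e\<in>T. cw_char K e ` topspace (disk (cw_dim K e)))"
  proof
    show "cell_union T \<subseteq> (\<Union>e\<in>T. cw_char K e ` topspace (disk (cw_dim K e)))"
      by (auto simp: cell_union_def open_cell_def disk_Un)
    show "(\<Union>e\<in>T. cw_char K e ` topspace (disk (cw_dim K e))) \<subseteq> cell_union T"
      using char_disk_subset[OF assms] by blast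
  qed
  moreover have "closedin (cw_space K) (cw_char K e ` topspace (disk (cw_dim K e)))" if "e \<in> T" for e
    using that assms continuous_imp_closed_map[OF continuous_char compact_space_disk Hausdorff_cw]
    by (auto simp: closed_cells_def closed_map_def)
  moreover have "finite T"
    using assms finite_cells finite_subset by (auto simp: closed_cells_def)
  ultimately show ?thesis
    by (metis (no_types, lifting) closedin_Union finite_imageI imageE)
qed

lemma cell_union_subset: "T \<subseteq> cw_cells K \<Longrightarrow> cell_union T \<subseteq> topspace (cw_space K)"
  using topspace_cw cell_union_mono by simp

lemma cell_union_Diff:
  assumes "e \<in> T" "T \<subseteq> cw_cells K"
  shows "cell_union (T - {e}) = cell_union T - open_cell K e"
  using assms disjoint_cells by (fastforce simp: cell_union_def)

lemma cell_attachment: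
  assumes "closed_cells T" "closed_cells (T - {e})" "e \<in> T"
    and sphere: "cw_char K e ` disk_sphere (cw_dim K e) \<subseteq> cell_union (T - {e})"
  shows "cell_attachment (subtopology (cw_space K) (cell_union T)) (cell_union (T - {e})) (cw_dim K e) (cw_char K e)"
proof
  have T: "T \<subseteq> cw_cells K" and e: "e \<in> cw_cells K" using assms by (auto simp: closed_cells_def)
  show "Hausdorff_space (subtopology (cw_space K) (cell_union T))"
    by (simp add: Hausdorff_cw Hausdorff_space_subtopology)
  show "closedin (subtopology (cw_space K) (cell_union T)) (cell_union (T - {e}))"
    using closedin_cell_union assms by (intro closedin_subset_topspace) (auto simp: cell_union_def)
  have un: "cell_union T = cell_union (T - {e}) \<union> open_cell K e"
    using \<open>e \<in> T\<close> by (auto simp: cell_union_def)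
  show "continuous_map (disk (cw_dim K e)) (subtopology (cw_space K) (cell_union T)) (cw_char K e)"
    using continuous_char[OF e] sphere un disk_Un[of "cw_dim K e"]
    by (auto simp: continuous_map_in_subtopology open_cell_def)
  show "topspace (subtopology (cw_space K) (cell_union T)) = cell_union (T - {e}) \<union> cw_char K e ` open_disk (cw_dim K e)"
    using cell_union_subset[OF T] un by (auto simp: open_cell_def)
  show "cell_union (T - {e}) \<inter> cw_char K e ` open_disk (cw_dim K e) = {}"
    unfolding cell_union_Diff[OF \<open>e \<in> T\<close> T] open_cell_def by auto
qed (use assms inj_on_char in \<open>auto simp: closed_cells_def\<close>)

lemma cells_of_subset: "cells_of K k \<subseteq> skeleton_cells K k" "cells_of K k \<subseteq> cw_cells K"
  by (auto simp: cells_of_def skeleton_cells_def)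

lemma skeleton_cells_Un: "skeleton_cells K k = skeleton_cells K (k - 1) \<union> cells_of K k"
  by (auto simp: cells_of_def skeleton_cells_def)

lemma cells_of_disjoint_skeleton: "e \<in> cells_of K k \<Longrightarrow> e \<notin> skeleton_cells K (k - 1)"
  by (auto simp: cells_of_def skeleton_cells_def)

lemma attach_top_cell:
  assumes T: "skeleton_cells K (k - 1) \<subseteq> T" "T \<subseteq> skeleton_cells K k" and e: "e \<in> T" "e \<in> cells_of K k"
  shows "cell_attachment (subtopology (cw_space K) (cell_union T)) (cell_union (T - {e})) (cw_dim K e) (cw_char K e)"
proof (rule cell_attachment)
  have T': "skeleton_cells K (k - 1) \<subseteq> T - {e}" "T - {e} \<subseteq> skeleton_cells K k"
    using T cells_of_disjoint_skeleton[OF e(2)] by auto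
  show "closed_cells T" "closed_cells (T - {e})"
    using T T' closed_cellsI by blast+
  have "cw_char K e ` disk_sphere (cw_dim K e) \<subseteq> skeleton K (k - 1)"
    using char_sphere_skeleton[of e] e by (simp add: cells_of_def)
  also have "\<dots> \<subseteq> cell_union (T - {e})"
    unfolding skeleton_eq using T' by (intro cell_union_mono)
  finally show "cw_char K e ` disk_sphere (cw_dim K e) \<subseteq> cell_union (T - {e})" .
qed fact

text \<open>The class of a cell in the homology of a union of cells relative to the skeleton below. The
variable union permits an induction that adds the top cells one at a time.\<close>

definition subspace_class :: "'c set \<Rightarrow> 'c \<Rightarrow> 'p chain set" where
  "subspace_class T e =
     hom_induced (int (cw_dim K e)) (disk (cw_dim K e)) (disk_sphere (cw_dim K e))
       (subtopology (cw_space K) (cell_union T)) (skeleton K (int (cw_dim K e) - 1)) (cw_char K e)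
       (disk_class (cw_dim K e))"

lemma continuous_char_cell_union:
  assumes "closed_cells T" "e \<in> T"
  shows "continuous_map (disk (cw_dim K e)) (subtopology (cw_space K) (cell_union T)) (cw_char K e)"
  using continuous_char[of e] assms char_disk_subset[OF assms]
  by (auto simp: continuous_map_in_subtopology closed_cells_def)

lemma subspace_class_push:
  assumes T: "closed_cells T" "T \<subseteq> T'" "e \<in> T" and C: "skeleton K (int (cw_dim K e) - 1) \<subseteq> C"
  shows "hom_induced (int (cw_dim K e)) (subtopology (cw_space K) (cell_union T)) (skeleton K (int (cw_dim K e) - 1))
      (subtopology (cw_space K) (cell_union T')) C id (subspace_class T e)
    = hom_induced (int (cw_dim K e)) (disk (cw_dim K e)) (disk_sphere (cw_dim K e))
       (subtopology (cw_space K) (cell_union T')) C (cw_char K e) (disk_class (cw_dim K e))"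
proof -
  have e: "e \<in> cw_cells K" using T by (auto simp: closed_cells_def)
  have "continuous_map (subtopology (cw_space K) (cell_union T)) (subtopology (cw_space K) (cell_union T')) id"
    using T cell_union_mono[of T T'] by (auto simp: continuous_map_in_subtopology)
  then show ?thesis
    unfolding subspace_class_def
    using continuous_char_cell_union[OF T(1,3)] char_sphere_skeleton[OF e] C
    by (subst hom_induced_compose') auto
qed

text \<open>Add one cell \<open>e\<close> to the union \<open>T0\<close>. Modulo \<open>T0\<close> every class is a multiple of the class of \<open>e\<close>, by the
computation for a single cell; subtracting this multiple gives a class that comes from \<open>T0\<close>, by
the exact sequence of the triple.\<close>

lemma skeleton_classes_generate:
  fixes k :: int
  assumes "finite E" "E \<subseteq> cells_of K k" "T = skeleton_cells K (k - 1) \<union> E"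
    and "x \<in> carrier (relative_homology_group k (subtopology (cw_space K) (cell_union T)) (skeleton K (k - 1)))"
  defines "G \<equiv> \<lambda>T. relative_homology_group k (subtopology (cw_space K) (cell_union T)) (skeleton K (k - 1))"
  shows "\<exists>m::'c \<Rightarrow> int. x = (\<Otimes>\<^bsub>G T\<^esub>f\<in>E. subspace_class T f [^]\<^bsub>G T\<^esub> m f)"
  using assms(1-4) unfolding G_def
proof (induction E arbitrary: x T rule: finite_induct)
  case empty
  let ?G = "relative_homology_group k (subtopology (cw_space K) (cell_union T)) (skeleton K (k - 1))"
  interpret comm_group ?G by simp
  have "skeleton K (k - 1) = topspace (subtopology (cw_space K) (cell_union T))"
    using cell_union_subset[of "skeleton_cells K (k - 1)"] empty(2)
    by (auto simp: skeleton_eq skeleton_cells_def)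
  then have "trivial_group ?G"
    using trivial_relative_homology_group_topspace by metis
  then show ?case
    using empty unfolding finprod_empty trivial_group_def by blast
next
  case (insert e E)
  define T0 where "T0 = T - {e}"
  let ?A = "skeleton K (k - 1)"
  let ?X = "subtopology (cw_space K) (cell_union T0)" and ?X' = "subtopology (cw_space K) (cell_union T)"
  let ?G = "relative_homology_group k ?X ?A" and ?G' = "relative_homology_group k ?X' ?A"
  let ?Q = "relative_homology_group k ?X' (cell_union T0)"
  let ?i = "hom_induced k ?X ?A ?X' ?A id" and ?j = "hom_induced k ?X' ?A ?X' (cell_union T0) id"
  have e: "e \<in> cells_of K k" "e \<in> T" and E: "E \<subseteq> cells_of K k" using insert by auto
  have dim: "int (cw_dim K f) = k" if "f \<in> insert e E" for f
    using that insert.prems by (auto simp: cells_of_def)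
  have T0: "T0 = skeleton_cells K (k - 1) \<union> E"
    using insert.hyps insert.prems(2) cells_of_disjoint_skeleton[OF e(1)] by (auto simp: T0_def)
  have sub: "skeleton_cells K (k - 1) \<subseteq> T" "T \<subseteq> skeleton_cells K k"
    using insert.prems skeleton_cells_Un[of k] by auto
  have sub': "skeleton_cells K (k - 1) \<subseteq> T0" "T0 \<subseteq> skeleton_cells K k"
    using E T0 skeleton_cells_Un[of k] by auto
  have closed: "closed_cells T" "closed_cells T0"
    using closed_cellsI[OF sub] closed_cellsI[OF sub'] by blast+
  have ET: "f \<in> T" if "f \<in> insert e E" for f using that insert.prems by auto
  have ET0: "f \<in> T0" if "f \<in> E" for f using that T0 by auto
  have TT: "T0 \<subseteq> T" by (auto simp: T0_def)
  have AT: "?A \<subseteq> cell_union T0" "cell_union T0 \<subseteq> cell_union T"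
    unfolding skeleton_eq by (rule cell_union_mono[OF sub'(1)], rule cell_union_mono[OF TT])
  interpret G: comm_group ?G by simp
  interpret G': comm_group ?G' by simp
  interpret Q: comm_group ?Q by simp
  interpret a: cell_attachment ?X' "cell_union T0" "cw_dim K e" "cw_char K e"
    using attach_top_cell[OF sub e(2,1)] by (simp add: T0_def)
  interpret i: group_hom ?G ?G' ?i by unfold_locales (rule hom_induced_hom)
  interpret j: group_hom ?G' ?Q ?j by unfold_locales (rule hom_induced_hom)
  have cls: "subspace_class T f \<in> carrier ?G'" if "f \<in> insert e E" for f
    unfolding subspace_class_def dim[OF that] by (rule hom_induced_carrier)
  have cls0: "subspace_class T0 f \<in> carrier ?G" if "f \<in> E" for f
    unfolding subspace_class_def dim[OF insertI2[OF that]] by (rule hom_induced_carrier)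
  have jx: "?j (subspace_class T e) = hom_induced k (disk (cw_dim K e)) (disk_sphere (cw_dim K e)) ?X' (cell_union T0) (cw_char K e) (disk_class (cw_dim K e))"
    using subspace_class_push[OF closed(1) order_refl e(2), of "cell_union T0"]
    unfolding dim[of e, simplified] using AT by blast
  have "\<exists>m0::int. ?j x = ?j (subspace_class T e) [^]\<^bsub>?Q\<^esub> m0"
    unfolding jx using a.char_class_generates[of "?j x"]
    unfolding dim[of e, simplified] using hom_induced_carrier by blast
  then obtain m0 :: int where m0: "?j x = ?j (subspace_class T e) [^]\<^bsub>?Q\<^esub> m0" ..
  define p where "p = subspace_class T e [^]\<^bsub>?G'\<^esub> m0"
  have p: "p \<in> carrier ?G'" unfolding p_def using cls[of e] by blast
  have jp: "?j p = ?j x" unfolding p_def m0 using cls[of e] by (intro j.hom_int_pow) auto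
  define y where "y = x \<otimes>\<^bsub>?G'\<^esub> inv\<^bsub>?G'\<^esub> p"
  have x: "x \<in> carrier ?G'" using insert.prems by blast
  have y: "y \<in> carrier ?G'" unfolding y_def using x p by blast
  have "?j y = ?j x \<otimes>\<^bsub>?Q\<^esub> inv\<^bsub>?Q\<^esub> (?j x)"
    unfolding y_def using x p jp by (metis G'.inv_closed j.hom_inv j.hom_mult)
  also have "\<dots> = \<one>\<^bsub>?Q\<^esub>"
    by (intro Q.r_inv j.hom_closed x)
  finally have jy: "?j y = \<one>\<^bsub>?Q\<^esub>" .
  have XX: "subtopology ?X' (cell_union T0) = ?X"
    using AT by (simp add: subtopology_subtopology Int_absorb1)
  have "exact_seq ([?Q, ?G', ?G], [?j, ?i])"
    using homology_exactness_triple_3[OF AT(1), of k ?X'] unfolding XX .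
  then have "kernel ?G' ?Q ?j = ?i ` carrier ?G"
    by simp
  then have "y \<in> ?i ` carrier ?G"
    using y jy unfolding kernel_def by blast
  then obtain w where w: "w \<in> carrier ?G" "y = ?i w" by blast
  obtain m :: "'c \<Rightarrow> int" where m: "w = (\<Otimes>\<^bsub>?G\<^esub>f\<in>E. subspace_class T0 f [^]\<^bsub>?G\<^esub> m f)"
    using insert.IH[OF E T0 w(1)] by blast
  define m' where "m' = m(e := m0)"
  have i_cls: "?i (subspace_class T0 f) = subspace_class T f" if "f \<in> E" for f
    using subspace_class_push[OF closed(2) TT ET0[OF that], of ?A]
    unfolding subspace_class_def[of T] dim[OF insertI2[OF that]] by blast
  have "y = (\<Otimes>\<^bsub>?G'\<^esub>f\<in>E. ?i (subspace_class T0 f [^]\<^bsub>?G\<^esub> m f))"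
    unfolding w(2) m using cls0 by (intro hom_finprod) (auto simp: hom_induced_hom)
  also have "\<dots> = (\<Otimes>\<^bsub>?G'\<^esub>f\<in>E. subspace_class T f [^]\<^bsub>?G'\<^esub> m' f)"
  proof (rule G'.finprod_cong')
    show "?i (subspace_class T0 f [^]\<^bsub>?G\<^esub> m f) = subspace_class T f [^]\<^bsub>?G'\<^esub> m' f" if "f \<in> E" for f
    proof -
      have "f \<noteq> e" using that insert.hyps by blast
      then show ?thesis
        unfolding m'_def i_cls[OF that, symmetric] using i.hom_int_pow[OF cls0[OF that], of "m f"] by simp
    qed
    show "(\<lambda>f. subspace_class T f [^]\<^bsub>?G'\<^esub> m' f) \<in> E \<rightarrow> carrier ?G'"
      using cls by blast
  qed simp
  finally have yy: "y = (\<Otimes>\<^bsub>?G'\<^esub>f\<in>E. subspace_class T f [^]\<^bsub>?G'\<^esub> m' f)" .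
  have "x = p \<otimes>\<^bsub>?G'\<^esub> y"
    unfolding y_def using x p by (metis G'.inv_closed G'.m_comm G'.inv_solve_right' y y_def)
  also have "\<dots> = (\<Otimes>\<^bsub>?G'\<^esub>f\<in>insert e E. subspace_class T f [^]\<^bsub>?G'\<^esub> m' f)"
  proof -
    have "(\<lambda>f. subspace_class T f [^]\<^bsub>?G'\<^esub> m' f) \<in> E \<rightarrow> carrier ?G'" "subspace_class T e [^]\<^bsub>?G'\<^esub> m' e \<in> carrier ?G'"
      using cls by blast+
    from G'.finprod_insert[OF insert.hyps(1,2) this] show ?thesis
      unfolding yy p_def by (simp add: m'_def)
  qed
  finally show ?case by blast
qed

text \<open>Collapsing everything except the open cell \<open>e\<close> kills the classes of all other cells and maps that of
\<open>e\<close> to an element of infinite order, so a relation has coefficient zero at \<open>e\<close>.\<close>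

lemma skeleton_classes_independent:
  fixes m :: "'c \<Rightarrow> int" and k :: int
  defines "G \<equiv> relative_homology_group k (subtopology (cw_space K) (skeleton K k)) (skeleton K (k - 1))"
  assumes eq: "(\<Otimes>\<^bsub>G\<^esub>f\<in>cells_of K k. subspace_class (skeleton_cells K k) f [^]\<^bsub>G\<^esub> m f) = \<one>\<^bsub>G\<^esub>"
    and e: "e \<in> cells_of K k"
  shows "m e = 0"
proof -
  let ?T = "skeleton_cells K k"
  let ?X = "subtopology (cw_space K) (cell_union ?T)" and ?B = "cell_union (?T - {e})" and ?A = "skeleton K (k - 1)"
  let ?Q = "relative_homology_group k ?X ?B"
  let ?j = "hom_induced k ?X ?A ?X ?B id"
  have dim: "int (cw_dim K f) = k" if "f \<in> cells_of K k" for f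
    using that by (auto simp: cells_of_def)
  have sub: "skeleton_cells K (k - 1) \<subseteq> ?T" using skeleton_cells_Un[of k] by blast
  have closed: "closed_cells ?T" by (rule closed_cellsI[OF sub order_refl])
  have AB: "?A \<subseteq> ?B" 
    unfolding skeleton_eq using sub cells_of_disjoint_skeleton[OF e] by (intro cell_union_mono) blast
  interpret G: comm_group G by (simp add: G_def)
  interpret Q: comm_group ?Q by simp
  interpret a: cell_attachment ?X ?B "cw_dim K e" "cw_char K e"
    using cells_of_subset e by (intro attach_top_cell[OF sub order_refl _ e]) blast
  have j: "?j \<in> hom G ?Q" unfolding G_def skeleton_eq[of k] by (rule hom_induced_hom)
  then interpret j: group_hom G ?Q ?j by unfold_locales
  have cls: "subspace_class ?T f \<in> carrier G" if "f \<in> cells_of K k" for f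
    unfolding subspace_class_def G_def dim[OF that] skeleton_eq[of k] by (rule hom_induced_carrier)
  have jf: "?j (subspace_class ?T f) = hom_induced k (disk (cw_dim K f)) (disk_sphere (cw_dim K f)) ?X ?B (cw_char K f) (disk_class (cw_dim K f))"
    if "f \<in> cells_of K k" for f
  proof -
    have "f \<in> ?T" using that cells_of_subset(1) by blast
    then show ?thesis
      using subspace_class_push[OF closed order_refl, of f ?B] AB unfolding dim[OF that] by blast
  qed
  have j0: "?j (subspace_class ?T f) = \<one>\<^bsub>?Q\<^esub>" if f: "f \<in> cells_of K k" "f \<noteq> e" for f
  proof -
    let ?Y = "subtopology (cw_space K) ?B"
    have fc: "f \<in> ?T - {e}" using f cells_of_subset(1) by blast
    have cl: "closed_cells (?T - {e})"
      using sub cells_of_disjoint_skeleton[OF e] by (intro closed_cellsI[of k]) blast+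
    have sph: "cw_char K f ` disk_sphere (cw_dim K f) \<subseteq> ?B"
      using char_sphere_skeleton[of f] f cells_of_subset(2) AB unfolding dim[OF f(1)] by blast
    have "?B \<subseteq> cell_union ?T" by (rule cell_union_mono) blast
    then have YX: "continuous_map ?Y ?X id"
      by (auto simp: continuous_map_in_subtopology)
    let ?Z = "relative_homology_group k ?Y ?B"
    let ?u = "hom_induced k ?Y ?B ?X ?B id"
    let ?v = "hom_induced k (disk (cw_dim K f)) (disk_sphere (cw_dim K f)) ?Y ?B (cw_char K f)"
    have comp: "hom_induced k (disk (cw_dim K f)) (disk_sphere (cw_dim K f)) ?X ?B (id \<circ> cw_char K f) = ?u \<circ> ?v"
      by (rule hom_induced_compose[OF continuous_char_cell_union[OF cl fc] _ YX]) (use sph in auto)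
    have "?B \<subseteq> topspace (cw_space K)"
      by (rule cell_union_subset) (auto simp: skeleton_cells_def)
    then have "topspace ?Y = ?B"
      by (simp only: topspace_subtopology Int_absorb1)
    then have "trivial_group ?Z"
      using trivial_relative_homology_group_topspace[of k ?Y] by (simp only:)
    then have "?v (disk_class (cw_dim K f)) = \<one>\<^bsub>?Z\<^esub>"
      using hom_induced_carrier[of k _ _ ?Y ?B] unfolding trivial_group_def by blast
    moreover have "?u \<one>\<^bsub>?Z\<^esub> = \<one>\<^bsub>?Q\<^esub>"
      by (rule hom_one[OF hom_induced_hom group_relative_homology_group group_relative_homology_group])
    ultimately show ?thesis
      using comp unfolding jf[OF f(1)] by simp
  qed
  have fin: "finite (cells_of K k)"
    using finite_subset[OF cells_of_subset(2) finite_cells] .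
  have closed_term: "(\<lambda>f. if e = f then ?j (subspace_class ?T f) [^]\<^bsub>?Q\<^esub> m f else \<one>\<^bsub>?Q\<^esub>) \<in> cells_of K k \<rightarrow> carrier ?Q"
  proof (rule Pi_I)
    fix f assume "f \<in> cells_of K k"
    then have "?j (subspace_class ?T f) [^]\<^bsub>?Q\<^esub> m f \<in> carrier ?Q"
      by (intro Q.int_pow_closed j.hom_closed cls)
    then show "(if e = f then ?j (subspace_class ?T f) [^]\<^bsub>?Q\<^esub> m f else \<one>\<^bsub>?Q\<^esub>) \<in> carrier ?Q"
      by (cases "e = f") (simp_all only: if_True if_False Q.one_closed refl)
  qed
  have pow: "?j (subspace_class ?T f [^]\<^bsub>G\<^esub> m f)
      = (if e = f then ?j (subspace_class ?T f) [^]\<^bsub>?Q\<^esub> m f else \<one>\<^bsub>?Q\<^esub>)" if f: "f \<in> cells_of K k" for f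
  proof (cases "e = f")
    case True
    show ?thesis unfolding if_P[OF True] by (rule j.hom_int_pow[OF cls[OF f]])
  next
    case False
    have "?j (subspace_class ?T f [^]\<^bsub>G\<^esub> m f) = \<one>\<^bsub>?Q\<^esub> [^]\<^bsub>?Q\<^esub> m f"
      using j.hom_int_pow[OF cls[OF f], of "m f"] unfolding j0[OF f not_sym[OF False]] .
    then show ?thesis unfolding if_not_P[OF False] Q.int_pow_one .
  qed
  have "\<one>\<^bsub>?Q\<^esub> = ?j (\<Otimes>\<^bsub>G\<^esub>f\<in>cells_of K k. subspace_class ?T f [^]\<^bsub>G\<^esub> m f)"
    unfolding eq by (rule j.hom_one[symmetric])
  also have "\<dots> = (\<Otimes>\<^bsub>?Q\<^esub>f\<in>cells_of K k. ?j (subspace_class ?T f [^]\<^bsub>G\<^esub> m f))"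
    using cls G.int_pow_closed by (intro hom_finprod j G.comm_group_axioms Q.comm_group_axioms) blast
  also have "\<dots> = (\<Otimes>\<^bsub>?Q\<^esub>f\<in>cells_of K k. if e = f then ?j (subspace_class ?T f) [^]\<^bsub>?Q\<^esub> m f else \<one>\<^bsub>?Q\<^esub>)"
    by (rule Q.finprod_cong'[OF refl closed_term pow])
  also have "\<dots> = ?j (subspace_class ?T e) [^]\<^bsub>?Q\<^esub> m e"
    by (rule Q.finprod_singleton[OF e fin]) (intro Pi_I Q.int_pow_closed j.hom_closed cls)
  finally have "?j (subspace_class ?T e) [^]\<^bsub>?Q\<^esub> m e = \<one>\<^bsub>?Q\<^esub>" by (rule sym)
  then show ?thesis
    unfolding jf[OF e] by (intro a.char_class_infinite_order[of "m e"]) (simp only: dim[OF e])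
qed

end

section \<open>Incidence numbers\<close>

lemma (in comm_group) finprod_int_pow:
  assumes "a \<in> S \<rightarrow> carrier G"
  shows "finprod G a S [^] (m::int) = finprod G (\<lambda>s. a s [^] m) S"
proof (rule hom_finprod[where h="\<lambda>x. x [^] m"])
  show "(\<lambda>x. x [^] m) \<in> hom G G"
    by (auto simp: hom_def int_pow_distrib)
qed (use assms comm_group_axioms in auto)

lemma (in comm_group) finprod_pow_combine:
  fixes m :: "'i \<Rightarrow> int" and n :: "'i \<Rightarrow> 'j \<Rightarrow> int"
  assumes "finite F" "c \<in> S \<rightarrow> carrier G"
  shows "finprod G (\<lambda>f. finprod G (\<lambda>g. c g [^] n f g) S [^] m f) F
    = finprod G (\<lambda>g. c g [^] (\<Sum>f\<in>F. m f * n f g)) S"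
  using assms(1)
proof (induction F rule: finite_induct)
  case empty
  then show ?case by simp
next
  case (insert x F)
  have c: "c g \<in> carrier G" if "g \<in> S" for g using assms(2) that by auto
  have "finprod G (\<lambda>f. finprod G (\<lambda>g. c g [^] n f g) S [^] m f) (insert x F)
    = finprod G (\<lambda>g. c g [^] n x g) S [^] m x \<otimes> finprod G (\<lambda>g. c g [^] (\<Sum>f\<in>F. m f * n f g)) S"
    using insert c by (subst finprod_insert) auto
  also have "finprod G (\<lambda>g. c g [^] n x g) S [^] m x = finprod G (\<lambda>g. (c g [^] n x g) [^] m x) S"
    using c by (intro finprod_int_pow) auto
  also have "\<dots> \<otimes> finprod G (\<lambda>g. c g [^] (\<Sum>f\<in>F. m f * n f g)) S
    = finprod G (\<lambda>g. (c g [^] n x g) [^] m x \<otimes> c g [^] (\<Sum>f\<in>F. m f * n f g)) S"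
    using c by (intro finprod_multf[symmetric]) auto
  also have "\<dots> = finprod G (\<lambda>g. c g [^] (\<Sum>f\<in>insert x F. m f * n f g)) S"
    using insert.hyps c by (intro finprod_cong') (auto simp: int_pow_pow int_pow_mult mult.commute)
  finally show ?case .
qed

context finite_cw
begin

lemma finite_cells_of: "finite (cells_of K k)"
  by (rule finite_subset[OF cells_of_subset(2) finite_cells])

lemma cell_class_eq: "e \<in> cells_of K k \<Longrightarrow> cell_class K e = subspace_class (skeleton_cells K k) e"
  by (auto simp: cell_class_def subspace_class_def cells_of_def skeleton_eq Let_def)

lemma skeleton_homology_eq:
  "skeleton_homology K k = relative_homology_group k (subtopology (cw_space K) (cell_union (skeleton_cells K k))) (skeleton K (k - 1))"
  by (simp add: skeleton_homology_def skeleton_eq)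

lemma comm_group_skeleton_homology: "comm_group (skeleton_homology K k)"
  by (simp add: skeleton_homology_def)

lemma cell_class_carrier: "e \<in> cells_of K k \<Longrightarrow> cell_class K e \<in> carrier (skeleton_homology K k)"
proof -
  assume e: "e \<in> cells_of K k"
  then have dim: "int (cw_dim K e) = k" by (simp add: cells_of_def)
  show ?thesis
    unfolding cell_class_def Let_def skeleton_homology_def dim by (rule hom_induced_carrier)
qed

lemma cell_classes_generate:
  assumes "x \<in> carrier (skeleton_homology K k)"
  shows "\<exists>m::'c \<Rightarrow> int. x = (\<Otimes>\<^bsub>skeleton_homology K k\<^esub>f\<in>cells_of K k. cell_class K f [^]\<^bsub>skeleton_homology K k\<^esub> m f)"
proof -
  interpret comm_group "skeleton_homology K k" by (rule comm_group_skeleton_homology)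
  obtain m :: "'c \<Rightarrow> int" where m: "x = (\<Otimes>\<^bsub>skeleton_homology K k\<^esub>f\<in>cells_of K k. subspace_class (skeleton_cells K k) f [^]\<^bsub>skeleton_homology K k\<^esub> m f)"
    using skeleton_classes_generate[OF finite_cells_of order_refl skeleton_cells_Un, of x k] assms
    unfolding skeleton_homology_eq by blast
  have "x = (\<Otimes>\<^bsub>skeleton_homology K k\<^esub>f\<in>cells_of K k. cell_class K f [^]\<^bsub>skeleton_homology K k\<^esub> m f)"
    unfolding m
  proof (rule finprod_cong'[OF refl])
    show "(\<lambda>f. cell_class K f [^]\<^bsub>skeleton_homology K k\<^esub> m f) \<in> cells_of K k \<rightarrow> carrier (skeleton_homology K k)"
      by (intro Pi_I int_pow_closed cell_class_carrier)
    fix f assume "f \<in> cells_of K k"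
    then show "subspace_class (skeleton_cells K k) f [^]\<^bsub>skeleton_homology K k\<^esub> m f = cell_class K f [^]\<^bsub>skeleton_homology K k\<^esub> m f"
      by (simp only: cell_class_eq)
  qed
  then show ?thesis by (rule exI[of _ m])
qed

lemma cell_classes_independent:
  fixes m :: "'c \<Rightarrow> int"
  assumes "(\<Otimes>\<^bsub>skeleton_homology K k\<^esub>f\<in>cells_of K k. cell_class K f [^]\<^bsub>skeleton_homology K k\<^esub> m f) = \<one>\<^bsub>skeleton_homology K k\<^esub>"
    and e: "e \<in> cells_of K k"
  shows "m e = 0"
proof -
  interpret comm_group "skeleton_homology K k" by (rule comm_group_skeleton_homology)
  have "(\<Otimes>\<^bsub>skeleton_homology K k\<^esub>f\<in>cells_of K k. subspace_class (skeleton_cells K k) f [^]\<^bsub>skeleton_homology K k\<^esub> m f)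
    = (\<Otimes>\<^bsub>skeleton_homology K k\<^esub>f\<in>cells_of K k. cell_class K f [^]\<^bsub>skeleton_homology K k\<^esub> m f)"
  proof (rule finprod_cong'[OF refl])
    show "(\<lambda>f. cell_class K f [^]\<^bsub>skeleton_homology K k\<^esub> m f) \<in> cells_of K k \<rightarrow> carrier (skeleton_homology K k)"
      by (intro Pi_I int_pow_closed cell_class_carrier)
    fix f assume "f \<in> cells_of K k"
    then show "subspace_class (skeleton_cells K k) f [^]\<^bsub>skeleton_homology K k\<^esub> m f = cell_class K f [^]\<^bsub>skeleton_homology K k\<^esub> m f"
      by (simp only: cell_class_eq)
  qed
  then show ?thesis
    using skeleton_classes_independent[OF _ e, of m] assms(1) unfolding skeleton_homology_def by (simp only:)
qed

lemma cell_classes_unique: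
  fixes m n :: "'c \<Rightarrow> int"
  assumes "(\<Otimes>\<^bsub>skeleton_homology K k\<^esub>f\<in>cells_of K k. cell_class K f [^]\<^bsub>skeleton_homology K k\<^esub> m f)
      = (\<Otimes>\<^bsub>skeleton_homology K k\<^esub>f\<in>cells_of K k. cell_class K f [^]\<^bsub>skeleton_homology K k\<^esub> n f)"
    and e: "e \<in> cells_of K k"
  shows "m e = n e"
proof -
  let ?G = "skeleton_homology K k"
  interpret comm_group ?G by (rule comm_group_skeleton_homology)
  have pow: "(\<lambda>f. cell_class K f [^]\<^bsub>?G\<^esub> j f) \<in> cells_of K k \<rightarrow> carrier ?G" for j :: "'c \<Rightarrow> int"
    by (intro Pi_I int_pow_closed cell_class_carrier)
  define l where "l f = m f - n f" for f
  have "(\<Otimes>\<^bsub>?G\<^esub>f\<in>cells_of K k. cell_class K f [^]\<^bsub>?G\<^esub> m f)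
    = (\<Otimes>\<^bsub>?G\<^esub>f\<in>cells_of K k. cell_class K f [^]\<^bsub>?G\<^esub> l f \<otimes>\<^bsub>?G\<^esub> cell_class K f [^]\<^bsub>?G\<^esub> n f)"
  proof (rule finprod_cong'[OF refl])
    show "(\<lambda>f. cell_class K f [^]\<^bsub>?G\<^esub> l f \<otimes>\<^bsub>?G\<^esub> cell_class K f [^]\<^bsub>?G\<^esub> n f) \<in> cells_of K k \<rightarrow> carrier ?G"
      using pow by (intro Pi_I m_closed int_pow_closed cell_class_carrier)
    fix f assume "f \<in> cells_of K k"
    then show "cell_class K f [^]\<^bsub>?G\<^esub> m f = cell_class K f [^]\<^bsub>?G\<^esub> l f \<otimes>\<^bsub>?G\<^esub> cell_class K f [^]\<^bsub>?G\<^esub> n f"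
      using int_pow_mult[OF cell_class_carrier, of f "l f" "n f"] by (simp add: l_def)
  qed
  also have "\<dots> = (\<Otimes>\<^bsub>?G\<^esub>f\<in>cells_of K k. cell_class K f [^]\<^bsub>?G\<^esub> l f) \<otimes>\<^bsub>?G\<^esub> (\<Otimes>\<^bsub>?G\<^esub>f\<in>cells_of K k. cell_class K f [^]\<^bsub>?G\<^esub> n f)"
    by (rule finprod_multf[OF pow pow])
  finally have "(\<Otimes>\<^bsub>?G\<^esub>f\<in>cells_of K k. cell_class K f [^]\<^bsub>?G\<^esub> l f) = \<one>\<^bsub>?G\<^esub>"
    unfolding assms(1) using finprod_closed[OF pow, of l] finprod_closed[OF pow, of n]
    by (simp only: r_cancel_one')
  then have "l e = 0" using e by (rule cell_classes_independent)
  then show ?thesis by (simp add: l_def)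
qed

text \<open>Incidence numbers are defined by a definite description; it denotes because the cell classes form
a basis.\<close>

lemma incidence_spec:
  assumes e: "e \<in> cells_of K k"
  defines "G \<equiv> skeleton_homology K (k - 1)"
  shows "skeleton_boundary K k (cell_class K e)
      = (\<Otimes>\<^bsub>G\<^esub>f\<in>cells_of K (k - 1). cell_class K f [^]\<^bsub>G\<^esub> incidence K e f)"
proof -
  interpret comm_group G unfolding G_def by (rule comm_group_skeleton_homology)
  define P where "P n \<longleftrightarrow> (\<forall>f. f \<notin> cells_of K (k - 1) \<longrightarrow> n f = 0) \<and>
        skeleton_boundary K k (cell_class K e) =
          (\<Otimes>\<^bsub>G\<^esub> f\<in>cells_of K (k - 1). cell_class K f [^]\<^bsub>G\<^esub> n f)" for n :: "'c \<Rightarrow> int"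
  have dim: "int (cw_dim K e) = k" using e by (simp add: cells_of_def)
  have inc: "incidence K e = (THE n. P n)"
    unfolding incidence_def Let_def dim P_def G_def ..
  have "skeleton_boundary K k (cell_class K e) \<in> carrier G"
  proof -
    have "subtopology (subtopology (cw_space K) (skeleton K k)) (skeleton K (k - 1)) = subtopology (cw_space K) (skeleton K (k - 1))"
      using skeleton_mono[of "k - 1" k] by (simp add: subtopology_subtopology Int_absorb1)
    then show ?thesis
      using hom_relboundary[of k "subtopology (cw_space K) (skeleton K k)" "skeleton K (k - 1)" "skeleton K (k - 2)" "cell_class K e"]
      unfolding skeleton_boundary_def G_def skeleton_homology_def by simp
  qed
  then obtain m :: "'c \<Rightarrow> int" where m: "skeleton_boundary K k (cell_class K e)
      = (\<Otimes>\<^bsub>G\<^esub>f\<in>cells_of K (k - 1). cell_class K f [^]\<^bsub>G\<^esub> m f)"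
    using cell_classes_generate unfolding G_def by blast
  define n where "n f = (if f \<in> cells_of K (k - 1) then m f else 0)" for f
  have "P n"
    unfolding P_def m
  proof (intro conjI finprod_cong'[OF refl])
    show "(\<lambda>f. cell_class K f [^]\<^bsub>G\<^esub> n f) \<in> cells_of K (k - 1) \<rightarrow> carrier G"
      unfolding G_def by (intro Pi_I group.int_pow_closed cell_class_carrier comm_group.axioms(2) comm_group_skeleton_homology)
  qed (simp_all add: n_def)
  moreover have "n' = n" if "P n'" for n'
  proof
    fix f
    show "n' f = n f"
    proof (cases "f \<in> cells_of K (k - 1)")
      case True
      have "(\<Otimes>\<^bsub>G\<^esub> f\<in>cells_of K (k - 1). cell_class K f [^]\<^bsub>G\<^esub> n' f)
          = (\<Otimes>\<^bsub>G\<^esub> f\<in>cells_of K (k - 1). cell_class K f [^]\<^bsub>G\<^esub> n f)"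
        using that[unfolded P_def, THEN conjunct2] \<open>P n\<close>[unfolded P_def, THEN conjunct2]
        by (rule trans[OF sym])
      then show ?thesis unfolding G_def using True by (rule cell_classes_unique)
    qed (use that \<open>P n\<close> in \<open>simp add: P_def\<close>)
  qed
  ultimately have "P (incidence K e)"
    unfolding inc by (rule theI)
  then show "skeleton_boundary K k (cell_class K e)
      = (\<Otimes>\<^bsub>G\<^esub>f\<in>cells_of K (k - 1). cell_class K f [^]\<^bsub>G\<^esub> incidence K e f)"
    unfolding P_def by (rule conjunct2)
qed

lemma skeleton_subtopology: "j \<le> k \<Longrightarrow> subtopology (subtopology (cw_space K) (skeleton K k)) (skeleton K j) = subtopology (cw_space K) (skeleton K j)"
  using skeleton_mono[of j k] by (simp add: subtopology_subtopology Int_absorb1)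

lemma skeleton_boundary_hom: "skeleton_boundary K k \<in> hom (skeleton_homology K k) (skeleton_homology K (k - 1))"
  using group_homomorphism_hom_relboundary[of k "subtopology (cw_space K) (skeleton K k)" "skeleton K (k - 1)" "skeleton K (k - 2)"]
  by (simp add: skeleton_boundary_def skeleton_homology_def skeleton_subtopology)

text \<open>The composite contains two consecutive maps of the long exact sequence of the pair of the two
lower skeleta.\<close>

lemma skeleton_boundary_twice:
  "skeleton_boundary K (k - 1) (skeleton_boundary K k x) = \<one>\<^bsub>skeleton_homology K (k - 2)\<^esub>"
proof -
  let ?X = "subtopology (cw_space K) (skeleton K k)" and ?Y = "subtopology (cw_space K) (skeleton K (k - 1))"
  let ?A = "skeleton K (k - 1)" and ?B = "skeleton K (k - 2)" and ?Z = "subtopology (cw_space K) (skeleton K (k - 2))"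
  let ?u = "hom_boundary k ?X ?A x"
  have XY: "subtopology ?X ?A = ?Y" and YZ: "subtopology ?Y ?B = ?Z"
    by (simp_all add: skeleton_subtopology)
  have u: "?u \<in> carrier (homology_group (k - 1) ?Y)"
    using hom_boundary_carrier[of k ?X ?A x] unfolding XY .
  have "exact_seq ([homology_group (k - 1 - 1) (subtopology ?Y ?B), relative_homology_group (k - 1) ?Y ?B, homology_group (k - 1) ?Y],
              [hom_boundary (k - 1) ?Y ?B, hom_induced (k - 1) ?Y {} ?Y ?B id])"
    by (rule homology_exactness_axiom_1)
  then have "kernel (relative_homology_group (k - 1) ?Y ?B) (homology_group (k - 1 - 1) ?Z) (hom_boundary (k - 1) ?Y ?B)
     = hom_induced (k - 1) ?Y {} ?Y ?B id ` carrier (homology_group (k - 1) ?Y)"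
    unfolding YZ by simp
  then have "hom_boundary (k - 1) ?Y ?B (hom_induced (k - 1) ?Y {} ?Y ?B id ?u) = \<one>\<^bsub>homology_group (k - 2) ?Z\<^esub>"
    using u unfolding kernel_def by (auto simp: diff_diff_eq)
  moreover have "hom_induced (k - 2) ?Z {} ?Z (skeleton K (k - 3)) id \<one>\<^bsub>homology_group (k - 2) ?Z\<^esub>
      = \<one>\<^bsub>relative_homology_group (k - 2) ?Z (skeleton K (k - 3))\<^esub>"
    by (rule hom_one[OF hom_induced_hom group_relative_homology_group group_relative_homology_group])
  moreover have "k - 1 - 1 = k - 2" "k - 1 - 2 = k - 3" "k - 2 - 1 = k - 3" by simp_all
  ultimately show ?thesis
    unfolding skeleton_boundary_def skeleton_homology_def hom_relboundary_def comp_def XY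
    by (simp only: YZ)
qed

lemma incidence_incidence:
  assumes e: "e \<in> cells_of K k" and g: "g \<in> cells_of K (k - 2)"
  shows "(\<Sum>f\<in>cells_of K (k - 1). incidence K e f * incidence K f g) = 0"
proof -
  let ?G = "skeleton_homology K (k - 1)" and ?H = "skeleton_homology K (k - 2)"
  let ?d = "skeleton_boundary K (k - 1)"
  have k: "k - 1 - 1 = k - 2" by simp
  interpret G: comm_group ?G by (rule comm_group_skeleton_homology)
  interpret H: comm_group ?H by (rule comm_group_skeleton_homology)
  have d: "?d \<in> hom ?G ?H"
    using skeleton_boundary_hom[of "k - 1"] unfolding k .
  interpret d: group_hom ?G ?H ?d by unfold_locales (rule d)
  have "\<one>\<^bsub>?H\<^esub> = ?d (\<Otimes>\<^bsub>?G\<^esub>f\<in>cells_of K (k - 1). cell_class K f [^]\<^bsub>?G\<^esub> incidence K e f)"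
    using skeleton_boundary_twice[of k "cell_class K e"] unfolding incidence_spec[OF e] by (rule sym)
  also have "\<dots> = (\<Otimes>\<^bsub>?H\<^esub>f\<in>cells_of K (k - 1). ?d (cell_class K f [^]\<^bsub>?G\<^esub> incidence K e f))"
    by (intro hom_finprod G.comm_group_axioms H.comm_group_axioms d Pi_I G.int_pow_closed cell_class_carrier)
  also have "\<dots> = (\<Otimes>\<^bsub>?H\<^esub>f\<in>cells_of K (k - 1).
      (\<Otimes>\<^bsub>?H\<^esub>g\<in>cells_of K (k - 2). cell_class K g [^]\<^bsub>?H\<^esub> incidence K f g) [^]\<^bsub>?H\<^esub> incidence K e f)"
  proof (rule H.finprod_cong'[OF refl])
    show "(\<lambda>f. (\<Otimes>\<^bsub>?H\<^esub>g\<in>cells_of K (k - 2). cell_class K g [^]\<^bsub>?H\<^esub> incidence K f g) [^]\<^bsub>?H\<^esub> incidence K e f)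
       \<in> cells_of K (k - 1) \<rightarrow> carrier ?H"
      by (intro Pi_I H.int_pow_closed H.finprod_closed cell_class_carrier)
    fix f assume f: "f \<in> cells_of K (k - 1)"
    show "?d (cell_class K f [^]\<^bsub>?G\<^esub> incidence K e f)
      = (\<Otimes>\<^bsub>?H\<^esub>g\<in>cells_of K (k - 2). cell_class K g [^]\<^bsub>?H\<^esub> incidence K f g) [^]\<^bsub>?H\<^esub> incidence K e f"
      unfolding incidence_spec[OF f, unfolded k, symmetric]
      by (rule d.hom_int_pow[OF cell_class_carrier[OF f]])
  qed
  also have "\<dots> = (\<Otimes>\<^bsub>?H\<^esub>g\<in>cells_of K (k - 2). cell_class K g [^]\<^bsub>?H\<^esub>
      (\<Sum>f\<in>cells_of K (k - 1). incidence K e f * incidence K f g))"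
    by (rule H.finprod_pow_combine[OF finite_cells_of]) (intro Pi_I cell_class_carrier)
  finally show ?thesis
    by (rule cell_classes_independent[where m="\<lambda>g. \<Sum>f\<in>cells_of K (k - 1). incidence K e f * incidence K f g", OF sym g])
qed

end

text \<open>Subcomplexes that contain the whole codimension-one skeleton, so that only top cells are missing.
They have the same skeleta as \<open>K\<close> below the top dimension. For a top cell, the inclusion of the
subcomplex preserves the cell class, and naturality of the boundary map then shows that the
incidence numbers are those of \<open>K\<close>.\<close>

locale cw_with_top_cells = finite_cw K for K :: "('p, 'c) cw" +
  fixes d :: nat and T :: "'c set"
  assumes T_cells: "T \<subseteq> cw_cells K" and T_skeleton: "skeleton_cells K (int d - 1) \<subseteq> T"
    and dim_le: "e \<in> cw_cells K \<Longrightarrow> cw_dim K e \<le> d"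
begin

lemma restrict_cw_simps [simp]:
  "cw_cells (restrict_cw K T) = T" "cw_dim (restrict_cw K T) = cw_dim K" "cw_char (restrict_cw K T) = cw_char K"
  "cw_space (restrict_cw K T) = subtopology (cw_space K) (cell_union T)"
  "open_cell (restrict_cw K T) = open_cell K"
  by (auto simp: restrict_cw_def cell_union_def open_cell_def)

lemma skeleton_cells_restrict: "skeleton_cells (restrict_cw K T) k = T \<inter> skeleton_cells K k"
  using T_cells by (auto simp: skeleton_cells_def)

lemma cells_of_restrict: "cells_of (restrict_cw K T) k = T \<inter> cells_of K k"
  using T_cells by (auto simp: cells_of_def)

lemma skeleton_cells_subset: "k \<le> int d - 1 \<Longrightarrow> skeleton_cells K k \<subseteq> T"
  using T_skeleton by (auto simp: skeleton_cells_def)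

lemma cells_of_restrict_low: "k \<le> int d - 1 \<Longrightarrow> cells_of (restrict_cw K T) k = cells_of K k"
  unfolding cells_of_restrict using skeleton_cells_subset[of k] cells_of_subset(1)[of k] by blast

lemma skeleton_restrict: "skeleton (restrict_cw K T) k = cell_union (T \<inter> skeleton_cells K k)"
  unfolding skeleton_def skeleton_cells_restrict by (simp add: cell_union_def)

lemma skeleton_restrict_low: "k \<le> int d - 1 \<Longrightarrow> skeleton (restrict_cw K T) k = skeleton K k"
  unfolding skeleton_restrict skeleton_eq using skeleton_cells_subset[of k] by (simp add: Int_absorb1)

lemma subtopology_skeleton_restrict:
  "subtopology (cw_space (restrict_cw K T)) (skeleton (restrict_cw K T) k)
    = subtopology (cw_space K) (cell_union (T \<inter> skeleton_cells K k))"
  unfolding skeleton_restrict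
  using cell_union_mono[of "T \<inter> skeleton_cells K k" T] by (simp add: subtopology_subtopology Int_absorb1)

lemma subtopology_skeleton_restrict_low:
  "k \<le> int d - 1 \<Longrightarrow> subtopology (cw_space (restrict_cw K T)) (skeleton (restrict_cw K T) k)
    = subtopology (cw_space K) (skeleton K k)"
  using skeleton_restrict_low[of k] unfolding subtopology_skeleton_restrict unfolding skeleton_restrict
  by (simp only:)

lemma skeleton_homology_restrict:
  "k \<le> int d - 1 \<Longrightarrow> skeleton_homology (restrict_cw K T) k = skeleton_homology K k"
  unfolding skeleton_homology_def subtopology_skeleton_restrict_low by (simp only: skeleton_restrict_low)

lemma cell_class_restrict:
  assumes "int (cw_dim K e) \<le> int d - 1"
  shows "cell_class (restrict_cw K T) e = cell_class K e"
  unfolding cell_class_def Let_def restrict_cw_simps(2,3) subtopology_skeleton_restrict_low[OF assms]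
  using assms by (simp only: skeleton_restrict_low)

lemma skeleton_boundary_restrict:
  assumes e: "e \<in> T" "int (cw_dim K e) = k"
  shows "skeleton_boundary (restrict_cw K T) k (cell_class (restrict_cw K T) e) = skeleton_boundary K k (cell_class K e)"
proof -
  have k: "k \<le> int d" using e T_cells dim_le by fastforce
  let ?S = "T \<inter> skeleton_cells K k"
  let ?X' = "subtopology (cw_space K) (cell_union ?S)" and ?X = "subtopology (cw_space K) (skeleton K k)"
  let ?A = "skeleton K (k - 1)" and ?B = "skeleton K (k - 2)"
  let ?Y = "subtopology (cw_space K) ?A"
  let ?i = "hom_induced k ?X' ?A ?X ?A id"
  have S: "skeleton_cells K (k - 1) \<subseteq> ?S" "?S \<subseteq> skeleton_cells K k" "e \<in> ?S"
    using skeleton_cells_subset[of "k - 1"] k skeleton_cells_Un[of k] e T_cells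
    by (auto simp: skeleton_cells_def)
  have closed: "closed_cells ?S" by (rule closed_cellsI[OF S(1,2)])
  have AS: "?A \<subseteq> cell_union ?S" "cell_union ?S \<subseteq> skeleton K k"
    unfolding skeleton_eq by (rule cell_union_mono[OF S(1)], rule cell_union_mono[OF S(2)])
  have XY: "subtopology ?X ?A = ?Y" "subtopology ?X' ?A = ?Y"
    using AS by (auto simp: subtopology_subtopology Int_absorb1 Int_absorb2)
  have skel: "skeleton (restrict_cw K T) (k - 1) = ?A" "skeleton (restrict_cw K T) (k - 2) = ?B"
    using k by (intro skeleton_restrict_low; linarith)+
  have cls': "cell_class (restrict_cw K T) e = subspace_class ?S e"
    unfolding cell_class_def subspace_class_def Let_def restrict_cw_simps(2,3) e(2) skel
      subtopology_skeleton_restrict ..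
  have "continuous_map ?X' ?X id"
    using AS by (auto simp: continuous_map_in_subtopology)
  then have nat: "hom_relboundary k ?X ?A ?B \<circ> ?i = hom_induced (k - 1) ?Y ?B ?Y ?B id \<circ> hom_relboundary k ?X' ?A ?B"
    using naturality_hom_induced_relboundary[of ?X' ?X id ?A ?A ?B ?B k] unfolding XY by simp
  have "?i (subspace_class ?S e) = cell_class K e"
    using subspace_class_push[OF closed S(2,3), of ?A]
    unfolding e(2) cell_class_def Let_def skeleton_eq[symmetric] by blast
  then have "skeleton_boundary K k (cell_class K e) = (hom_relboundary k ?X ?A ?B \<circ> ?i) (subspace_class ?S e)"
    unfolding skeleton_boundary_def by simp
  also have "\<dots> = hom_induced (k - 1) ?Y ?B ?Y ?B id (hom_relboundary k ?X' ?A ?B (subspace_class ?S e))"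
    unfolding nat by simp
  also have "\<dots> = hom_relboundary k ?X' ?A ?B (subspace_class ?S e)"
    using hom_relboundary[of k ?X' ?A ?B] unfolding XY by (intro hom_induced_id)
  also have "\<dots> = skeleton_boundary (restrict_cw K T) k (cell_class (restrict_cw K T) e)"
    unfolding skeleton_boundary_def subtopology_skeleton_restrict skel cls' ..
  finally show ?thesis ..
qed

lemma incidence_restrict:
  assumes e: "e \<in> T"
  shows "incidence (restrict_cw K T) e = incidence K e"
proof -
  define k where "k = int (cw_dim K e)"
  have k: "k - 1 \<le> int d - 1" using e T_cells dim_le by (fastforce simp: k_def)
  let ?G = "skeleton_homology K (k - 1)"
  interpret comm_group ?G by (rule comm_group_skeleton_homology)
  have prod: "(\<Otimes>\<^bsub>?G\<^esub>f\<in>cells_of K (k - 1). cell_class (restrict_cw K T) f [^]\<^bsub>?G\<^esub> n f)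
      = (\<Otimes>\<^bsub>?G\<^esub>f\<in>cells_of K (k - 1). cell_class K f [^]\<^bsub>?G\<^esub> n f)" for n :: "'c \<Rightarrow> int"
  proof (rule finprod_cong'[OF refl])
    show "(\<lambda>f. cell_class K f [^]\<^bsub>?G\<^esub> n f) \<in> cells_of K (k - 1) \<rightarrow> carrier ?G"
      by (intro Pi_I int_pow_closed cell_class_carrier)
    fix f assume "f \<in> cells_of K (k - 1)"
    then have "int (cw_dim K f) \<le> int d - 1" using k by (auto simp: cells_of_def)
    then show "cell_class (restrict_cw K T) f [^]\<^bsub>?G\<^esub> n f = cell_class K f [^]\<^bsub>?G\<^esub> n f"
      by (simp only: cell_class_restrict)
  qed
  show ?thesis
    unfolding incidence_def Let_def restrict_cw_simps(2) k_def[symmetric]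
      skeleton_boundary_restrict[OF e k_def[symmetric]] skeleton_homology_restrict[OF k]
      cells_of_restrict_low[OF k] prod ..
qed

lemma subcomplex_T: "T \<subseteq> skeleton_cells K d \<Longrightarrow> subcomplex K T"
  using closedin_cell_union[OF closed_cellsI[OF T_skeleton]] T_cells
  unfolding subcomplex_def cell_union_def by blast

end

section \<open>Linear algebra over the integers\<close>

text \<open>Gaussian elimination without division. One induction serves two purposes: more vectors than
coordinates are dependent over the integers, and integer vectors that are dependent over the reals
are dependent over the integers.\<close>

lemma integer_relation:
  fixes v :: "'i \<Rightarrow> 'f \<Rightarrow> int"
  assumes "finite F" "finite I"
    and "card F < card I \<or> (\<exists>x::'i \<Rightarrow> real. (\<exists>i\<in>I. x i \<noteq> 0) \<and> (\<forall>f\<in>F. (\<Sum>i\<in>I. x i * of_int (v i f)) = 0))"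
  shows "\<exists>n::'i \<Rightarrow> int. (\<exists>i\<in>I. n i \<noteq> 0) \<and> (\<forall>f\<in>F. (\<Sum>i\<in>I. n i * v i f) = 0)"
  using assms
proof (induction F arbitrary: I v rule: finite_induct)
  case empty
  then have "I \<noteq> {}" by auto
  then show ?case by (intro exI[of _ "\<lambda>_. 1"]) auto
next
  case (insert f F)
  show ?case
  proof (cases "\<forall>i\<in>I. v i f = 0")
    case True
    have "card F < card I \<or> (\<exists>x::'i \<Rightarrow> real. (\<exists>i\<in>I. x i \<noteq> 0) \<and> (\<forall>f\<in>F. (\<Sum>i\<in>I. x i * of_int (v i f)) = 0))"
      using insert.prems(2) insert.hyps by auto
    from insert.IH[OF insert.prems(1) this] show ?thesis
      using True by auto
  next
    case False
    then obtain j where j: "j \<in> I" "v j f \<noteq> 0" by blast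
    let ?J = "I - {j}"
    define w where "w i g = v j f * v i g - v i f * v j g" for i g
    have split: "(\<Sum>i\<in>I. h i) = h j + (\<Sum>i\<in>?J. h i)" for h :: "'i \<Rightarrow> 'z::comm_monoid_add"
      using insert.prems(1) j(1) by (rule sum.remove)
    have "card F < card ?J \<or> (\<exists>x::'i \<Rightarrow> real. (\<exists>i\<in>?J. x i \<noteq> 0) \<and> (\<forall>g\<in>F. (\<Sum>i\<in>?J. x i * of_int (w i g)) = 0))"
      using insert.prems(2)
    proof
      assume "card (insert f F) < card I"
      then show ?thesis using insert.hyps insert.prems(1) j by auto
    next
      assume "\<exists>x::'i \<Rightarrow> real. (\<exists>i\<in>I. x i \<noteq> 0) \<and> (\<forall>g\<in>insert f F. (\<Sum>i\<in>I. x i * of_int (v i g)) = 0)"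
      then obtain x :: "'i \<Rightarrow> real" where x: "\<exists>i\<in>I. x i \<noteq> 0"
        "\<And>g. g \<in> insert f F \<Longrightarrow> (\<Sum>i\<in>?J. x i * of_int (v i g)) = - (x j * of_int (v j g))"
        by (auto simp: split eq_neg_iff_add_eq_0 add.commute)
      have "\<exists>i\<in>?J. x i \<noteq> 0"
      proof (rule ccontr)
        assume "\<not> ?thesis"
        then have "x j * of_int (v j f) = 0" using x(2)[of f] by auto
        then have "x j = 0" using j by simp
        with \<open>\<not> ?thesis\<close> x(1) show False by auto
      qed
      moreover have "(\<Sum>i\<in>?J. x i * of_int (w i g)) = 0" if "g \<in> F" for g
      proof -
        have "(\<Sum>i\<in>?J. x i * of_int (w i g))
          = of_int (v j f) * (\<Sum>i\<in>?J. x i * of_int (v i g)) - (\<Sum>i\<in>?J. x i * of_int (v i f)) * of_int (v j g)"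
          by (simp add: w_def sum_distrib_left sum_distrib_right sum_subtractf algebra_simps)
        also have "\<dots> = 0" using x(2)[of f] x(2)[of g] that by simp
        finally show ?thesis .
      qed
      ultimately show ?thesis by blast
    qed
    from insert.IH[OF finite_Diff[OF insert.prems(1)] this]
    obtain n where n: "\<exists>i\<in>?J. n i \<noteq> 0" "\<forall>g\<in>F. (\<Sum>i\<in>?J. n i * w i g) = 0" by blast
    define m where "m i = (if i = j then - (\<Sum>i\<in>?J. n i * v i f) else v j f * n i)" for i
    have m: "(\<Sum>i\<in>I. m i * v i g) = (\<Sum>i\<in>?J. n i * w i g)" for g
    proof -
      have "(\<Sum>i\<in>?J. m i * v i g) = (\<Sum>i\<in>?J. v j f * n i * v i g)"
        by (rule sum.cong) (auto simp: m_def)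
      then show ?thesis
        by (simp add: split m_def w_def sum_distrib_left sum_distrib_right sum_subtractf algebra_simps)
    qed
    have "(\<Sum>i\<in>?J. n i * w i f) = 0" by (rule sum.neutral) (simp add: w_def)
    then have "\<forall>g\<in>insert f F. (\<Sum>i\<in>I. m i * v i g) = 0"
      using n(2) m by auto
    moreover obtain i where "i \<in> ?J" "n i \<noteq> 0" using n(1) by blast
    then have "\<exists>i\<in>I. m i \<noteq> 0"
      using j by (intro bexI[of _ i]) (auto simp: m_def)
    ultimately show ?thesis by blast
  qed
qed

text \<open>The orthogonal complement of the kernel of a matrix is the image of its transpose. The proof
eliminates one column with a pivot row \<open>j\<close>, again by induction on the columns.\<close>

lemma annihilator_in_row_space:
  fixes a :: "'e \<Rightarrow> 'f \<Rightarrow> real" and x :: "'e \<Rightarrow> real"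
  assumes "finite F" "finite E"
    and "\<And>c::'e \<Rightarrow> real. (\<And>f. f \<in> F \<Longrightarrow> (\<Sum>e\<in>E. c e * a e f) = 0) \<Longrightarrow> (\<Sum>e\<in>E. c e * x e) = 0"
  shows "\<exists>y. \<forall>e\<in>E. x e = (\<Sum>f\<in>F. a e f * y f)"
  using assms
proof (induction F arbitrary: E a x rule: finite_induct)
  case empty
  have "x e = 0" if "e \<in> E" for e
  proof -
    have "(\<Sum>i\<in>E. (if i = e then 1 else 0) * x i) = 0" by (rule empty.prems(2)) simp
    then show ?thesis using empty.prems(1) that by (simp add: if_distrib[of "\<lambda>c. c * _"] cong: if_cong)
  qed
  then show ?case by simp
next
  case (insert f F)
  show ?case
  proof (cases "\<forall>e\<in>E. a e f = 0")
    case True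
    have "\<exists>y. \<forall>e\<in>E. x e = (\<Sum>f\<in>F. a e f * y f)"
      by (rule insert.IH[OF insert.prems(1) insert.prems(2)]) (use True in auto)
    then show ?thesis using True insert.hyps by auto
  next
    case False
    then obtain j where j: "j \<in> E" "a j f \<noteq> 0" by blast
    let ?J = "E - {j}"
    define q where "q e = a e f / a j f" for e
    define b where "b e g = a e g - q e * a j g" for e g
    have split: "(\<Sum>i\<in>E. h i) = h j + (\<Sum>i\<in>?J. h i)" for h :: "'e \<Rightarrow> real"
      using insert.prems(1) j(1) by (rule sum.remove)
    have "\<exists>y. \<forall>e\<in>?J. x e - q e * x j = (\<Sum>f\<in>F. b e f * y f)"
    proof (rule insert.IH[OF finite_Diff[OF insert.prems(1)]])
      fix c :: "'e \<Rightarrow> real" assume c: "\<And>g. g \<in> F \<Longrightarrow> (\<Sum>e\<in>?J. c e * b e g) = 0"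
      \<comment> \<open>the coefficient at the pivot row is chosen so that column \<open>f\<close> is annihilated too\<close>
      define c' where "c' e = (if e = j then - (\<Sum>e\<in>?J. c e * q e) else c e)" for e
      have c': "(\<Sum>e\<in>E. c' e * h e) = (\<Sum>e\<in>?J. c e * (h e - q e * h j))" for h
      proof -
        have "(\<Sum>e\<in>?J. c' e * h e) = (\<Sum>e\<in>?J. c e * h e)"
          by (rule sum.cong) (auto simp: c'_def)
        then show ?thesis
          by (simp add: split c'_def sum_distrib_left sum_distrib_right sum_subtractf algebra_simps)
      qed
      have "(\<Sum>e\<in>E. c' e * x e) = 0"
      proof (rule insert.prems(2))
        fix g assume "g \<in> insert f F"
        moreover have "(\<Sum>e\<in>?J. c e * (a e f - q e * a j f)) = 0"
          using j by (intro sum.neutral) (simp add: q_def)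
        ultimately show "(\<Sum>e\<in>E. c' e * a e g) = 0"
          unfolding c' using c by (auto simp: b_def)
      qed
      then show "(\<Sum>e\<in>?J. c e * (x e - q e * x j)) = 0" unfolding c' .
    qed
    then obtain y where y: "\<And>e. e \<in> ?J \<Longrightarrow> x e - q e * x j = (\<Sum>f\<in>F. b e f * y f)" by blast
    define s where "s = (x j - (\<Sum>g\<in>F. a j g * y g)) / a j f"
    define y' where "y' g = (if g = f then s else y g)" for g
    have y': "(\<Sum>g\<in>insert f F. a e g * y' g) = a e f * s + (\<Sum>g\<in>F. a e g * y g)" for e
    proof -
      have "(\<Sum>g\<in>F. a e g * y' g) = (\<Sum>g\<in>F. a e g * y g)"
        using insert.hyps by (intro sum.cong) (auto simp: y'_def)
      then show ?thesis using insert.hyps by (simp add: y'_def)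
    qed
    have "x e = a e f * s + (\<Sum>g\<in>F. a e g * y g)" if "e \<in> E" for e
    proof (cases "e = j")
      case True
      then show ?thesis using j by (simp add: s_def)
    next
      case False
      then have "x e = q e * x j + (\<Sum>g\<in>F. b e g * y g)" using y[of e] that by simp
      also have "(\<Sum>g\<in>F. b e g * y g) = (\<Sum>g\<in>F. a e g * y g) - q e * (\<Sum>g\<in>F. a j g * y g)"
        by (simp add: b_def sum_distrib_left sum_subtractf algebra_simps)
      also have "q e * x j = q e * (a j f * s + (\<Sum>g\<in>F. a j g * y g))"
        using j by (simp add: s_def)
      finally show ?thesis using j by (simp add: q_def algebra_simps)
    qed
    then show ?thesis using y' by (intro exI[of _ y']) simp
  qed
qed

section \<open>Counting cosets\<close>

definition lattice_coset :: "('f \<Rightarrow> int) set \<Rightarrow> ('f \<Rightarrow> int) \<Rightarrow> ('f \<Rightarrow> int) set" where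
  "lattice_coset L z = {\<lambda>f. l f + z f |l. l \<in> L}"

definition int_lattice :: "('f \<Rightarrow> int) set \<Rightarrow> bool" where
  "int_lattice L \<longleftrightarrow> (\<lambda>_. 0) \<in> L \<and> (\<forall>k. \<forall>x\<in>L. \<forall>y\<in>L. (\<lambda>f. x f + k * y f) \<in> L)"

lemma int_lattice_zero: "int_lattice L \<Longrightarrow> (\<lambda>_. 0) \<in> L"
  and int_lattice_lin: "int_lattice L \<Longrightarrow> x \<in> L \<Longrightarrow> y \<in> L \<Longrightarrow> (\<lambda>f. x f + k * y f) \<in> L"
  by (auto simp: int_lattice_def)

lemma int_lattice_add: "int_lattice L \<Longrightarrow> x \<in> L \<Longrightarrow> y \<in> L \<Longrightarrow> (\<lambda>f. x f + y f) \<in> L"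
  using int_lattice_lin[of L x y 1] by simp

lemma int_lattice_scale: "int_lattice L \<Longrightarrow> x \<in> L \<Longrightarrow> (\<lambda>f. k * x f) \<in> L"
  using int_lattice_lin[of L "\<lambda>_. 0" x k] int_lattice_zero[of L] by simp

lemma int_lattice_uminus: "int_lattice L \<Longrightarrow> x \<in> L \<Longrightarrow> (\<lambda>f. - x f) \<in> L"
  using int_lattice_scale[of L x "-1"] by simp

lemma lattice_coset_eq_iff:
  assumes "int_lattice L"
  shows "lattice_coset L z = lattice_coset L w \<longleftrightarrow> (\<lambda>f. z f - w f) \<in> L"
proof
  assume "lattice_coset L z = lattice_coset L w"
  moreover have "z \<in> lattice_coset L z"
    using int_lattice_zero[OF assms] by (force simp: lattice_coset_def)
  ultimately obtain l where "l \<in> L" "z = (\<lambda>f. l f + w f)"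
    by (auto simp: lattice_coset_def)
  then show "(\<lambda>f. z f - w f) \<in> L" by simp
next
  have sub: "lattice_coset L z \<subseteq> lattice_coset L w" if "(\<lambda>f. z f - w f) \<in> L" for z w
  proof
    fix u assume "u \<in> lattice_coset L z"
    then obtain l where l: "l \<in> L" "u = (\<lambda>f. l f + z f)" by (auto simp: lattice_coset_def)
    then have "u = (\<lambda>f. (l f + (z f - w f)) + w f)" by simp
    then show "u \<in> lattice_coset L w"
      using int_lattice_add[OF assms l(1) that] unfolding lattice_coset_def mem_Collect_eq
      by (intro exI[of _ "\<lambda>f. l f + (z f - w f)"] conjI)
  qed
  assume "(\<lambda>f. z f - w f) \<in> L"
  moreover from int_lattice_uminus[OF assms this] have "(\<lambda>f. w f - z f) \<in> L" by simp
  ultimately show "lattice_coset L z = lattice_coset L w"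
    by (intro equalityI sub)
qed

text \<open>Adjoining to \<open>L\<close> an element of order \<open>t\<close> modulo \<open>L\<close> divides the number of cosets by \<open>t\<close>: each coset of
the larger lattice splits into the \<open>t\<close> translates by multiples of \<open>\<beta>\<close>. The statement also holds when
there are infinitely many cosets, both cardinalities then being 0.\<close>

lemma card_lattice_cosets_extend:
  fixes t :: int
  assumes L: "int_lattice L" and L': "int_lattice L'"
    and L'_eq: "L' = {\<lambda>f. l f + k * \<beta> f |l k. l \<in> L}"
    and order: "\<And>k. (\<lambda>f. k * \<beta> f) \<in> L \<longleftrightarrow> t dvd k" and "t > 0"
    and M: "\<And>z l. z \<in> M \<Longrightarrow> l \<in> L' \<Longrightarrow> (\<lambda>f. z f + l f) \<in> M"
  shows "card (lattice_coset L ` M) = nat t * card (lattice_coset L' ` M)"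
proof -
  have LL': "L \<subseteq> L'" unfolding L'_eq by (auto intro!: exI[of _ 0])
  have beta: "(\<lambda>f. k * \<beta> f) \<in> L'" for k
    unfolding L'_eq using int_lattice_zero[OF L] by force
  define rep where "rep C = (SOME z. z \<in> M \<and> lattice_coset L' z = C)" for C
  have rep: "rep C \<in> M" "lattice_coset L' (rep C) = C" if "C \<in> lattice_coset L' ` M" for C
    using someI_ex[of "\<lambda>z. z \<in> M \<and> lattice_coset L' z = C"] that unfolding rep_def by blast+
  let ?h = "\<lambda>(C, i). lattice_coset L (\<lambda>f. rep C f + i * \<beta> f)"
  have "bij_betw ?h (lattice_coset L' ` M \<times> {0..<t}) (lattice_coset L ` M)"
  proof (rule bij_betw_imageI)
    show "inj_on ?h (lattice_coset L' ` M \<times> {0..<t})"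
    proof (rule inj_onI, clarify)
      fix z i z' i'
      assume z: "z \<in> M" "z' \<in> M" and i: "i \<in> {0..<t}" "i' \<in> {0..<t}"
        and eq: "lattice_coset L (\<lambda>f. rep (lattice_coset L' z) f + i * \<beta> f)
            = lattice_coset L (\<lambda>f. rep (lattice_coset L' z') f + i' * \<beta> f)"
      define C C' where "C = lattice_coset L' z" and "C' = lattice_coset L' z'"
      have "(\<lambda>f. (rep C f + i * \<beta> f) - (rep C' f + i' * \<beta> f)) \<in> L"
        using eq unfolding C_def C'_def lattice_coset_eq_iff[OF L] .
      then have diff: "(\<lambda>f. (rep C f - rep C' f) + (i - i') * \<beta> f) \<in> L"
        by (simp add: algebra_simps)
      from int_lattice_lin[OF L' subsetD[OF LL' this] beta[of "i - i'"], of "-1"]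
      have "(\<lambda>f. rep C f - rep C' f) \<in> L'" by simp
      then have "lattice_coset L' (rep C) = lattice_coset L' (rep C')"
        unfolding lattice_coset_eq_iff[OF L'] .
      then have CC': "C = C'" using rep z unfolding C_def C'_def by auto
      then have "t dvd i - i'" using diff order by simp
      then have "i = i'" using i by (simp flip: mod_eq_dvd_iff)
      with CC' show "lattice_coset L' z = lattice_coset L' z' \<and> i = i'" by (simp add: C_def C'_def)
    qed
    show "?h ` (lattice_coset L' ` M \<times> {0..<t}) = lattice_coset L ` M"
    proof (intro equalityI subsetI)
      fix X assume "X \<in> ?h ` (lattice_coset L' ` M \<times> {0..<t})"
      then obtain C i where "C \<in> lattice_coset L' ` M" "X = lattice_coset L (\<lambda>f. rep C f + i * \<beta> f)" by auto
      then show "X \<in> lattice_coset L ` M" using M[OF rep(1) beta] by blast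
    next
      fix X assume "X \<in> lattice_coset L ` M"
      then obtain z where z: "z \<in> M" "X = lattice_coset L z" by blast
      define C where "C = lattice_coset L' z"
      have C: "C \<in> lattice_coset L' ` M" using z by (simp add: C_def)
      have "(\<lambda>f. rep C f - z f) \<in> L'"
        using rep(2)[OF C] unfolding C_def lattice_coset_eq_iff[OF L', symmetric] .
      then obtain l k where lk: "l \<in> L" "(\<lambda>f. rep C f - z f) = (\<lambda>f. l f + k * \<beta> f)"
        unfolding L'_eq by blast
      define i where "i = (- k) mod t"
      have "t dvd i + k" unfolding i_def by (simp add: mod_0_imp_dvd mod_add_left_eq)
      then have "(\<lambda>f. (i + k) * \<beta> f) \<in> L" using order by simp
      from int_lattice_add[OF L lk(1) this]
      have "(\<lambda>f. (l f + k * \<beta> f) + i * \<beta> f) \<in> L" by (simp add: algebra_simps)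
      moreover have "(\<lambda>f. (l f + k * \<beta> f) + i * \<beta> f) = (\<lambda>f. (rep C f + i * \<beta> f) - z f)"
      proof
        fix f show "(l f + k * \<beta> f) + i * \<beta> f = (rep C f + i * \<beta> f) - z f"
          using fun_cong[OF lk(2), of f] by simp
      qed
      ultimately have "X = lattice_coset L (\<lambda>f. rep C f + i * \<beta> f)"
        unfolding z(2) using lattice_coset_eq_iff[OF L] by metis
      moreover have "i \<in> {0..<t}" using \<open>t > 0\<close> by (simp add: i_def)
      ultimately show "X \<in> ?h ` (lattice_coset L' ` M \<times> {0..<t})" using C by force
    qed
  qed
  then have "card (lattice_coset L ` M) = card (lattice_coset L' ` M \<times> {0..<t})"
    by (simp add: bij_betw_same_card)
  then show ?thesis by (simp add: card_cartesian_product)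
qed

section \<open>Weighted spanning trees of an integer matrix\<close>

text \<open>The top end of a chain complex: \<open>E\<close> indexes the top cells, \<open>F\<close> the cells one dimension below, \<open>D e f\<close> is
the coefficient of \<open>f\<close> in the boundary of \<open>e\<close>, and \<open>Z\<close> is the group of cycles on \<open>F\<close>. The last assumption
says that the square of the boundary is zero. Chains are functions with support in a set of cells.\<close>

locale cell_matrix =
  fixes E :: "'e set" and F :: "'f set" and D :: "'e \<Rightarrow> 'f \<Rightarrow> int" and Z :: "('f \<Rightarrow> int) set"
  assumes finite_E: "finite E" and finite_F: "finite F"
    and lattice_Z: "int_lattice Z"
    and support_Z: "z \<in> Z \<Longrightarrow> f \<notin> F \<Longrightarrow> z f = 0"
    and boundary_in_Z: "(\<lambda>f. if f \<in> F then \<Sum>e\<in>E. c e * D e f else 0) \<in> Z"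
begin

definition bdry :: "('e \<Rightarrow> 'a::comm_ring_1) \<Rightarrow> 'f \<Rightarrow> 'a" where
  "bdry c = (\<lambda>f. if f \<in> F then \<Sum>e\<in>E. c e * of_int (D e f) else 0)"

definition cycles_in :: "'e set \<Rightarrow> ('e \<Rightarrow> 'a::comm_ring_1) set" where
  "cycles_in S = {c. (\<forall>e. e \<notin> S \<longrightarrow> c e = 0) \<and> bdry c = (\<lambda>_. 0)}"

definition boundaries_in :: "'e set \<Rightarrow> ('f \<Rightarrow> int) set" where
  "boundaries_in S = bdry ` {c. \<forall>e. e \<notin> S \<longrightarrow> c e = 0}"

text \<open>The top cells of spanning trees, described as maximal sets that support no nonzero cycle.\<close>

definition max_forest :: "'e set \<Rightarrow> bool" where
  "max_forest S \<longleftrightarrow> S \<subseteq> E \<and> (cycles_in S :: ('e \<Rightarrow> int) set) = {\<lambda>_. 0} \<and>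
     (\<forall>b\<in>E - S. (cycles_in (insert b S) :: ('e \<Rightarrow> int) set) \<noteq> {\<lambda>_. 0})"

text \<open>The cycles that represent torsion classes modulo the boundaries of chains on \<open>S\<close>.\<close>

definition torsion :: "'e set \<Rightarrow> ('f \<Rightarrow> int) set" where
  "torsion S = {z \<in> Z. \<exists>k::int. k > 0 \<and> (\<lambda>f. k * z f) \<in> boundaries_in S}"

definition theta :: "'e set \<Rightarrow> nat" where
  "theta S = card (lattice_coset (boundaries_in S) ` torsion S)"

text \<open>The circuit is chosen as a function of the set \<open>U\<close> alone. Two trees \<open>T\<close> and \<open>T'\<close> that differ by an exchange
of \<open>b\<close> and \<open>b'\<close> therefore share the same circuit on their common extension, not merely up to sign.\<close>

definition is_circuit :: "'e set \<Rightarrow> ('e \<Rightarrow> int) \<Rightarrow> bool" where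
  "is_circuit U c \<longleftrightarrow> c \<in> cycles_in U \<and> cycles_in U = {\<lambda>e. k * c e |k. True}"

definition circuit :: "'e set \<Rightarrow> 'e \<Rightarrow> int" where
  "circuit U = (SOME c. is_circuit U c)"

definition fundamental_cycle :: "'e set \<Rightarrow> 'e \<Rightarrow> 'e \<Rightarrow> real" where
  "fundamental_cycle T b = (if b \<in> T then (\<lambda>_. 0)
     else (\<lambda>e. real_of_int (circuit (insert b T) e) / real_of_int (circuit (insert b T) b)))"

lemma bd_lin: "bdry (\<lambda>e. a * x e + b * y e) = (\<lambda>f. a * bdry x f + b * bdry y f)"
  by (auto simp: bdry_def sum_distrib_left sum.distrib algebra_simps)

lemma bd_zero [simp]: "bdry (\<lambda>_. 0) = (\<lambda>_. 0)"
  by (auto simp: bdry_def)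

lemma bd_of_int: "bdry (\<lambda>e. of_int (c e)) = (\<lambda>f. of_int (bdry c f))"
  by (auto simp: bdry_def)

lemma cyc_lin: "x \<in> cycles_in S \<Longrightarrow> y \<in> cycles_in S \<Longrightarrow> (\<lambda>e. a * x e + b * y e) \<in> cycles_in S"
  by (auto simp: cycles_in_def bd_lin)

lemma cyc_zero: "(\<lambda>_. 0) \<in> cycles_in S"
  by (auto simp: cycles_in_def)

lemma cyc_scale: "x \<in> cycles_in S \<Longrightarrow> (\<lambda>e. a * x e) \<in> cycles_in S"
  using cyc_lin[of x S x a 0] by simp

lemma cyc_sum: "(\<And>i. i \<in> I \<Longrightarrow> x i \<in> cycles_in S) \<Longrightarrow> (\<lambda>e. \<Sum>i\<in>I. a i * x i e) \<in> cycles_in S"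
proof (induction I rule: infinite_finite_induct)
  case (insert j I)
  then show ?case using cyc_lin[of "x j" S "\<lambda>e. \<Sum>i\<in>I. a i * x i e" "a j" 1] by simp
qed (auto simp: cyc_zero)

lemma cyc_mono: "S \<subseteq> U \<Longrightarrow> cycles_in S \<subseteq> cycles_in U"
  by (auto simp: cycles_in_def)

lemma cyc_support: "c \<in> cycles_in S \<Longrightarrow> e \<notin> S \<Longrightarrow> c e = 0"
  by (auto simp: cycles_in_def)

lemma cyc_shrink: "c \<in> cycles_in S \<Longrightarrow> (\<And>e. e \<in> S - U \<Longrightarrow> c e = 0) \<Longrightarrow> c \<in> cycles_in U"
  by (auto simp: cycles_in_def)

lemma cyc_of_int: "c \<in> cycles_in S \<Longrightarrow> (\<lambda>e. of_int (c e)) \<in> cycles_in S"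
  by (auto simp: cycles_in_def bd_of_int)

lemma int_lattice_bnd: "int_lattice (boundaries_in S)"
  unfolding int_lattice_def
proof (intro conjI allI ballI)
  show "(\<lambda>_. 0) \<in> boundaries_in S" unfolding boundaries_in_def by (rule image_eqI[of _ _ "\<lambda>_. 0"]) auto
  fix k x y assume "x \<in> boundaries_in S" "y \<in> boundaries_in S"
  then obtain c c' where c: "\<forall>e. e \<notin> S \<longrightarrow> c e = 0" "\<forall>e. e \<notin> S \<longrightarrow> c' e = 0" "x = bdry c" "y = bdry c'"
    by (auto simp: boundaries_in_def)
  then have "(\<lambda>f. x f + k * y f) = bdry (\<lambda>e. 1 * c e + k * c' e)"
    by (simp only: bd_lin) simp
  then show "(\<lambda>f. x f + k * y f) \<in> boundaries_in S"
    using c unfolding boundaries_in_def by (intro image_eqI[of _ _ "\<lambda>e. 1 * c e + k * c' e"]) auto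
qed

lemma bnd_subset_Z: "boundaries_in S \<subseteq> Z"
proof
  fix x assume "x \<in> boundaries_in S"
  then obtain c :: "'e \<Rightarrow> int" where "x = bdry c" by (auto simp: boundaries_in_def)
  then have "x = (\<lambda>f. if f \<in> F then \<Sum>e\<in>E. c e * D e f else 0)"
    unfolding bdry_def of_int_eq_id id_apply .
  then show "x \<in> Z" using boundary_in_Z by simp
qed

lemma bnd_mono: "S \<subseteq> U \<Longrightarrow> boundaries_in S \<subseteq> boundaries_in U"
  by (auto simp: boundaries_in_def)

definition cell_boundary :: "'e \<Rightarrow> 'f \<Rightarrow> int" where
  "cell_boundary b = bdry (\<lambda>e. if e = b then 1 else 0)"

lemma bnd_insert:
  assumes "b \<notin> S"
  shows "boundaries_in (insert b S) = {\<lambda>f. l f + k * cell_boundary b f |l k. l \<in> boundaries_in S}"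
proof (intro equalityI subsetI)
  fix x assume "x \<in> boundaries_in (insert b S)"
  then obtain c where c: "\<forall>e. e \<notin> insert b S \<longrightarrow> c e = 0" "x = bdry c" by (auto simp: boundaries_in_def)
  let ?c = "\<lambda>e. c e - c b * (if e = b then 1 else 0)"
  have "c = (\<lambda>e. 1 * ?c e + c b * (if e = b then 1 else 0))" by auto
  then have "x = (\<lambda>f. 1 * bdry ?c f + c b * cell_boundary b f)"
    unfolding cell_boundary_def c(2) by (subst bd_lin[symmetric]) simp
  moreover have "bdry ?c \<in> boundaries_in S" unfolding boundaries_in_def using c(1) by (intro imageI) auto
  ultimately show "x \<in> {\<lambda>f. l f + k * cell_boundary b f |l k. l \<in> boundaries_in S}" by auto
next
  fix x assume "x \<in> {\<lambda>f. l f + k * cell_boundary b f |l k. l \<in> boundaries_in S}"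
  then obtain c k where c: "\<forall>e. e \<notin> S \<longrightarrow> c e = 0" "x = (\<lambda>f. bdry c f + k * cell_boundary b f)" by (auto simp: boundaries_in_def)
  then have "x = bdry (\<lambda>e. 1 * c e + k * (if e = b then 1 else 0))"
    unfolding cell_boundary_def by (subst bd_lin) simp
  then show "x \<in> boundaries_in (insert b S)"
    unfolding boundaries_in_def using c(1) by (intro image_eqI) auto
qed

text \<open>The order of the boundary of \<open>b\<close> modulo the boundaries of \<open>S\<close> is thus read off from the circuit through \<open>b\<close>.\<close>

lemma scaled_boundary_iff:
  assumes "b \<notin> S"
  shows "(\<lambda>f. k * cell_boundary b f) \<in> boundaries_in S \<longleftrightarrow> (\<exists>c\<in>cycles_in (insert b S). c b = k)"
proof
  assume "(\<lambda>f. k * cell_boundary b f) \<in> boundaries_in S"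
  then obtain x where x: "\<forall>e. e \<notin> S \<longrightarrow> x e = 0" "bdry x = (\<lambda>f. k * cell_boundary b f)" by (auto simp: boundaries_in_def)
  let ?c = "\<lambda>e. k * (if e = b then 1 else 0) + (- 1) * x e"
  have "bdry ?c = (\<lambda>_. 0)" unfolding bd_lin x(2) cell_boundary_def by simp
  then have "?c \<in> cycles_in (insert b S)" using x(1) by (auto simp: cycles_in_def)
  moreover have "?c b = k" using x(1) assms by simp
  ultimately show "\<exists>c\<in>cycles_in (insert b S). c b = k" by (intro bexI[of _ ?c])
next
  assume "\<exists>c\<in>cycles_in (insert b S). c b = k"
  then obtain c where c: "c \<in> cycles_in (insert b S)" "c b = k" by blast
  let ?x = "\<lambda>e. k * (if e = b then 1 else 0) + (- 1) * c e"
  have "bdry ?x = (\<lambda>f. k * cell_boundary b f)"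
    unfolding bd_lin cell_boundary_def using c by (simp add: cycles_in_def)
  moreover have "\<forall>e. e \<notin> S \<longrightarrow> ?x e = 0" using c by (auto simp: cycles_in_def)
  ultimately show "(\<lambda>f. k * cell_boundary b f) \<in> boundaries_in S"
    unfolding boundaries_in_def by (intro image_eqI[of _ _ ?x]) auto
qed

lemma real_cyc_trivial:
  assumes "S \<subseteq> E" "(cycles_in S :: ('e \<Rightarrow> int) set) = {\<lambda>_. 0}" "x \<in> cycles_in S"
  shows "x = (\<lambda>_. 0::real)"
proof (rule ccontr)
  have sum_S: "(\<Sum>e\<in>E. c e * of_int (D e f)) = (\<Sum>e\<in>S. c e * of_int (D e f))"
    if "\<forall>e. e \<notin> S \<longrightarrow> c e = 0" for c :: "'e \<Rightarrow> 'a::comm_ring_1" and f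
    using assms(1) that finite_E by (intro sum.mono_neutral_right) auto
  assume "x \<noteq> (\<lambda>_. 0)"
  then obtain e where "x e \<noteq> 0" by (auto simp: fun_eq_iff)
  then have "\<exists>i\<in>S. x i \<noteq> 0" using assms(3) by (auto simp: cycles_in_def)
  moreover have "(\<Sum>i\<in>S. x i * of_int (D i f)) = 0" if "f \<in> F" for f
  proof -
    have "bdry x f = 0" "\<forall>e. e \<notin> S \<longrightarrow> x e = 0" using assms(3) by (auto simp: cycles_in_def)
    then show ?thesis using that sum_S[of x f] by (simp add: bdry_def)
  qed
  ultimately have "\<exists>x::'e \<Rightarrow> real. (\<exists>i\<in>S. x i \<noteq> 0) \<and> (\<forall>f\<in>F. (\<Sum>i\<in>S. x i * of_int (D i f)) = 0)"
    by (intro exI[of _ x] conjI ballI)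
  from integer_relation[OF finite_F finite_subset[OF assms(1) finite_E] disjI2[OF this]]
  obtain n :: "'e \<Rightarrow> int" where n: "\<exists>i\<in>S. n i \<noteq> 0" "\<forall>f\<in>F. (\<Sum>i\<in>S. n i * D i f) = 0"
    by (elim exE conjE)
  define m where "m i = (if i \<in> S then n i else 0)" for i
  have "(\<Sum>i\<in>E. m i * D i f) = (\<Sum>i\<in>S. n i * D i f)" for f
    using sum_S[of m f] by (simp add: m_def)
  then have "m \<in> cycles_in S" using n(2) by (auto simp: cycles_in_def bdry_def m_def)
  then have "m = (\<lambda>_. 0)" using assms(2) by auto
  moreover obtain i where "i \<in> S" "n i \<noteq> 0" using n(1) by blast
  then have "m i \<noteq> 0" by (simp add: m_def)
  ultimately show False by simp
qed

lemma circuit_exists: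
  assumes "b \<notin> S" "(cycles_in S :: ('e \<Rightarrow> int) set) = {\<lambda>_. 0}" "(cycles_in (insert b S) :: ('e \<Rightarrow> int) set) \<noteq> {\<lambda>_. 0}"
  shows "\<exists>c. is_circuit (insert b S) c"
    and "is_circuit (insert b S) c \<Longrightarrow> c b \<noteq> 0"
proof -
  let ?U = "insert b S"
  have zero: "x = (\<lambda>_. 0)" if "x \<in> cycles_in ?U" "x b = 0" for x :: "'e \<Rightarrow> int"
    using cyc_shrink[OF that(1), of S] that(2) assms by auto
  obtain x :: "'e \<Rightarrow> int" where x: "x \<in> cycles_in ?U" "x b \<noteq> 0"
    using assms(3) zero cyc_zero by blast
  define P where "P n \<longleftrightarrow> n > 0 \<and> (\<exists>c\<in>cycles_in ?U. c b = int n)" for n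
  have "P (nat \<bar>x b\<bar>)"
  proof -
    have "\<exists>c\<in>cycles_in ?U. c b = \<bar>x b\<bar>"
      using x cyc_scale[OF x(1), of "sgn (x b)"] by (intro bexI[of _ "\<lambda>e. sgn (x b) * x e"]) (auto simp: abs_sgn mult.commute)
    then show ?thesis using x by (simp add: P_def)
  qed
  then have "P (LEAST n. P n)" by (rule LeastI)
  then obtain c where c: "c \<in> cycles_in ?U" "c b = int (LEAST n. P n)" "c b > 0" by (auto simp: P_def)
  have "y \<in> {\<lambda>e. k * c e |k. True}" if y: "y \<in> cycles_in ?U" for y :: "'e \<Rightarrow> int"
  proof -
    let ?r = "\<lambda>e. 1 * y e + (- (y b div c b)) * c e"
    have r: "?r \<in> cycles_in ?U" using y c(1) by (rule cyc_lin)
    have rb: "?r b = y b mod c b" by (simp add: minus_div_mult_eq_mod)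
    have "?r b = 0"
    proof (rule ccontr)
      assume "?r b \<noteq> 0"
      then have "?r b > 0" using rb c(3) pos_mod_sign[of "c b" "y b"] by linarith
      then have "P (nat (?r b))" unfolding P_def using r by (intro conjI bexI[of _ ?r]) auto
      then have "(LEAST n. P n) \<le> nat (?r b)" by (rule Least_le)
      moreover have "?r b < c b" using rb c(3) by simp
      ultimately show False using c(2) \<open>?r b > 0\<close> by linarith
    qed
    then have "?r = (\<lambda>_. 0)" using zero[OF r] by blast
    then have "y e = (y b div c b) * c e" for e using fun_cong[of ?r "\<lambda>_. 0" e] by simp
    then have "y = (\<lambda>e. (y b div c b) * c e)" by (rule ext)
    then show ?thesis by blast
  qed
  then show "\<exists>c. is_circuit ?U c"
    unfolding is_circuit_def using c(1) cyc_scale[OF c(1)] by (intro exI[of _ c]) auto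
  show "c b \<noteq> 0" if circ: "is_circuit ?U c" for c
  proof -
    obtain k where "x = (\<lambda>e. k * c e)" using circ x(1) unfolding is_circuit_def by blast
    then show ?thesis using x(2) by auto
  qed
qed

lemma max_forest_circuit:
  assumes "max_forest T" "b \<in> E" "b \<notin> T"
  shows is_circuit_circuit: "is_circuit (insert b T) (circuit (insert b T))"
    and circuit_nonzero: "circuit (insert b T) b \<noteq> 0"
proof -
  have T: "(cycles_in T :: ('e \<Rightarrow> int) set) = {\<lambda>_. 0}" "(cycles_in (insert b T) :: ('e \<Rightarrow> int) set) \<noteq> {\<lambda>_. 0}"
    using assms by (auto simp: max_forest_def)
  show *: "is_circuit (insert b T) (circuit (insert b T))"
    unfolding circuit_def by (rule someI_ex[OF circuit_exists(1)[OF assms(3) T]])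
  show "circuit (insert b T) b \<noteq> 0"
    using circuit_exists(2)[OF assms(3) T *] .
qed

lemma fundamental_cycle_cycle:
  assumes "max_forest T" "b \<in> E"
  shows "fundamental_cycle T b \<in> cycles_in E"
proof (cases "b \<in> T")
  case False
  have "circuit (insert b T) \<in> cycles_in E"
    using is_circuit_circuit[OF assms False] cyc_mono[of "insert b T" E] assms
    by (auto simp: is_circuit_def max_forest_def)
  from cyc_scale[OF cyc_of_int[OF this], of "1 / real_of_int (circuit (insert b T) b)"]
  show ?thesis using False by (simp add: fundamental_cycle_def)
qed (simp add: fundamental_cycle_def cyc_zero)

lemma fundamental_cycle_outside:
  assumes "max_forest T" "b \<in> E" "e \<notin> T"
  shows "fundamental_cycle T b e = (if e = b then 1 else 0)"
proof (cases "b \<in> T")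
  case True
  then show ?thesis using assms by (auto simp: fundamental_cycle_def)
next
  case False
  have "circuit (insert b T) \<in> cycles_in (insert b T)"
    using is_circuit_circuit[OF assms(1,2) False] unfolding is_circuit_def by (rule conjunct1)
  then show ?thesis
    using circuit_nonzero[OF assms(1,2) False] cyc_support[of "circuit (insert b T)" "insert b T" e] assms(3) False
    by (auto simp: fundamental_cycle_def)
qed

text \<open>The difference of the two sides is a cycle on the tree \<open>T\<close>, since the fundamental cycle of \<open>b\<close>
has coefficient 1 at \<open>b\<close> and no other coefficient outside \<open>T\<close>.\<close>

lemma fundamental_cycle_retraction:
  assumes T: "max_forest T" and x: "x \<in> cycles_in E"
  shows "(\<Sum>b\<in>E. x b * fundamental_cycle T b e) = x e"
proof -
  let ?y = "\<lambda>e. \<Sum>b\<in>E. x b * fundamental_cycle T b e"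
  have y: "?y \<in> cycles_in E" by (intro cyc_sum fundamental_cycle_cycle T)
  have "(\<lambda>e. 1 * ?y e + (- 1) * x e) \<in> cycles_in T"
  proof (rule cyc_shrink[OF cyc_lin[OF y x]])
    fix e assume "e \<in> E - T"
    then show "1 * ?y e + (- 1) * x e = 0"
      using fundamental_cycle_outside[OF T] finite_E by (simp add: if_distrib[of "\<lambda>z. _ * z"] cong: if_cong)
  qed
  then have "(\<lambda>e. 1 * ?y e + (- 1) * x e) = (\<lambda>_. 0)"
    using T by (intro real_cyc_trivial[of T]) (auto simp: max_forest_def)
  from fun_cong[OF this, of e] show ?thesis by simp
qed

text \<open>Adding \<open>b\<close> to the tree kills in the torsion group the cyclic subgroup generated by the boundary of
\<open>b\<close>, whose order is the coefficient of the circuit at \<open>b\<close>.\<close>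

lemma theta_insert:
  assumes T: "max_forest T" and b: "b \<in> E" "b \<notin> T"
  shows "int (theta T) = \<bar>circuit (insert b T) b\<bar> * int (theta (insert b T))"
proof -
  define t where "t = \<bar>circuit (insert b T) b\<bar>"
  have t: "t > 0" using circuit_nonzero[OF T b] by (simp add: t_def)
  have order: "(\<lambda>f. k * cell_boundary b f) \<in> boundaries_in T \<longleftrightarrow> t dvd k" for k
  proof -
    have "(\<exists>c\<in>cycles_in (insert b T). c b = k) \<longleftrightarrow> circuit (insert b T) b dvd k"
      using is_circuit_circuit[OF T b] unfolding is_circuit_def by (auto simp: dvd_def mult.commute)
    then show ?thesis unfolding scaled_boundary_iff[OF b(2)] by (simp add: t_def)
  qed
  have tor: "torsion T = torsion (insert b T)"
  proof (intro equalityI subsetI)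
    fix z assume "z \<in> torsion T"
    then show "z \<in> torsion (insert b T)" using bnd_mono[of T "insert b T"] by (auto simp: torsion_def)
  next
    fix z assume "z \<in> torsion (insert b T)"
    then obtain k l j where z: "z \<in> Z" "k > 0" "l \<in> boundaries_in T" "(\<lambda>f. k * z f) = (\<lambda>f. l f + j * cell_boundary b f)"
      unfolding torsion_def bnd_insert[OF b(2)] by blast
    have "(\<lambda>f. (t * j) * cell_boundary b f) \<in> boundaries_in T" using order by simp
    then have "(\<lambda>f. t * l f + (t * j) * cell_boundary b f) \<in> boundaries_in T"
      using int_lattice_add[OF int_lattice_bnd int_lattice_scale[OF int_lattice_bnd z(3)]] by blast
    also have "(\<lambda>f. t * l f + (t * j) * cell_boundary b f) = (\<lambda>f. (t * k) * z f)"
    proof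
      fix f show "t * l f + (t * j) * cell_boundary b f = (t * k) * z f"
        using fun_cong[OF z(4), of f] by (simp add: mult.assoc flip: distrib_left)
    qed
    finally show "z \<in> torsion T" unfolding torsion_def using z(1,2) t by (auto intro!: exI[of _ "t * k"])
  qed
  have "theta T = nat t * theta (insert b T)"
    unfolding theta_def tor
  proof (rule card_lattice_cosets_extend[OF int_lattice_bnd int_lattice_bnd bnd_insert[OF b(2)] order t])
    fix z l assume z: "z \<in> torsion (insert b T)" and l: "l \<in> boundaries_in (insert b T)"
    then obtain k where k: "z \<in> Z" "k > 0" "(\<lambda>f. k * z f) \<in> boundaries_in (insert b T)" by (auto simp: torsion_def)
    have "(\<lambda>f. k * z f + k * l f) \<in> boundaries_in (insert b T)"
      using k(3) l by (intro int_lattice_lin int_lattice_bnd)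
    moreover have "(\<lambda>f. z f + l f) \<in> Z"
      using k(1) l bnd_subset_Z by (intro int_lattice_add lattice_Z) auto
    ultimately show "(\<lambda>f. z f + l f) \<in> torsion (insert b T)"
      unfolding torsion_def using k(2) by (auto simp: algebra_simps)
  qed
  then show ?thesis using t by (simp add: t_def)
qed

text \<open>Finiteness of the torsion group. If \<open>k z\<close> is the boundary of \<open>c\<close>, reducing the coefficients of
\<open>c\<close> modulo \<open>k\<close> changes \<open>z\<close> by a boundary and makes its coefficients bounded by a constant that depends
only on the matrix.\<close>

lemma theta_pos:
  assumes "S \<subseteq> E"
  shows "theta S > 0"
proof -
  define M where "M = (\<Sum>e\<in>E. \<Sum>f\<in>F. \<bar>D e f\<bar>)"
  define Y where "Y = {z::'f \<Rightarrow> int. \<forall>f. (f \<in> F \<longrightarrow> z f \<in> {-M..M}) \<and> (f \<notin> F \<longrightarrow> z f = 0)}"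
  have "finite Y" unfolding Y_def using finite_F by (intro finite_set_of_finite_funs) auto
  have "lattice_coset (boundaries_in S) ` torsion S \<subseteq> lattice_coset (boundaries_in S) ` Y"
  proof (rule image_subsetI)
    fix z assume "z \<in> torsion S"
    then obtain k c where z: "z \<in> Z" "k > 0" "\<forall>e. e \<notin> S \<longrightarrow> c e = 0" "(\<lambda>f. k * z f) = bdry c"
      unfolding torsion_def boundaries_in_def by auto
    define q where "q e = c e div k" for e
    define y where "y f = z f - bdry q f" for f
    have ky: "k * y f = bdry (\<lambda>e. c e mod k) f" for f
    proof -
      have "(\<lambda>e. c e mod k) = (\<lambda>e. 1 * c e + (- k) * q e)"
        by (simp add: q_def minus_mult_div_eq_mod mult.commute)
      then show ?thesis using fun_cong[OF z(4), of f] by (simp only: bd_lin) (simp add: y_def algebra_simps)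
    qed
    have "y f \<in> {-M..M}" if f: "f \<in> F" for f
    proof -
      have "k * \<bar>y f\<bar> = \<bar>\<Sum>e\<in>E. (c e mod k) * D e f\<bar>"
      proof -
        have "k * \<bar>y f\<bar> = \<bar>k * y f\<bar>" using z(2) by (simp add: abs_mult)
        then show ?thesis using ky[of f] f by (simp add: bdry_def)
      qed
      also have "\<dots> \<le> (\<Sum>e\<in>E. \<bar>(c e mod k) * D e f\<bar>)" by (rule sum_abs)
      also have "\<dots> \<le> (\<Sum>e\<in>E. k * \<bar>D e f\<bar>)"
      proof (rule sum_mono)
        fix e
        have "\<bar>c e mod k\<bar> \<le> k" using z(2) pos_mod_bound[of k "c e"] pos_mod_sign[of k "c e"] by linarith
        then show "\<bar>c e mod k * D e f\<bar> \<le> k * \<bar>D e f\<bar>" by (simp add: abs_mult mult_right_mono)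
      qed
      also have "\<dots> \<le> k * M"
        unfolding M_def sum_distrib_left[symmetric] using z(2) f finite_F
        by (intro mult_left_mono sum_mono member_le_sum) auto
      finally have "\<bar>y f\<bar> \<le> M" using z(2) by simp
      then show ?thesis by auto
    qed
    moreover have "y f = 0" if "f \<notin> F" for f
      using support_Z[OF z(1) that] that by (simp add: y_def bdry_def)
    ultimately have "y \<in> Y" by (simp add: Y_def)
    moreover have "lattice_coset (boundaries_in S) z = lattice_coset (boundaries_in S) y"
      unfolding lattice_coset_eq_iff[OF int_lattice_bnd] y_def
      using z(3) by (auto simp: boundaries_in_def q_def intro!: image_eqI[of _ _ q])
    ultimately show "lattice_coset (boundaries_in S) z \<in> lattice_coset (boundaries_in S) ` Y" by blast
  qed
  then have "finite (lattice_coset (boundaries_in S) ` torsion S)"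
    using \<open>finite Y\<close> finite_subset by blast
  moreover have "(\<lambda>_. 0) \<in> torsion S"
    using int_lattice_zero[OF lattice_Z] int_lattice_zero[OF int_lattice_bnd] by (auto simp: torsion_def intro!: exI[of _ 1])
  ultimately show ?thesis unfolding theta_def card_gt_0_iff by blast
qed

lemma max_forest_exists: "\<exists>T. max_forest T"
proof -
  define P where "P S \<longleftrightarrow> S \<subseteq> E \<and> (cycles_in S :: ('e \<Rightarrow> int) set) = {\<lambda>_. 0}" for S
  have "P {}" by (auto simp: P_def cycles_in_def)
  moreover have "\<forall>S. P S \<longrightarrow> card S < Suc (card E)"
    using finite_E by (auto simp: P_def card_mono less_Suc_eq_le)
  ultimately obtain T where T: "P T" "\<And>S. P S \<Longrightarrow> card S \<le> card T"
    using ex_has_greatest_nat[of P "{}" card "Suc (card E)"] by (metis less_imp_le)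
  have "\<not> P (insert b T)" if "b \<in> E - T" for b
    using T(2)[of "insert b T"] that T(1) finite_subset[OF _ finite_E, of T] by (auto simp: P_def)
  then have "max_forest T" using T(1) by (auto simp: max_forest_def P_def)
  then show ?thesis ..
qed

lemma finite_max_forests: "finite {T. max_forest T}"
  by (rule finite_subset[of _ "Pow E"]) (auto simp: max_forest_def finite_E)

text \<open>A cycle on the new set is a multiple of the circuit and vanishes at \<open>b'\<close>, so it is zero. For
maximality, the circuit through a further cell \<open>a\<close> is combined with the circuit through \<open>b\<close> so that
the coefficient at \<open>b'\<close> cancels.\<close>

lemma max_forest_exchange:
  assumes T: "max_forest T" and b: "b \<in> E" "b \<notin> T" and b': "b' \<in> T" "circuit (insert b T) b' \<noteq> 0"
  shows "max_forest (insert b T - {b'})"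
proof -
  let ?U = "insert b T" and ?T' = "insert b T - {b'}" and ?c = "circuit (insert b T)"
  have TE: "T \<subseteq> E" and T0: "(cycles_in T :: ('e \<Rightarrow> int) set) = {\<lambda>_. 0}" using T by (auto simp: max_forest_def)
  have circ: "is_circuit ?U ?c" by (rule is_circuit_circuit[OF T b])
  have c: "?c \<in> cycles_in ?U" using circ unfolding is_circuit_def by (rule conjunct1)
  have nontrivial: "(cycles_in U :: ('e \<Rightarrow> int) set) \<noteq> {\<lambda>_. 0}" if "x \<in> cycles_in U" "x e \<noteq> 0" for x :: "'e \<Rightarrow> int" and U e
  proof
    assume "cycles_in U = {\<lambda>_. 0::int}"
    with that(1) have "x = (\<lambda>_. 0)" by blast
    with that(2) show False by simp
  qed
  have "x = (\<lambda>_. 0)" if x: "x \<in> cycles_in ?T'" for x :: "'e \<Rightarrow> int"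
  proof -
    have "x \<in> cycles_in ?U" using x cyc_mono[of ?T' ?U] by auto
    then obtain k where k: "x = (\<lambda>e. k * ?c e)" using circ unfolding is_circuit_def by blast
    have "x b' = 0" using x by (simp add: cyc_support)
    then have "k = 0" using k b' by simp
    then show ?thesis using k by simp
  qed
  then have "(cycles_in ?T' :: ('e \<Rightarrow> int) set) = {\<lambda>_. 0}" using cyc_zero by blast
  moreover have "(cycles_in (insert a ?T') :: ('e \<Rightarrow> int) set) \<noteq> {\<lambda>_. 0}" if a: "a \<in> E - ?T'" for a
  proof (cases "a = b'")
    case True
    then have "insert a ?T' = ?U" using b' by auto
    then show ?thesis using nontrivial[OF c circuit_nonzero[OF T b]] by simp
  next
    case False
    then have a': "a \<in> E" "a \<notin> T" "a \<noteq> b" using a by auto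
    let ?u = "circuit (insert a T)"
    have u: "?u \<in> cycles_in (insert a T)" "?u a \<noteq> 0"
      using is_circuit_circuit[OF T a'(1,2)] circuit_nonzero[OF T a'(1,2)] by (auto simp: is_circuit_def)
    let ?x = "\<lambda>e. ?c b' * ?u e + (- ?u b') * ?c e"
    have "?x \<in> cycles_in (insert a ?T')"
    proof (rule cyc_shrink[OF cyc_lin[of _ "insert a ?U"]])
      show "?u \<in> cycles_in (insert a ?U)" using u(1) cyc_mono[of "insert a T" "insert a ?U"] by auto
      show "?c \<in> cycles_in (insert a ?U)" using c cyc_mono[of ?U "insert a ?U"] by auto
      show "?x e = 0" if "e \<in> insert a ?U - insert a ?T'" for e
      proof -
        have "e = b'" using that by auto
        then show ?thesis by simp
      qed
    qed
    moreover have "?x a \<noteq> 0"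
      using cyc_support[OF c, of a] a' u(2) b'(2) by simp
    ultimately show ?thesis by (rule nontrivial)
  qed
  moreover have "?T' \<subseteq> E" using TE b by blast
  ultimately show ?thesis unfolding max_forest_def by (intro conjI ballI)
qed

definition weight :: "('e \<Rightarrow> real) \<Rightarrow> 'e set \<Rightarrow> real" where
  "weight r T = (real (theta T))\<^sup>2 * (\<Prod>b\<in>T. inverse (r b))"

text \<open>This is where the torsion factors enter. With \<open>U\<close> the common extension of both trees and \<open>c\<close> its
circuit, the torsion numbers of \<open>T\<close> and \<open>T'\<close> are those of \<open>U\<close> times the absolute values of \<open>c b\<close> and
\<open>c b'\<close>, so their squares make both sides proportional to \<open>c b * c b'\<close>.\<close>

lemma exchange_weight:
  assumes T: "max_forest T" and b: "b \<in> E" "b \<notin> T" and b': "b' \<in> T" "circuit (insert b T) b' \<noteq> 0"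
    and r: "\<And>e. e \<in> E \<Longrightarrow> r e > 0"
  defines "T' \<equiv> insert b T - {b'}"
  shows "r b' * (weight r T * fundamental_cycle T b b') = r b * (weight r T' * fundamental_cycle T' b' b)"
proof -
  let ?c = "circuit (insert b T)"
  have T': "max_forest T'" unfolding T'_def by (rule max_forest_exchange[OF T b b'])
  have TE: "T \<subseteq> E" using T by (simp add: max_forest_def)
  have U: "insert b' T' = insert b T" and b'T': "b' \<notin> T'" "b' \<in> E" "b \<in> T'"
    using b b' TE by (auto simp: T'_def)
  have c: "?c b \<noteq> 0" by (rule circuit_nonzero[OF T b])
  define \<theta> where "\<theta> = real (theta (insert b T))"
  define \<pi> where "\<pi> = (\<Prod>e\<in>T - {b'}. inverse (r e))"
  have thT: "real (theta T) = \<bar>real_of_int (?c b)\<bar> * \<theta>"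
    using arg_cong[OF theta_insert[OF T b], of real_of_int] by (simp add: \<theta>_def)
  have thT': "real (theta T') = \<bar>real_of_int (?c b')\<bar> * \<theta>"
    using arg_cong[OF theta_insert[OF T' b'T'(2,1)], of real_of_int] by (simp add: \<theta>_def U)
  have fin: "finite T" using finite_subset[OF TE finite_E] .
  have piT: "(\<Prod>e\<in>T. inverse (r e)) = inverse (r b') * \<pi>"
    unfolding \<pi>_def using fin b'(1) by (rule prod.remove)
  have "T' - {b} = T - {b'}" using b by (auto simp: T'_def)
  then have piT': "(\<Prod>e\<in>T'. inverse (r e)) = inverse (r b) * \<pi>"
    unfolding \<pi>_def using prod.remove[of T' b "\<lambda>e. inverse (r e)"] fin b'T'(3) by (simp add: T'_def)
  have rpos: "r b > 0" "r b' > 0" using r b b'T' by auto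
  have "r b' * (weight r T * fundamental_cycle T b b') = (real_of_int (?c b))\<^sup>2 * \<theta>\<^sup>2 * \<pi> * (?c b' / ?c b)"
    using rpos b(2) unfolding weight_def thT piT fundamental_cycle_def by (simp add: power_mult_distrib field_simps)
  also have "\<dots> = (real_of_int (?c b'))\<^sup>2 * \<theta>\<^sup>2 * \<pi> * (?c b / ?c b')"
    using c b'(2) by (simp add: power2_eq_square)
  also have "\<dots> = r b * (weight r T' * fundamental_cycle T' b' b)"
    using rpos b'T'(1) unfolding weight_def thT' piT' fundamental_cycle_def U by (simp add: power_mult_distrib field_simps)
  finally show ?thesis .
qed

text \<open>Self-adjointness of the weighted average of the tree maps for the inner product with weights \<open>r\<close>: the
exchange of \<open>b\<close> and \<open>b'\<close> is a bijection between the trees that contribute to the two sides.\<close>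

lemma weighted_fundamental_cycle_symmetric:
  assumes r: "\<And>e. e \<in> E \<Longrightarrow> r e > 0" and b: "b \<in> E" and b': "b' \<in> E"
  shows "r b' * (\<Sum>T | max_forest T. weight r T * fundamental_cycle T b b')
    = r b * (\<Sum>T | max_forest T. weight r T * fundamental_cycle T b' b)"
proof (cases "b = b'")
  case False
  define Q where "Q x y = {T. max_forest T \<and> x \<notin> T \<and> y \<in> T \<and> circuit (insert x T) y \<noteq> 0}" for x y
  have restrict: "(\<Sum>T | max_forest T. weight r T * fundamental_cycle T x y) = (\<Sum>T\<in>Q x y. weight r T * fundamental_cycle T x y)"
    if x: "x \<in> E" and xy: "x \<noteq> y" for x y
  proof (rule sum.mono_neutral_right[OF finite_max_forests])
    show "Q x y \<subseteq> {T. max_forest T}" by (auto simp: Q_def)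
    have "fundamental_cycle T x y = 0" if T: "max_forest T" "T \<notin> Q x y" for T
    proof (cases "y \<in> T")
      case True
      then show ?thesis using T by (auto simp: Q_def fundamental_cycle_def)
    qed (use fundamental_cycle_outside[OF T(1) x] xy in auto)
    then show "\<forall>T\<in>{T. max_forest T} - Q x y. weight r T * fundamental_cycle T x y = 0" by auto
  qed
  have swap: "insert x T - {y} \<in> Q y x" "insert y (insert x T - {y}) - {x} = T"
    if T: "T \<in> Q x y" and x: "x \<in> E" for T x y
  proof -
    have T': "max_forest T" "x \<notin> T" "y \<in> T" "circuit (insert x T) y \<noteq> 0" using T by (auto simp: Q_def)
    have "insert y (insert x T - {y}) = insert x T" using T' by auto
    moreover have "circuit (insert x T) x \<noteq> 0" by (rule circuit_nonzero[OF T'(1) x T'(2)])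
    moreover have "max_forest (insert x T - {y})" by (rule max_forest_exchange[OF T'(1) x T'(2-4)])
    ultimately show "insert x T - {y} \<in> Q y x" "insert y (insert x T - {y}) - {x} = T"
      using T' by (auto simp: Q_def)
  qed
  have "(\<Sum>T\<in>Q b b'. r b' * (weight r T * fundamental_cycle T b b')) = (\<Sum>T\<in>Q b' b. r b * (weight r T * fundamental_cycle T b' b))"
  proof (rule sum.reindex_bij_witness[of _ "\<lambda>T. insert b' T - {b}" "\<lambda>T. insert b T - {b'}"])
    fix T assume T: "T \<in> Q b b'"
    show "insert b' (insert b T - {b'}) - {b} = T" "insert b T - {b'} \<in> Q b' b"
      using swap[OF T b] by auto
    show "r b * (weight r (insert b T - {b'}) * fundamental_cycle (insert b T - {b'}) b' b) = r b' * (weight r T * fundamental_cycle T b b')"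
      using T b r by (intro exchange_weight[symmetric]) (auto simp: Q_def)
  next
    fix T assume T: "T \<in> Q b' b"
    show "insert b (insert b' T - {b}) - {b'} = T" "insert b' T - {b} \<in> Q b b'"
      using swap[OF T b'] by auto
  qed
  then show ?thesis
    using restrict[OF b False] restrict[OF b' not_sym[OF False]] by (simp add: sum_distrib_left)
qed simp

lemma total_weight_pos:
  assumes "\<And>e. e \<in> E \<Longrightarrow> r e > 0"
  shows "(\<Sum>T | max_forest T. weight r T) > 0"
proof (rule sum_pos[OF finite_max_forests])
  show "{T. max_forest T} \<noteq> {}" using max_forest_exists by auto
  fix T assume "T \<in> {T. max_forest T}"
  then have "T \<subseteq> E" by (auto simp: max_forest_def)
  moreover have "(\<Prod>b\<in>T. inverse (r b)) > 0"
    using assms calculation by (intro prod_pos) (metis inverse_positive_iff_positive subsetD)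
  ultimately show "weight r T > 0" using theta_pos by (simp add: weight_def)
qed

text \<open>Being a retraction onto the cycles and self-adjoint for the weighted inner product, \<open>Q\<close> is the orthogonal
projection. Testing the equation against the cycle \<open>Q b\<close> gives the value of \<open>z\<close> at \<open>b\<close>, and
\<open>Q (V / r)\<close> is a solution.\<close>

theorem network_solution:
  assumes r: "\<And>e. e \<in> E \<Longrightarrow> r e > 0"
  defines "Q \<equiv> \<lambda>b e. (\<Sum>T | max_forest T. weight r T * fundamental_cycle T b e) / (\<Sum>T | max_forest T. weight r T)"
  shows network_unique: "\<lbrakk>z \<in> cycles_in E; \<And>c. c \<in> cycles_in E \<Longrightarrow> (\<Sum>e\<in>E. (V e - r e * z e) * c e) = 0; b \<in> E\<rbrakk>
      \<Longrightarrow> z b = (\<Sum>e\<in>E. V e * Q b e) / r b"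
    and network_exists: "\<exists>z\<in>cycles_in E. \<forall>c\<in>cycles_in E. (\<Sum>e\<in>E. (V e - r e * z e) * c e) = 0"
proof -
  define \<Delta> where "\<Delta> = (\<Sum>T | max_forest T. weight r T)"
  have \<Delta>: "\<Delta> > 0" unfolding \<Delta>_def by (rule total_weight_pos[OF r])
  have Q: "Q b e = (\<Sum>T | max_forest T. (weight r T / \<Delta>) * fundamental_cycle T b e)" for b e
    by (simp add: Q_def \<Delta>_def sum_divide_distrib)
  have cycle: "Q b \<in> cycles_in E" if "b \<in> E" for b
    using cyc_sum[of "{T. max_forest T}" "\<lambda>T. fundamental_cycle T b" E "\<lambda>T. weight r T / \<Delta>"] fundamental_cycle_cycle that
    unfolding Q by auto
  have sym: "r e * Q b e = r b * Q e b" if "b \<in> E" "e \<in> E" for b e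
    using weighted_fundamental_cycle_symmetric[of r b e, OF r that] by (simp add: Q_def)
  have retract: "(\<Sum>b\<in>E. c b * Q b e) = c e" if c: "c \<in> cycles_in E" for c e
  proof -
    have "(\<Sum>b\<in>E. c b * Q b e) = (\<Sum>T | max_forest T. (weight r T / \<Delta>) * (\<Sum>b\<in>E. c b * fundamental_cycle T b e))"
      unfolding Q sum_distrib_left by (subst sum.swap) (simp add: algebra_simps)
    also have "\<dots> = (\<Sum>T | max_forest T. (weight r T / \<Delta>) * c e)"
      using fundamental_cycle_retraction[OF _ c] by (intro sum.cong) auto
    also have "\<dots> = c e"
      using \<Delta> by (simp flip: sum_distrib_right sum_divide_distrib add: \<Delta>_def[symmetric])
    finally show ?thesis .
  qed
  show "z b = (\<Sum>e\<in>E. V e * Q b e) / r b"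
    if z: "z \<in> cycles_in E" and orth: "\<And>c. c \<in> cycles_in E \<Longrightarrow> (\<Sum>e\<in>E. (V e - r e * z e) * c e) = 0" and b: "b \<in> E" for z b
  proof -
    have "(\<Sum>e\<in>E. V e * Q b e) = (\<Sum>e\<in>E. r e * z e * Q b e)"
      using orth[OF cycle[OF b]] by (simp add: left_diff_distrib sum_subtractf)
    also have "\<dots> = (\<Sum>e\<in>E. r b * (z e * Q e b))"
      using sym[OF b] by (intro sum.cong) (auto simp: mult.commute mult.left_commute)
    also have "\<dots> = r b * z b"
      by (simp add: retract[OF z] flip: sum_distrib_left)
    finally show ?thesis using r[OF b] by simp
  qed
  define z where "z b = (\<Sum>e\<in>E. (V e / r e) * Q e b)" for b
  have z: "z \<in> cycles_in E" unfolding z_def by (intro cyc_sum cycle)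
  have rz: "r b * z b = (\<Sum>e\<in>E. V e * Q b e)" if b: "b \<in> E" for b
    unfolding z_def sum_distrib_left
  proof (rule sum.cong[OF refl])
    fix e assume e: "e \<in> E"
    show "r b * (V e / r e * Q e b) = V e * Q b e"
      using sym[OF b e] r[OF e] by (simp add: field_simps)
  qed
  have "(\<Sum>e\<in>E. (V e - r e * z e) * c e) = 0" if c: "c \<in> cycles_in E" for c
  proof -
    have "(\<Sum>b\<in>E. (r b * z b) * c b) = (\<Sum>b\<in>E. \<Sum>e\<in>E. V e * (c b * Q b e))"
      using rz by (intro sum.cong) (auto simp: sum_distrib_left mult_ac)
    also have "\<dots> = (\<Sum>e\<in>E. V e * c e)"
      by (subst sum.swap) (simp add: retract[OF c] flip: sum_distrib_left)
    finally show ?thesis by (simp add: left_diff_distrib sum_subtractf)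
  qed
  then show "\<exists>z\<in>cycles_in E. \<forall>c\<in>cycles_in E. (\<Sum>e\<in>E. (V e - r e * z e) * c e) = 0" using z by blast
qed

end

section \<open>Quotients of integer lattices\<close>

definition lattice_group :: "('f \<Rightarrow> int) set \<Rightarrow> ('f \<Rightarrow> int) monoid" where
  "lattice_group Z = \<lparr>carrier = Z, monoid.mult = (\<lambda>c c' e. c e + c' e), one = (\<lambda>_. 0)\<rparr>"

lemma lattice_group_simps [simp]:
  "carrier (lattice_group Z) = Z" "x \<otimes>\<^bsub>lattice_group Z\<^esub> y = (\<lambda>e. x e + y e)" "\<one>\<^bsub>lattice_group Z\<^esub> = (\<lambda>_. 0)"
  by (simp_all add: lattice_group_def)

lemma comm_group_lattice_group:
  assumes "int_lattice Z"
  shows "comm_group (lattice_group Z)"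
proof (rule comm_groupI)
  fix x assume "x \<in> carrier (lattice_group Z)"
  then show "\<exists>y\<in>carrier (lattice_group Z). y \<otimes>\<^bsub>lattice_group Z\<^esub> x = \<one>\<^bsub>lattice_group Z\<^esub>"
    using int_lattice_uminus[OF assms] by (intro bexI[of _ "\<lambda>e. - x e"]) auto
qed (use int_lattice_zero[OF assms] int_lattice_add[OF assms] in \<open>auto simp: algebra_simps\<close>)

lemma lattice_group_int_pow:
  assumes "int_lattice Z" "x \<in> Z"
  shows "x [^]\<^bsub>lattice_group Z\<^esub> (k::int) = (\<lambda>f. k * x f)"
proof -
  interpret comm_group "lattice_group Z" by (rule comm_group_lattice_group[OF assms(1)])
  have x: "x \<in> carrier (lattice_group Z)" using assms by simp
  have nat: "x [^]\<^bsub>lattice_group Z\<^esub> (n::nat) = (\<lambda>f. int n * x f)" for n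
    by (induction n) (auto simp: algebra_simps)
  have inv: "inv\<^bsub>lattice_group Z\<^esub> (\<lambda>f. int n * x f) = (\<lambda>f. - int n * x f)" for n
    using int_lattice_scale[OF assms, of "int n"] int_lattice_scale[OF assms, of "- int n"]
    by (intro inv_equality) auto
  show ?thesis
  proof (cases "k \<ge> 0")
    case True
    then show ?thesis using nat[of "nat k"] by (simp add: int_pow_def nat_pow_def)
  next
    case False
    then show ?thesis
      using int_pow_neg_int[OF x, of "nat (- k)"] nat[of "nat (- k)"] inv[of "nat (- k)"] by simp
  qed
qed

lemma finprod_lattice_group:
  assumes "int_lattice Z" "v \<in> X \<rightarrow> Z" "finite X"
  shows "finprod (lattice_group Z) v X = (\<lambda>f. \<Sum>x\<in>X. v x f)"
  using assms(3,2)
proof (induction X rule: finite_induct)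
  case (insert x X)
  interpret comm_group "lattice_group Z" by (rule comm_group_lattice_group[OF assms(1)])
  show ?case using insert by (subst finprod_insert) auto
next
  case empty
  interpret comm_group "lattice_group Z" by (rule comm_group_lattice_group[OF assms(1)])
  show ?case by simp
qed

definition independent_mod :: "('f \<Rightarrow> int) set \<Rightarrow> ('f \<Rightarrow> int) set \<Rightarrow> bool" where
  "independent_mod L X \<longleftrightarrow>
     (\<forall>n::('f \<Rightarrow> int) \<Rightarrow> int. (\<lambda>f. \<Sum>x\<in>X. n x * x f) \<in> L \<longrightarrow> (\<forall>x\<in>X. n x = 0))"

lemma independent_modD:
  "independent_mod L X \<Longrightarrow> (\<lambda>f. \<Sum>x\<in>X. n x * x f) \<in> L \<Longrightarrow> x \<in> X \<Longrightarrow> n x = 0"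
  by (simp add: independent_mod_def)

locale lattice_quotient =
  fixes Z L :: "('f \<Rightarrow> int) set"
  assumes Z: "int_lattice Z" and L: "int_lattice L" and LZ: "L \<subseteq> Z"
begin

abbreviation "G \<equiv> lattice_group Z"
abbreviation "Q \<equiv> lattice_group Z Mod L"

sublocale G: comm_group G
  by (rule comm_group_lattice_group[OF Z])

lemma subgroup_L: "subgroup L G"
proof (rule G.subgroupI)
  show "L \<noteq> {}" using int_lattice_zero[OF L] by blast
  show "inv\<^bsub>G\<^esub> a \<in> L" if "a \<in> L" for a
  proof -
    have "inv\<^bsub>G\<^esub> a = (\<lambda>f. - a f)"
      using that LZ int_lattice_uminus[OF Z, of a] by (intro G.inv_equality) auto
    then show ?thesis using int_lattice_uminus[OF L that] by simp
  qed
  show "a \<otimes>\<^bsub>G\<^esub> b \<in> L" if "a \<in> L" "b \<in> L" for a b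
    using int_lattice_add[OF L that] by simp
qed (use LZ in auto)

sublocale Q: comm_group Q
  by (rule G.abelian_FactGroup[OF subgroup_L])

lemma r_coset_eq: "L #>\<^bsub>G\<^esub> z = lattice_coset L z"
  by (auto simp: r_coset_def lattice_coset_def)

lemma carrier_Q: "carrier Q = lattice_coset L ` Z"
  by (auto simp: carrier_FactGroup r_coset_eq)

lemma coset_eq_one_iff: "lattice_coset L z = \<one>\<^bsub>Q\<^esub> \<longleftrightarrow> z \<in> L"
proof -
  have "L = lattice_coset L (\<lambda>_. 0)" by (auto simp: lattice_coset_def)
  then show ?thesis using lattice_coset_eq_iff[OF L, of z "\<lambda>_. 0"] by simp
qed

lemma coset_hom: "lattice_coset L \<in> hom G Q"
proof -
  have "normal L G" by (simp add: G.normal_iff_subgroup subgroup_L)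
  from normal.r_coset_hom_Mod[OF this] show ?thesis by (simp add: r_coset_eq)
qed

sublocale coset: group_hom G Q "lattice_coset L"
  by unfold_locales (rule coset_hom)

lemma coset_int_pow: "z \<in> Z \<Longrightarrow> lattice_coset L z [^]\<^bsub>Q\<^esub> (k::int) = lattice_coset L (\<lambda>f. k * z f)"
  using coset.hom_int_pow[of z k] by (simp add: lattice_group_int_pow[OF Z])

lemma torsion_subgroup_Q:
  "torsion_subgroup Q = lattice_coset L ` {z \<in> Z. \<exists>k::int. k > 0 \<and> (\<lambda>f. k * z f) \<in> L}"
proof -
  have "(\<exists>n::nat. n > 0 \<and> lattice_coset L z [^]\<^bsub>Q\<^esub> n = \<one>\<^bsub>Q\<^esub>) \<longleftrightarrow> (\<exists>k::int. k > 0 \<and> (\<lambda>f. k * z f) \<in> L)"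
    if "z \<in> Z" for z
  proof -
    have "lattice_coset L z [^]\<^bsub>Q\<^esub> n = \<one>\<^bsub>Q\<^esub> \<longleftrightarrow> (\<lambda>f. int n * z f) \<in> L" for n :: nat
      using coset_int_pow[OF that, of "int n"] coset_eq_one_iff by (simp add: int_pow_int)
    then show ?thesis
      by (metis int_nat_eq less_imp_le of_nat_0_less_iff zero_less_nat_eq)
  qed
  then show ?thesis unfolding torsion_subgroup_def carrier_Q by (intro equalityI subsetI) blast+
qed

lemma finprod_cosets:
  assumes "finite X" "X \<subseteq> Z" "inj_on (lattice_coset L) X"
  shows "finprod Q (\<lambda>C. C [^]\<^bsub>Q\<^esub> n C) (lattice_coset L ` X)
    = lattice_coset L (\<lambda>f. \<Sum>x\<in>X. n (lattice_coset L x) * x f)"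
proof -
  have cl: "lattice_coset L x \<in> carrier Q" if "x \<in> Z" for x
    unfolding carrier_Q using that by blast
  have "finprod Q (\<lambda>C. C [^]\<^bsub>Q\<^esub> n C) (lattice_coset L ` X)
    = finprod Q (\<lambda>x. lattice_coset L x [^]\<^bsub>Q\<^esub> n (lattice_coset L x)) X"
    using assms(2,3) cl by (intro Q.finprod_reindex) blast+
  also have "\<dots> = finprod Q (\<lambda>x. lattice_coset L (\<lambda>f. n (lattice_coset L x) * x f)) X"
    using assms(2) by (intro Q.finprod_cong' refl Pi_I cl int_lattice_scale[OF Z] coset_int_pow) blast+
  also have "\<dots> = lattice_coset L (finprod G (\<lambda>x f. n (lattice_coset L x) * x f) X)"
    using assms(2) int_lattice_scale[OF Z]
    by (intro hom_finprod[OF G.comm_group_axioms Q.comm_group_axioms coset_hom,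
          where f="\<lambda>x f. n (lattice_coset L x) * x f", symmetric]) auto
  also have "finprod G (\<lambda>x f. n (lattice_coset L x) * x f) X = (\<lambda>f. \<Sum>x\<in>X. n (lattice_coset L x) * x f)"
    using assms int_lattice_scale[OF Z] by (intro finprod_lattice_group Z) auto
  finally show ?thesis .
qed

lemma independent_cosets_iff:
  assumes "finite X" "X \<subseteq> Z" "inj_on (lattice_coset L) X"
  shows "int_independent Q (lattice_coset L ` X) \<longleftrightarrow> independent_mod L X"
proof
  assume ind: "int_independent Q (lattice_coset L ` X)"
  show "independent_mod L X"
    unfolding independent_mod_def
  proof (intro allI impI)
    fix n assume n: "(\<lambda>f. \<Sum>x\<in>X. n x * x f) \<in> L"
    define m where "m C = n (inv_into X (lattice_coset L) C)" for C
    have mn: "m (lattice_coset L x) = n x" if "x \<in> X" for x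
      using assms(3) that by (simp add: m_def)
    have "finprod Q (\<lambda>C. C [^]\<^bsub>Q\<^esub> m C) (lattice_coset L ` X) = \<one>\<^bsub>Q\<^esub>"
      unfolding finprod_cosets[OF assms] coset_eq_one_iff using n mn by simp
    then have "\<forall>C\<in>lattice_coset L ` X. m C = 0" using ind unfolding int_independent_def by blast
    then show "\<forall>x\<in>X. n x = 0" using mn by auto
  qed
next
  assume ind: "independent_mod L X"
  show "int_independent Q (lattice_coset L ` X)"
    unfolding int_independent_def
  proof (intro allI impI)
    fix m :: "('f \<Rightarrow> int) set \<Rightarrow> int" assume "finprod Q (\<lambda>C. C [^]\<^bsub>Q\<^esub> m C) (lattice_coset L ` X) = \<one>\<^bsub>Q\<^esub>"
    then have "(\<lambda>f. \<Sum>x\<in>X. m (lattice_coset L x) * x f) \<in> L"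
      unfolding finprod_cosets[OF assms] coset_eq_one_iff .
    with ind[unfolded independent_mod_def, rule_format, of "\<lambda>x. m (lattice_coset L x)"]
    show "\<forall>C\<in>lattice_coset L ` X. m C = 0" by blast
  qed
qed

lemma independent_mod_inj:
  assumes "finite X" "independent_mod L X"
  shows "inj_on (lattice_coset L) X"
proof (rule inj_onI, rule ccontr)
  fix x y assume xy: "x \<in> X" "y \<in> X" "lattice_coset L x = lattice_coset L y" "x \<noteq> y"
  define n where "n z = (if z = x then 1 else 0) - (if z = y then 1 else (0::int))" for z
  have "(\<Sum>z\<in>X. n z * z f) = x f - y f" for f
    using assms(1) xy by (simp add: n_def left_diff_distrib sum_subtractf if_distrib[of "\<lambda>c. c * _"] cong: if_cong)
  then have "(\<lambda>f. \<Sum>z\<in>X. n z * z f) \<in> L" using xy(3) by (simp add: lattice_coset_eq_iff[OF L])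
  then have "n x = 0" using assms(2) xy(1) unfolding independent_mod_def by blast
  then show False using xy(4) by (simp add: n_def)
qed

text \<open>Independent sets in the quotient lift to independent sets of representatives of the same size,
so ranks can be compared without leaving \<open>Z\<close>.\<close>

lemma abelian_rank_Q:
  "abelian_rank Q = Max {card X |X. finite X \<and> X \<subseteq> Z \<and> independent_mod L X}"
proof -
  have "{card S |S. finite S \<and> S \<subseteq> carrier Q \<and> int_independent Q S}
    = {card X |X. finite X \<and> X \<subseteq> Z \<and> independent_mod L X}" (is "?A = ?B")
  proof (intro equalityI subsetI)
    fix m assume "m \<in> ?A"
    then obtain S where S: "m = card S" "finite S" "S \<subseteq> lattice_coset L ` Z" "int_independent Q S"
      unfolding carrier_Q by blast
    from S(3)[unfolded subset_image_inj] obtain X where X: "X \<subseteq> Z" "inj_on (lattice_coset L) X" "S = lattice_coset L ` X"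
      by blast
    then have "finite X" using S(2) finite_imageD by blast
    then have "independent_mod L X" using independent_cosets_iff X S(4) by blast
    moreover have "m = card X" unfolding S(1) X(3) by (rule card_image[OF X(2)])
    ultimately show "m \<in> ?B" using X(1) \<open>finite X\<close> by blast
  next
    fix m assume "m \<in> ?B"
    then obtain X where X: "m = card X" "finite X" "X \<subseteq> Z" "independent_mod L X" by blast
    note inj = independent_mod_inj[OF X(2,4)]
    have "int_independent Q (lattice_coset L ` X)" using independent_cosets_iff[OF X(2,3) inj] X(4) by blast
    moreover have "m = card (lattice_coset L ` X)" unfolding X(1) by (rule card_image[OF inj, symmetric])
    moreover have "lattice_coset L ` X \<subseteq> carrier Q" unfolding carrier_Q using X(3) by blast
    ultimately show "m \<in> ?A" using X(2) by blast
  qed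
  then show ?thesis unfolding abelian_rank_def by simp
qed

end

lemma trivial_lattice_group_Mod:
  assumes "int_lattice Z"
  shows "trivial_group (lattice_group Z Mod {\<lambda>_. 0}) \<longleftrightarrow> Z = {\<lambda>_. 0}"
proof -
  have zero: "int_lattice {\<lambda>_. 0}" by (auto simp: int_lattice_def)
  interpret lattice_quotient Z "{\<lambda>_. 0}"
    by unfold_locales (use assms zero int_lattice_zero in auto)
  have "trivial_group Q \<longleftrightarrow> carrier Q = {\<one>\<^bsub>Q\<^esub>}"
    by (auto simp: trivial_group_def)
  also have "\<dots> \<longleftrightarrow> (\<forall>z\<in>Z. lattice_coset {\<lambda>_. 0} z = \<one>\<^bsub>Q\<^esub>)"
    using int_lattice_zero[OF assms] unfolding carrier_Q by blast
  also have "\<dots> \<longleftrightarrow> Z = {\<lambda>_. 0}"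
    unfolding coset_eq_one_iff using int_lattice_zero[OF assms] by auto
  finally show ?thesis .
qed

lemma card_independent_mod_le:
  assumes "finite F" "\<And>z f. z \<in> Z \<Longrightarrow> f \<notin> F \<Longrightarrow> z f = 0" "int_lattice L" "finite X" "X \<subseteq> Z" "independent_mod L X"
  shows "card X \<le> card F"
proof (rule ccontr)
  assume "\<not> ?thesis"
  then have "card F < card X" by simp
  from integer_relation[OF assms(1,4) disjI1[OF this], of "\<lambda>x. x"]
  obtain n :: "('a \<Rightarrow> int) \<Rightarrow> int" where n: "\<exists>x\<in>X. n x \<noteq> 0" "\<forall>f\<in>F. (\<Sum>x\<in>X. n x * x f) = 0" by blast
  have "(\<Sum>x\<in>X. n x * x f) = 0" for f
  proof (cases "f \<in> F")
    case False
    then show ?thesis using assms(2,5) by (intro sum.neutral) auto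
  qed (use n in auto)
  then have "(\<lambda>f. \<Sum>x\<in>X. n x * x f) \<in> L" using int_lattice_zero[OF assms(3)] by simp
  then show False using assms(6) n(1) unfolding independent_mod_def by blast
qed

text \<open>If \<open>L'\<close> is torsion modulo \<open>L\<close>, the same sets are independent for both. Otherwise an element of \<open>L'\<close> of
infinite order modulo \<open>L\<close> enlarges a maximal set that is independent modulo \<open>L'\<close>; the finite set \<open>F\<close>
bounds the sizes, so that the maximum exists.\<close>

lemma abelian_rank_Mod_eq_iff:
  assumes Z: "int_lattice Z" and F: "finite F" "\<And>z f. z \<in> Z \<Longrightarrow> f \<notin> F \<Longrightarrow> z f = 0"
    and L: "int_lattice L" and L': "int_lattice L'" and LL': "L \<subseteq> L'" and L'Z: "L' \<subseteq> Z"
  shows "abelian_rank (lattice_group Z Mod L) = abelian_rank (lattice_group Z Mod L')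
    \<longleftrightarrow> (\<forall>x\<in>L'. \<exists>k::int. k > 0 \<and> (\<lambda>f. k * x f) \<in> L)"
proof
  interpret L: lattice_quotient Z L using Z L LL' L'Z by unfold_locales auto
  interpret L': lattice_quotient Z L' using Z L' L'Z by unfold_locales auto
  let ?A = "\<lambda>L. {card X |X. finite X \<and> X \<subseteq> Z \<and> independent_mod L X}"
  have fin: "finite (?A M)" if "int_lattice M" for M
    using card_independent_mod_le[where F=F and Z=Z and L=M] F that by (intro finite_subset[of "?A M" "{..card F}"]) blast+
  have ne: "?A M \<noteq> {}" for M
  proof -
    have "card {} \<in> ?A M" by (intro CollectI exI[of _ "{}"]) (simp add: independent_mod_def)
    then show ?thesis by blast
  qed
  {
    assume eq: "abelian_rank (lattice_group Z Mod L) = abelian_rank (lattice_group Z Mod L')"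
    show "\<forall>x\<in>L'. \<exists>k::int. k > 0 \<and> (\<lambda>f. k * x f) \<in> L"
    proof (rule ccontr)
      assume "\<not> ?thesis"
      then obtain b where b: "b \<in> L'" "\<And>k::int. k > 0 \<Longrightarrow> (\<lambda>f. k * b f) \<notin> L" by blast
      have b0: "k = 0" if "(\<lambda>f. k * b f) \<in> L" for k :: int
      proof (rule ccontr)
        assume "k \<noteq> 0"
        moreover have "(\<lambda>f. (- k) * b f) \<in> L" using int_lattice_uminus[OF L that] by simp
        ultimately show False using b(2)[of k] b(2)[of "- k"] that by (cases "k > 0") auto
      qed
      have "Max (?A L') \<in> ?A L'" using fin[OF L'] ne by (rule Max_in)
      then obtain X where X: "Max (?A L') = card X" "finite X" "X \<subseteq> Z" "independent_mod L' X" by blast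
      have "b \<notin> X"
      proof
        assume "b \<in> X"
        have "(\<Sum>x\<in>X. (if x = b then 1 else 0) * x f) = b f" for f
          using X(2) \<open>b \<in> X\<close> by (simp add: if_distrib[of "\<lambda>c. c * _"] cong: if_cong)
        then have "(\<lambda>f. \<Sum>x\<in>X. (if x = b then 1 else 0) * x f) \<in> L'" using b(1) by simp
        from independent_modD[OF X(4) this \<open>b \<in> X\<close>] show False by simp
      qed
      have "independent_mod L (insert b X)"
        unfolding independent_mod_def
      proof (intro allI impI)
        fix n :: "('a \<Rightarrow> int) \<Rightarrow> int"
        assume "(\<lambda>f. \<Sum>x\<in>insert b X. n x * x f) \<in> L"
        then have sum: "(\<lambda>f. n b * b f + (\<Sum>x\<in>X. n x * x f)) \<in> L"
          using X(2) \<open>b \<notin> X\<close> by simp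
        from int_lattice_lin[OF L' subsetD[OF LL' this] b(1), of "- n b"]
        have "(\<lambda>f. \<Sum>x\<in>X. n x * x f) \<in> L'" by simp
        then have nX: "n x = 0" if "x \<in> X" for x using that by (rule independent_modD[OF X(4)])
        then have "(\<Sum>x\<in>X. n x * x f) = 0" for f by (intro sum.neutral) simp
        then have "(\<lambda>f. n b * b f) \<in> L" using sum by simp
        then have "n b = 0" by (rule b0)
        then show "\<forall>x\<in>insert b X. n x = 0" using nX by blast
      qed
      moreover have "insert b X \<subseteq> Z" using X(3) b(1) L'Z by blast
      ultimately have "card (insert b X) \<in> ?A L" using X(2) by blast
      then have "card (insert b X) \<le> Max (?A L)" using fin[OF L] by (rule Max_ge[rotated])
      moreover have "Max (?A L) = card X"
        using eq X(1) unfolding L.abelian_rank_Q L'.abelian_rank_Q by (rule trans)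
      moreover have "card (insert b X) = Suc (card X)" using X(2) \<open>b \<notin> X\<close> by (rule card_insert_disjoint)
      ultimately show False by linarith
    qed
  }
  {
    assume tors: "\<forall>x\<in>L'. \<exists>k::int. k > 0 \<and> (\<lambda>f. k * x f) \<in> L"
    have "independent_mod L X \<longleftrightarrow> independent_mod L' X" for X
    proof
      assume ind: "independent_mod L X"
      show "independent_mod L' X"
        unfolding independent_mod_def
      proof (intro allI impI)
        fix n assume n: "(\<lambda>f. \<Sum>x\<in>X. n x * x f) \<in> L'"
        from bspec[OF tors n]
        obtain k :: int where k: "k > 0" "(\<lambda>f. k * (\<Sum>x\<in>X. n x * x f)) \<in> L" by (elim exE conjE)
        then have "(\<lambda>f. \<Sum>x\<in>X. (k * n x) * x f) \<in> L" by (simp add: sum_distrib_left mult.assoc)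
        then have "k * n x = 0" if "x \<in> X" for x
          using that by (rule independent_modD[OF ind, of "\<lambda>x. k * n x"])
        then show "\<forall>x\<in>X. n x = 0" using k(1) by simp
      qed
    next
      assume "independent_mod L' X"
      then show "independent_mod L X"
        unfolding independent_mod_def using subsetD[OF LL'] by (intro allI impI) (elim allE impE, assumption)
    qed
    then show "abelian_rank (lattice_group Z Mod L) = abelian_rank (lattice_group Z Mod L')"
      unfolding L.abelian_rank_Q L'.abelian_rank_Q by (simp only:)
  }
qed

context cell_matrix
begin

lemma theta_eq_card_torsion: "theta S = card (torsion_subgroup (lattice_group Z Mod boundaries_in S))"
proof -
  interpret lattice_quotient Z "boundaries_in S"
    by unfold_locales (rule lattice_Z int_lattice_bnd bnd_subset_Z)+
  show ?thesis unfolding theta_def torsion_def torsion_subgroup_Q ..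
qed

text \<open>The Betti number condition. Ranks agree exactly when the boundary of each cell outside \<open>S\<close> is torsion modulo
the boundaries of \<open>S\<close>, which means that this cell closes a circuit.\<close>

lemma max_forest_iff_rank:
  assumes S: "S \<subseteq> E"
  shows "max_forest S \<longleftrightarrow> (cycles_in S :: ('e \<Rightarrow> int) set) = {\<lambda>_. 0} \<and>
    abelian_rank (lattice_group Z Mod boundaries_in S) = abelian_rank (lattice_group Z Mod boundaries_in E)"
proof (cases "(cycles_in S :: ('e \<Rightarrow> int) set) = {\<lambda>_. 0}")
  case True
  let ?R = "\<lambda>x. \<exists>k::int. k > 0 \<and> (\<lambda>f. k * x f) \<in> boundaries_in S"
  have cell_boundary: "?R (cell_boundary b) \<longleftrightarrow> (cycles_in (insert b S) :: ('e \<Rightarrow> int) set) \<noteq> {\<lambda>_. 0}" if b: "b \<in> E - S" for b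
  proof
    assume "?R (cell_boundary b)"
    then obtain k :: int where k: "k > 0" "(\<lambda>f. k * cell_boundary b f) \<in> boundaries_in S" by blast
    have "b \<notin> S" using b by blast
    from k(2)[unfolded scaled_boundary_iff[OF this]]
    obtain c :: "'e \<Rightarrow> int" where "c \<in> cycles_in (insert b S)" "c b = k" by blast
    with k(1) have "c \<in> cycles_in (insert b S)" "c b > 0" by simp_all
    then have "c \<in> cycles_in (insert b S)" "c \<noteq> (\<lambda>_. 0)" by auto
    then show "(cycles_in (insert b S) :: ('e \<Rightarrow> int) set) \<noteq> {\<lambda>_. 0}" by blast
  next
    assume *: "(cycles_in (insert b S) :: ('e \<Rightarrow> int) set) \<noteq> {\<lambda>_. 0}"
    have bS: "b \<notin> S" using b by blast
    obtain c where c: "is_circuit (insert b S) c" "c b \<noteq> 0"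
      using circuit_exists[OF bS True *] by blast
    then have c': "c \<in> cycles_in (insert b S)" unfolding is_circuit_def by blast
    have "(\<lambda>e. sgn (c b) * c e) \<in> cycles_in (insert b S)" by (rule cyc_scale[OF c'])
    moreover have "sgn (c b) * c b = \<bar>c b\<bar>" by (simp add: abs_sgn mult.commute)
    ultimately have "(\<lambda>f. \<bar>c b\<bar> * cell_boundary b f) \<in> boundaries_in S"
      unfolding scaled_boundary_iff[OF bS] by (intro bexI[of _ "\<lambda>e. sgn (c b) * c e"])
    then show "?R (cell_boundary b)" using c(2) by (intro exI[of _ "\<bar>c b\<bar>"]) auto
  qed
  have cell_boundary_in: "cell_boundary b \<in> boundaries_in U" if "b \<in> U" for b U
    unfolding cell_boundary_def boundaries_in_def using that by (intro imageI) auto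
  have lin: "?R (\<lambda>f. x f + j * y f)" if R: "?R x" "?R y" for x y and j :: int
  proof -
    obtain k l where kl: "k > 0" "(\<lambda>f. k * x f) \<in> boundaries_in S" "l > 0" "(\<lambda>f. l * y f) \<in> boundaries_in S" using R by blast
    have "(\<lambda>f. l * (k * x f) + (k * j) * (l * y f)) \<in> boundaries_in S"
      by (intro int_lattice_lin int_lattice_scale int_lattice_bnd kl)
    then have "(\<lambda>f. (k * l) * (x f + j * y f)) \<in> boundaries_in S" by (simp add: algebra_simps)
    then show ?thesis using kl by (intro exI[of _ "k * l"]) auto
  qed
  have "(\<forall>x\<in>boundaries_in E. ?R x) \<longleftrightarrow> (\<forall>b\<in>E - S. ?R (cell_boundary b))"
  proof
    assume "\<forall>x\<in>boundaries_in E. ?R x"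
    then show "\<forall>b\<in>E - S. ?R (cell_boundary b)" using cell_boundary_in by blast
  next
    assume R: "\<forall>b\<in>E - S. ?R (cell_boundary b)"
    have "\<forall>x\<in>boundaries_in (S \<union> B). ?R x" if "finite B" "B \<subseteq> E - S" for B
      using that
    proof (induction B rule: finite_induct)
      case empty
      then show ?case by (auto intro!: exI[of _ 1])
    next
      case (insert b B)
      have b: "b \<notin> S \<union> B" using insert by auto
      show ?case
      proof
        fix x assume "x \<in> boundaries_in (S \<union> insert b B)"
        then have "x \<in> boundaries_in (insert b (S \<union> B))" by simp
        then obtain l j where x: "l \<in> boundaries_in (S \<union> B)" "x = (\<lambda>f. l f + j * cell_boundary b f)"
          unfolding bnd_insert[OF b] by blast
        have "?R l" "?R (cell_boundary b)" using insert x(1) R by auto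
        then show "?R x" unfolding x(2) by (rule lin)
      qed
    qed
    from this[of "E - S"] show "\<forall>x\<in>boundaries_in E. ?R x" using finite_E S by (simp add: Un_absorb1)
  qed
  moreover have rank_iff: "abelian_rank (lattice_group Z Mod boundaries_in S) = abelian_rank (lattice_group Z Mod boundaries_in E) \<longleftrightarrow> (\<forall>x\<in>boundaries_in E. ?R x)"
    by (rule abelian_rank_Mod_eq_iff[where F=F])
      (use lattice_Z finite_F support_Z int_lattice_bnd bnd_mono[OF S] bnd_subset_Z in blast)+
  ultimately have "abelian_rank (lattice_group Z Mod boundaries_in S) = abelian_rank (lattice_group Z Mod boundaries_in E)
      \<longleftrightarrow> (\<forall>b\<in>E - S. (cycles_in (insert b S) :: ('e \<Rightarrow> int) set) \<noteq> {\<lambda>_. 0})"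
    using cell_boundary by simp
  then show ?thesis unfolding max_forest_def using True S by blast
qed (simp add: max_forest_def)

end

section \<open>Spanning trees of a CW complex\<close>

locale top_dim_cw = finite_cw K for K :: "('p, 'c) cw" +
  fixes d :: nat
  assumes dim_le: "e \<in> cw_cells K \<Longrightarrow> cw_dim K e \<le> d"
begin

abbreviation "E \<equiv> cells_of K (int d)"
abbreviation "F \<equiv> cells_of K (int d - 1)"
abbreviation "Z \<equiv> (cycles K (int d - 1) :: ('c \<Rightarrow> int) set)"

lemma int_lattice_cycles: "int_lattice (cycles K k)"
  unfolding int_lattice_def
proof (intro conjI allI ballI)
  show "(\<lambda>_. 0) \<in> cycles K k" by (auto simp: cycles_def cell_chains_def boundary_def)
  fix a and x y :: "'c \<Rightarrow> int" assume xy: "x \<in> cycles K k" "y \<in> cycles K k"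
  have "boundary K k (\<lambda>e. x e + a * y e) f = boundary K k x f + a * boundary K k y f" for f
    by (auto simp: boundary_def sum_distrib_left sum.distrib algebra_simps)
  then show "(\<lambda>e. x e + a * y e) \<in> cycles K k" using xy by (auto simp: cycles_def cell_chains_def)
qed

lemma boundary_column_cycle:
  "(\<lambda>f. if f \<in> F then \<Sum>e\<in>E. c e * incidence K e f else 0) \<in> Z"
proof -
  let ?x = "\<lambda>f. if f \<in> F then \<Sum>e\<in>E. c e * incidence K e f else 0"
  have "boundary K (int d - 1) ?x g = 0" for g
  proof (cases "g \<in> cells_of K (int d - 2)")
    case True
    have "(\<Sum>f\<in>F. (\<Sum>e\<in>E. c e * incidence K e f) * incidence K f g)
      = (\<Sum>e\<in>E. c e * (\<Sum>f\<in>F. incidence K e f * incidence K f g))"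
      unfolding sum_distrib_left sum_distrib_right by (subst sum.swap) (simp add: mult.assoc)
    also have "\<dots> = 0" using incidence_incidence[OF _ True] by (intro sum.neutral) auto
    finally show ?thesis by (simp add: boundary_def)
  qed (simp add: boundary_def)
  then show ?thesis by (auto simp: cycles_def cell_chains_def)
qed

sublocale cell_matrix E F "incidence K" Z
proof
  show "finite E" "finite F" by (rule finite_cells_of)+
  show "int_lattice Z" by (rule int_lattice_cycles)
  show "z f = 0" if "z \<in> Z" "f \<notin> F" for z f using that by (simp add: cycles_def cell_chains_def)
  show "(\<lambda>f. if f \<in> F then \<Sum>e\<in>E. c e * incidence K e f else 0) \<in> Z" for c
    by (rule boundary_column_cycle)
qed

lemma boundary_eq_bd: "boundary K (int d) = bdry"
  by (rule ext) (simp add: boundary_def bdry_def)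

lemma cycles_eq_cyc: "cycles K (int d) = cycles_in E"
  unfolding cycles_def cell_chains_def boundary_eq_bd cycles_in_def by auto

lemma homology_eq: "cellular_homology K (int d - 1) = lattice_group Z Mod boundaries_in E"
proof -
  have "boundaries K (int d - 1) = boundaries_in E"
    unfolding boundaries_def boundaries_in_def cell_chains_def by (simp add: boundary_eq_bd)
  then show ?thesis
    unfolding cellular_homology_def cycle_group_def lattice_group_def by simp
qed

text \<open>Unlike being a spanning tree, this property passes to the union of a tree with one more top cell,
on which the tree map is defined.\<close>

definition contains_skeleton :: "'c set \<Rightarrow> bool" where
  "contains_skeleton T \<longleftrightarrow> T \<subseteq> cw_cells K \<and> skeleton_cells K (int d - 1) \<subseteq> T"

lemma contains_skeleton_restrict: "contains_skeleton T \<Longrightarrow> cw_with_top_cells K d T"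
  unfolding contains_skeleton_def by unfold_locales (auto intro: dim_le)

context
  fixes T :: "'c set"
  assumes T: "contains_skeleton T"
begin

interpretation T: cw_with_top_cells K d T
  by (rule contains_skeleton_restrict[OF T])

lemma F_subset: "F \<subseteq> T"
  using T cells_of_subset(1)[of "int d - 1"] by (auto simp: contains_skeleton_def)

lemma boundary_restrict_top:
  assumes "\<forall>e. e \<notin> T \<inter> E \<longrightarrow> c e = 0"
  shows "boundary (restrict_cw K T) (int d) c = bdry c"
proof
  fix f
  have "(\<Sum>e\<in>T \<inter> E. c e * of_int (incidence (restrict_cw K T) e f)) = (\<Sum>e\<in>T \<inter> E. c e * of_int (incidence K e f))"
    by (intro sum.cong) (auto simp: T.incidence_restrict)
  also have "\<dots> = (\<Sum>e\<in>E. c e * of_int (incidence K e f))"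
    using assms finite_E by (intro sum.mono_neutral_left) auto
  finally show "boundary (restrict_cw K T) (int d) c f = bdry c f"
    unfolding boundary_def bdry_def T.cells_of_restrict using F_subset by auto
qed

lemma cell_chains_restrict: "c \<in> cell_chains (restrict_cw K T) (int d) \<longleftrightarrow> (\<forall>e. e \<notin> T \<inter> E \<longrightarrow> c e = 0)"
  unfolding cell_chains_def T.cells_of_restrict by blast

lemma cycles_restrict_top: "cycles (restrict_cw K T) (int d) = cycles_in (T \<inter> E)"
  unfolding cycles_def cycles_in_def cell_chains_restrict
  by (intro Collect_cong conj_cong refl) (simp only: boundary_restrict_top)

lemma boundaries_restrict: "boundaries (restrict_cw K T) (int d - 1) = boundaries_in (T \<inter> E)"
proof -
  have "boundaries (restrict_cw K T) (int d - 1) = boundary (restrict_cw K T) (int d) ` cell_chains (restrict_cw K T) (int d)"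
    by (simp add: boundaries_def)
  also have "\<dots> = bdry ` {c. \<forall>e. e \<notin> T \<inter> E \<longrightarrow> c e = 0}"
    using cell_chains_restrict boundary_restrict_top by (intro image_cong) auto
  finally show ?thesis unfolding boundaries_in_def .
qed

lemma cycles_restrict_low: "cycles (restrict_cw K T) (int d - 1) = Z"
proof -
  have low: "cells_of (restrict_cw K T) (int d - 1) = F"
    "cells_of (restrict_cw K T) (int d - 1 - 1) = cells_of K (int d - 1 - 1)"
    by (rule T.cells_of_restrict_low; simp)+
  have "boundary (restrict_cw K T) (int d - 1) = (boundary K (int d - 1) :: ('c \<Rightarrow> int) \<Rightarrow> _)"
  proof (intro ext)
    fix c :: "'c \<Rightarrow> int" and g
    have "(\<Sum>f\<in>F. c f * of_int (incidence (restrict_cw K T) f g)) = (\<Sum>f\<in>F. c f * of_int (incidence K f g))"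
      using F_subset T.incidence_restrict by (intro sum.cong) auto
    then show "boundary (restrict_cw K T) (int d - 1) c g = boundary K (int d - 1) c g"
      unfolding boundary_def low by (simp only:)
  qed
  then show ?thesis
    unfolding cycles_def cell_chains_def low by simp
qed

lemma homology_restrict_low:
  "cellular_homology (restrict_cw K T) (int d - 1) = lattice_group Z Mod boundaries_in (T \<inter> E)"
  unfolding cellular_homology_def cycle_group_def lattice_group_def cycles_restrict_low boundaries_restrict ..

lemma homology_restrict_top:
  "cellular_homology (restrict_cw K T) (int d) = lattice_group (cycles_in (T \<inter> E)) Mod {\<lambda>_. 0}"
proof -
  have "cells_of (restrict_cw K T) (int d + 1) = {}"
    unfolding T.cells_of_restrict using dim_le by (fastforce simp: cells_of_def)
  then have "boundaries (restrict_cw K T) (int d) = {\<lambda>_. 0 :: int}"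
    by (auto simp: boundaries_def cell_chains_def boundary_def fun_eq_iff image_iff)
  then show ?thesis
    unfolding cellular_homology_def cycle_group_def lattice_group_def cycles_restrict_top by (simp only:)
qed

lemma int_lattice_cyc: "int_lattice (cycles_in S)"
  unfolding int_lattice_def
proof (intro conjI allI ballI)
  fix k and x y :: "'c \<Rightarrow> int" assume "x \<in> cycles_in S" "y \<in> cycles_in S"
  from cyc_lin[OF this, of 1 k] show "(\<lambda>f. x f + k * y f) \<in> cycles_in S" by simp
qed (rule cyc_zero)

lemma spanning_tree_contains_skeleton_iff: "spanning_tree K d T \<longleftrightarrow> max_forest (T \<inter> E)"
proof -
  have "T \<subseteq> skeleton_cells K d"
    using T dim_le by (auto simp: contains_skeleton_def skeleton_cells_def)
  then have "subcomplex K T" by (rule T.subcomplex_T)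
  moreover have "skeleton_cells K (int d - 1) \<subseteq> T" using T by (simp add: contains_skeleton_def)
  ultimately show ?thesis
    unfolding spanning_tree_def betti_def homology_restrict_top homology_restrict_low homology_eq
      trivial_lattice_group_Mod[OF int_lattice_cyc] max_forest_iff_rank[OF Int_lower2] by simp
qed

lemma tree_weight_eq: "tree_weight K d r T = weight r (T \<inter> E)"
  unfolding tree_weight_def weight_def torsion_weight_def homology_restrict_low theta_eq_card_torsion
    T.cells_of_restrict ..

lemma circuit_generator_iff:
  "c \<in> carrier (cycle_group (restrict_cw K T) (int d)) \<and>
    generate (cycle_group (restrict_cw K T) (int d)) {c} = carrier (cycle_group (restrict_cw K T) (int d))
   \<longleftrightarrow> is_circuit (T \<inter> E) c"
proof -
  have G: "cycle_group (restrict_cw K T) (int d) = lattice_group (cycles_in (T \<inter> E))"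
    unfolding cycle_group_def lattice_group_def cycles_restrict_top ..
  interpret G: comm_group "lattice_group (cycles_in (T \<inter> E))"
    by (rule comm_group_lattice_group[OF int_lattice_cyc])
  have "generate (lattice_group (cycles_in (T \<inter> E))) {c} = {\<lambda>e. k * c e |k. True}" if "c \<in> cycles_in (T \<inter> E)"
    using G.generate_pow[of c] that by (simp add: lattice_group_int_pow[OF int_lattice_cyc that])
  then show ?thesis unfolding G is_circuit_def by auto
qed

end

lemma tree_cycle_eq:
  assumes T: "contains_skeleton T" and b: "b \<in> E"
  shows "tree_cycle K d T b = fundamental_cycle (T \<inter> E) b"
proof (cases "b \<in> T")
  case True
  then show ?thesis using b by (simp add: tree_cycle_def fundamental_cycle_def)
next
  case False
  have T': "contains_skeleton (insert b T)" using T b cells_of_subset(2) by (auto simp: contains_skeleton_def)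
  have U: "insert b T \<inter> E = insert b (T \<inter> E)" using b by auto
  have "chain_inner K (int d) x (cell_vector b) = x b" for x
    using b finite_E by (simp add: chain_inner_def cell_vector_def if_distrib[of "\<lambda>c. _ * c"] cong: if_cong)
  then show ?thesis
    unfolding tree_cycle_def fundamental_cycle_def Let_def circuit_generator_iff[OF T'] U circuit_def[symmetric]
    using False by simp
qed

lemma spanning_tree_iff: "spanning_tree K d T \<longleftrightarrow> contains_skeleton T \<and> max_forest (T \<inter> E)"
proof -
  have "spanning_tree K d T \<Longrightarrow> contains_skeleton T"
    by (simp add: spanning_tree_def contains_skeleton_def subcomplex_def)
  then show ?thesis using spanning_tree_contains_skeleton_iff by blast
qed

text \<open>A spanning tree is determined by its top cells.\<close>

lemma sum_spanning_trees:
  "(\<Sum>T | spanning_tree K d T. h (T \<inter> E)) = (\<Sum>S | max_forest S. h S)"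
proof (rule sum.reindex_bij_witness[of _ "\<lambda>S. skeleton_cells K (int d - 1) \<union> S" "\<lambda>T. T \<inter> E"])
  have top: "cw_cells K = skeleton_cells K (int d - 1) \<union> E"
    using dim_le by (force simp: skeleton_cells_def cells_of_def)
  fix T assume "T \<in> {T. spanning_tree K d T}"
  then have T: "contains_skeleton T" "max_forest (T \<inter> E)" by (auto simp: spanning_tree_iff)
  show "skeleton_cells K (int d - 1) \<union> T \<inter> E = T" using T(1) top unfolding contains_skeleton_def by blast
  show "T \<inter> E \<in> {S. max_forest S}" using T(2) by simp
next
  have disj: "skeleton_cells K (int d - 1) \<inter> E = {}"
    by (auto simp: skeleton_cells_def cells_of_def)
  fix S assume S: "S \<in> {S. max_forest S}"
  then have "S \<subseteq> E" by (simp add: max_forest_def)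
  then show eq: "(skeleton_cells K (int d - 1) \<union> S) \<inter> E = S" using disj by blast
  have "contains_skeleton (skeleton_cells K (int d - 1) \<union> S)"
    using \<open>S \<subseteq> E\<close> cells_of_subset(2) unfolding contains_skeleton_def by (auto simp: skeleton_cells_def)
  then show "skeleton_cells K (int d - 1) \<union> S \<in> {T. spanning_tree K d T}"
    using S eq by (simp add: spanning_tree_iff)
qed simp

lemma boundary_adjoint_eq:
  "boundary_adjoint K (int d) y = (\<lambda>e. if e \<in> E then \<Sum>f\<in>F. real_of_int (incidence K e f) * y f else 0)"
    (is "_ = ?x")
  unfolding boundary_adjoint_def
proof (rule the_equality)
  have inner: "chain_inner K (int d - 1) (boundary K (int d) c) y = (\<Sum>e\<in>E. c e * ?x e)" for c
  proof -
    have "chain_inner K (int d - 1) (boundary K (int d) c) y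
        = (\<Sum>f\<in>F. \<Sum>e\<in>E. c e * (real_of_int (incidence K e f) * y f))"
      by (simp add: chain_inner_def boundary_def sum_distrib_right mult.assoc)
    also have "\<dots> = (\<Sum>e\<in>E. c e * (\<Sum>f\<in>F. real_of_int (incidence K e f) * y f))"
      by (subst sum.swap) (simp add: sum_distrib_left)
    finally show ?thesis by simp
  qed
  show "?x \<in> cell_chains K (int d) \<and>
        (\<forall>c\<in>cell_chains K (int d). chain_inner K (int d) c ?x = chain_inner K (int d - 1) (boundary K (int d) c) y)"
    unfolding inner by (simp add: chain_inner_def cell_chains_def)
  fix x assume x: "x \<in> cell_chains K (int d) \<and>
        (\<forall>c\<in>cell_chains K (int d). chain_inner K (int d) c x = chain_inner K (int d - 1) (boundary K (int d) c) y)"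
  show "x = ?x"
  proof
    fix e
    show "x e = ?x e"
    proof (cases "e \<in> E")
      case True
      have pick: "(\<Sum>i\<in>E. (if i = e then 1 else 0) * h i) = h e" for h :: "'c \<Rightarrow> real"
        using True finite_E by (simp add: if_distrib[of "\<lambda>c. c * _"] cong: if_cong)
      have "(\<lambda>i. if i = e then 1 else 0) \<in> cell_chains K (int d)" using True by (auto simp: cell_chains_def)
      with x have "chain_inner K (int d) (\<lambda>i. if i = e then 1 else 0) x = (\<Sum>i\<in>E. (if i = e then 1 else 0) * ?x i)"
        unfolding inner by blast
      then show ?thesis unfolding chain_inner_def pick .
    next
      case False
      then have "x e = 0" using x by (simp add: cell_chains_def)
      then show ?thesis using False by simp
    qed
  qed
qed

text \<open>Coboundaries are exactly the chains orthogonal to all cycles.\<close>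

lemma coboundary_iff:
  assumes V: "V \<in> cell_chains K (int d)"
  shows "V - resistance_map K d r z \<in> coboundaries K (int d)
    \<longleftrightarrow> (\<forall>c\<in>cycles_in E. (\<Sum>e\<in>E. (V e - r e * z e) * c e) = 0)"
proof
  assume "V - resistance_map K d r z \<in> coboundaries K (int d)"
  then obtain y where y: "V - resistance_map K d r z = boundary_adjoint K (int d) y"
    by (auto simp: coboundaries_def)
  have Ve: "V e - r e * z e = (\<Sum>f\<in>F. real_of_int (incidence K e f) * y f)" if "e \<in> E" for e
    using fun_cong[OF y, of e] that by (simp add: boundary_adjoint_eq resistance_map_def)
  show "\<forall>c\<in>cycles_in E. (\<Sum>e\<in>E. (V e - r e * z e) * c e) = 0"
  proof
    fix c :: "'c \<Rightarrow> real" assume c: "c \<in> cycles_in E"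
    have "(\<Sum>e\<in>E. (V e - r e * z e) * c e) = (\<Sum>e\<in>E. \<Sum>f\<in>F. y f * (c e * real_of_int (incidence K e f)))"
      by (intro sum.cong) (auto simp: Ve sum_distrib_left mult_ac)
    also have "\<dots> = (\<Sum>f\<in>F. y f * (\<Sum>e\<in>E. c e * real_of_int (incidence K e f)))"
      by (subst sum.swap) (simp add: sum_distrib_left)
    also have "\<dots> = (\<Sum>f\<in>F. y f * bdry c f)" by (intro sum.cong) (auto simp: bdry_def)
    also have "\<dots> = 0" using c by (simp add: cycles_in_def)
    finally show "(\<Sum>e\<in>E. (V e - r e * z e) * c e) = 0" .
  qed
next
  assume orth: "\<forall>c\<in>cycles_in E. (\<Sum>e\<in>E. (V e - r e * z e) * c e) = 0"
  have "\<exists>y. \<forall>e\<in>E. V e - r e * z e = (\<Sum>f\<in>F. real_of_int (incidence K e f) * y f)"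
  proof (rule annihilator_in_row_space[OF finite_F finite_E])
    fix c :: "'c \<Rightarrow> real" assume c: "\<And>f. f \<in> F \<Longrightarrow> (\<Sum>e\<in>E. c e * real_of_int (incidence K e f)) = 0"
    define c' where "c' e = (if e \<in> E then c e else 0)" for e
    have "bdry c' f = (if f \<in> F then \<Sum>e\<in>E. c e * real_of_int (incidence K e f) else 0)" for f
      by (simp add: bdry_def c'_def)
    then have "c' \<in> cycles_in E" using c by (auto simp: cycles_in_def c'_def)
    then have "(\<Sum>e\<in>E. (V e - r e * z e) * c' e) = 0" using orth by blast
    then show "(\<Sum>e\<in>E. c e * (V e - r e * z e)) = 0" by (simp add: c'_def mult.commute)
  qed
  then obtain y where y: "\<And>e. e \<in> E \<Longrightarrow> V e - r e * z e = (\<Sum>f\<in>F. real_of_int (incidence K e f) * y f)" by blast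
  define y' where "y' f = (if f \<in> F then y f else 0)" for f
  have "V - resistance_map K d r z = boundary_adjoint K (int d) y'"
  proof
    fix e
    show "(V - resistance_map K d r z) e = boundary_adjoint K (int d) y' e"
      using V y[of e] by (auto simp: boundary_adjoint_eq resistance_map_def y'_def cell_chains_def)
  qed
  moreover have "y' \<in> cell_chains K (int d - 1)" by (simp add: y'_def cell_chains_def)
  ultimately show "V - resistance_map K d r z \<in> coboundaries K (int d)" by (auto simp: coboundaries_def)
qed

lemma tree_map_cell_vector:
  assumes "b \<in> E"
  shows "tree_map K d T (cell_vector b) = tree_cycle K d T b"
proof
  fix e show "tree_map K d T (cell_vector b) e = tree_cycle K d T b e"
    using assms finite_E by (simp add: tree_map_def cell_vector_def if_distrib[of "\<lambda>c. c * _"] cong: if_cong)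
qed

lemma tree_formula:
  assumes b: "b \<in> E"
  shows "1 / total_tree_weight K d r *
      (\<Sum>T | spanning_tree K d T. tree_weight K d r T / r b * chain_inner K d V (tree_map K d T (cell_vector b)))
    = (\<Sum>e\<in>E. V e * ((\<Sum>S | max_forest S. weight r S * fundamental_cycle S b e) / (\<Sum>S | max_forest S. weight r S))) / r b"
proof -
  define \<Delta> where "\<Delta> = (\<Sum>S | max_forest S. weight r S)"
  have "total_tree_weight K d r = (\<Sum>T | spanning_tree K d T. weight r (T \<inter> E))"
    unfolding total_tree_weight_def by (intro sum.cong) (auto simp: spanning_tree_iff tree_weight_eq)
  then have total: "total_tree_weight K d r = \<Delta>" unfolding sum_spanning_trees \<Delta>_def .
  have "(\<Sum>T | spanning_tree K d T. tree_weight K d r T / r b * chain_inner K d V (tree_map K d T (cell_vector b)))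
    = (\<Sum>T | spanning_tree K d T. weight r (T \<inter> E) / r b * (\<Sum>e\<in>E. V e * fundamental_cycle (T \<inter> E) b e))"
    by (intro sum.cong) (auto simp: spanning_tree_iff tree_weight_eq tree_map_cell_vector[OF b] tree_cycle_eq[OF _ b] chain_inner_def)
  also have "\<dots> = (\<Sum>S | max_forest S. weight r S / r b * (\<Sum>e\<in>E. V e * fundamental_cycle S b e))"
    by (rule sum_spanning_trees)
  also have "\<dots> = (\<Sum>e\<in>E. V e * (\<Sum>S | max_forest S. weight r S * fundamental_cycle S b e)) / r b"
    unfolding sum_distrib_left sum_divide_distrib by (subst sum.swap) (simp add: mult_ac)
  finally show ?thesis
    unfolding total \<Delta>_def[symmetric] by (simp add: sum_divide_distrib sum_distrib_left mult_ac)
qed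

end

theorem mainTheorem2:
  fixes K :: "('p, 'c) cw" and d :: nat and r :: "'c \<Rightarrow> real" and V :: "'c \<Rightarrow> real"
  assumes "cw_complex K"
    and "finite (cw_cells K)"
    and "connected_space (cw_space K)"
    and "has_dimension K d"
    and "d \<ge> 1"
    and "\<forall>b\<in>cells_of K d. r b > 0"
    and "V \<in> cell_chains K d"
  shows "(\<exists>!z. z \<in> cycles K d \<and> V - resistance_map K d r z \<in> coboundaries K d) \<and>
    (\<forall>z. z \<in> cycles K d \<and> V - resistance_map K d r z \<in> coboundaries K d \<longrightarrow>
      (\<forall>b\<in>cells_of K d.
        chain_inner K d z (cell_vector b) =
          1 / total_tree_weight K d r *
          (\<Sum>T | spanning_tree K d T.
             tree_weight K d r T / r b * chain_inner K d V (tree_map K d T (cell_vector b)))))"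
proof -
  interpret top_dim_cw K d
    using assms(1,2,4) by unfold_locales (auto simp: has_dimension_def)
  have r: "r e > 0" if "e \<in> E" for e using assms(6) that by blast
  define sol where "sol z \<longleftrightarrow> z \<in> cycles K d \<and> V - resistance_map K d r z \<in> coboundaries K d" for z
  have sol_iff: "sol z \<longleftrightarrow> z \<in> cycles_in E \<and> (\<forall>c\<in>cycles_in E. (\<Sum>e\<in>E. (V e - r e * z e) * c e) = 0)" for z
    unfolding sol_def cycles_eq_cyc coboundary_iff[OF assms(7)] ..
  have sol_value: "z b = 1 / total_tree_weight K d r * (\<Sum>T | spanning_tree K d T.
             tree_weight K d r T / r b * chain_inner K d V (tree_map K d T (cell_vector b)))"
    if "sol z" "b \<in> E" for z b
    unfolding tree_formula[OF that(2)]
    by (rule network_unique[OF r]) (use that in \<open>auto simp: sol_iff\<close>)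
  have "\<exists>!z. sol z"
  proof -
    obtain z where "sol z" using network_exists[of r V] r unfolding sol_iff by blast
    moreover have "z = z'" if "sol z" "sol z'" for z z'
    proof
      fix b show "z b = z' b"
      proof (cases "b \<in> E")
        case True
        show ?thesis unfolding sol_value[OF that(1) True] sol_value[OF that(2) True] ..
      next
        case False
        have "z \<in> cycles_in E" "z' \<in> cycles_in E" using that by (auto simp: sol_iff)
        then show ?thesis using cyc_support[OF _ False] by metis
      qed
    qed
    ultimately show ?thesis by blast
  qed
  moreover have "chain_inner K d z (cell_vector b) = z b" if "b \<in> E" for z b
    using that finite_E by (simp add: chain_inner_def cell_vector_def if_distrib[of "\<lambda>c. _ * c"] cong: if_cong)
  ultimately show ?thesis
    unfolding sol_def[symmetric] using sol_value by simp
qed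

end
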